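(* Suppose there exists a bounded non-decreasing function $r:[0,\infty]\to\mathbb{R}_+$ with $\lim_{h\searrow 0}r(h)=r(0)=0$ such that $|U^i(s,t,\cdot)-U^i(s',t',\cdot)|\le r(|s-s'|+|t-t'|)$ for all $s,t,s',t'\in[0,\infty]$, $i=1,2$. Fix $\epsilon>0$. With $h$, $\rho_h^i,\tau_h^i$, $\mu_1,\mu_2$, and (for $\delta>0$) $\rho^i_{\mu_i+\delta},\tau^i_{\mu_i+\delta}$ as in the context, define $\rho^*=(\rho_0^*,\rho_1^* )\in\mathfrak{T}$ and $\tau^*=(\tau_0^*,\tau_1^* )\in\mathfrak{T}$ by $$\rho_0^*:=\begin{cases}\mu_1,&\mu_1\le\mu_2,\\ \rho^2_{\mu_2+\delta},&\mu_1>\mu_2,\end{cases}\qquad \rho_1^*(t):=\begin{cases}\rho_h^2(t),&t\ge\mu_1\wedge\mu_2+\delta\text{ and }\mu_1>\mu_2,\\ \rho_h^1(t),&\text{otherwise},\end{cases}$$ $$\tau_0^*:=\begin{cases}\tau^1_{\mu_1+\delta},&\mu_1\le\mu_2,\\ \mu_2,&\mu_1>\mu_2,\end{cases}\qquad \tau_1^*(t):=\begin{cases}\tau_h^1(t),&t\ge\mu_1\wedge\mu_2+\delta\text{ and }\mu_1\le\mu_2,\\ \tau_h^2(t),&\text{otherwise}.\end{cases}$$ Then for all sufficiently small $\delta>0$, $(\rho^*,\tau^* )$ is an $18\epsilon$-Nash equilibrium of the non-zero-sum stopping game with payoffs $u^i(\rho,\tau)=\mathbb{E}[U^i(\rho[\tau],\tau[\rho])]$,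 $i=1,2$. Therefore this game admits an $\epsilon$-Nash equilibrium for every $\epsilon>0$.
   Context: $(\Omega,\mathcal{F},(\mathcal{F}_t)_{t\in[0,\infty]},\mathbb{P})$ is a filtered probability space whose filtration satisfies the usual conditions, with $\mathcal{F}=\mathcal{F}_\infty=\sigma(\bigcup_{t\in[0,\infty)}\mathcal{F}_t)$. $\Omega$ is at most countable and $\mathbb{P}$ is supported on $\Omega$ (every nonempty event has positive probability). $\mathcal{T}$ is the set of stopping times with values in $[0,\infty]$; for $\sigma\in\mathcal{T}$, $\mathcal{T}_\sigma$ (resp. $\mathcal{T}_{\sigma+}$) is the set of stopping times that are no less (resp. strictly greater) than $\sigma$, and $\mathbb{E}_\sigma[\cdot]:=\mathbb{E}[\cdot\,|\,\mathcal{F}_\sigma]$. $\mathbb{T}$ is the set of $\mathcal{B}([0,\infty])\otimes\mathcal{F}$-measurable maps $\phi:[0,\infty]\times\Omega\to[0,\infty]$ with $\phi(t,\cdot)\in\mathcal{T}_{t+}$ for every $t\in[0,\infty)$. For $\sigma\in\mathcal{T}$ and $\phi\in\mathbb{T}$, $\phi(\sigma):=\phi(\sigma(\cdot),\cdot)$. A stopping strategy is a pair $\rho=(\rho_0,\rho_1)$ with $\rho_0\in\mathcal{T}$, $\rho_1\in\mathbb{T}$; $\mathfrak{T}$ is the set of stopping strategies. For $\rho=(\rho_0,\rho_1),\tau=(\tau_0,\tau_1)\in\mathfrak{T}$, $\rho[\tau]:=\rho_0 1_{\{\rho_0\le\tau_0\}}+\rho_1(\tau_0)1_{\{\rho_0>\tau_0\}}$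 (with $0\cdot\infty=0$), and $\tau[\rho]$ is defined by exchanging the roles of $\rho$ and $\tau$. For $i=1,2$, $U^i:[0,\infty)\times[0,\infty)\times\Omega\to\mathbb{R}$ is bounded, $U^i(s,t)=U^i(s,t,\cdot)$ is $\mathcal{F}_{s\vee t}$-measurable for all $s,t$, and for $s,t\in[0,\infty)$ the limits $U^i(s,\infty):=\lim_{b\to\infty}U^i(s,b)$, $U^i(\infty,t):=\lim_{a\to\infty}U^i(a,t)$, $U^i(\infty,\infty):=\lim_{a,b\to\infty}U^i(a,b)$ are assumed to exist; these extend $U^i$ to $[0,\infty]^2\times\Omega$. Convention: $|\infty-\infty|=0$. For $\eta>0$, $(\rho^*,\tau^* )\in\mathfrak{T}^2$ is an $\eta$-Nash equilibrium if $u^1(\rho,\tau^* )\le u^1(\rho^*,\tau^* )+\eta$ and $u^2(\rho^*,\tau)\le u^2(\rho^*,\tau^* )+\eta$ for all $\rho,\tau\in\mathfrak{T}$. For $t\in[0,\infty]$: $X_t^1:=\inf_{\sigma\in\mathcal{T}_t}\mathbb{E}_t[U^1(t,\sigma)]$, $Y_t^1:=\sup_{\sigma\in\mathcal{T}_t}\mathbb{E}_t[U^1(\sigma,t)]$, $Z^1_t:=U^1(t,t)$; $X_t^2:=\sup_{\sigma\in\mathcal{T}_t}\mathbb{E}_t[U^2(t,\sigma)]$, $Y_t^2:=\inf_{\sigma\in\mathcal{T}_t}\mathbb{E}_t[U^2(\sigma,t)]$, $Z_t^2:=U^2(t,t)$. A subscript that is a stopping time means the process evaluated at it. For $h>0$,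 $n\in\mathbb{N}$, $i=1,2$, let $\bar\rho^i(nh),\bar\tau^i(nh)\in\mathcal{T}_{nh}$ be $\epsilon$-optimizers for $Y^i_{nh}$ and $X^i_{nh}$ respectively, i.e. $|\mathbb{E}_{nh}[U^i(\bar\rho^i(nh),nh)]-Y^i_{nh}|\le\epsilon$ and $|\mathbb{E}_{nh}[U^i(nh,\bar\tau^i(nh))]-X^i_{nh}|\le\epsilon$. Define $\rho_h^i(t):=\bar\rho^i(([t/h]+1)h)$, $\tau_h^i(t):=\bar\tau^i(([t/h]+1)h)$ for $t\in[0,\infty)$ ($[\cdot]$ is the integer part), and $\rho_h^i(\infty)=\tau_h^i(\infty)=\infty$. The number $h$ is chosen small enough that $r(h)<\epsilon/3$ and, for $i=1,2$ and all $\rho_0,\tau_0\in\mathcal{T}$, $|X^i_{\rho_0}-\mathbb{E}_{\rho_0}[U^i(\rho_0,\tau_h^i(\rho_0))]|\le2\epsilon$ and $|Y^i_{\tau_0}-\mathbb{E}_{\tau_0}[U^i(\rho_h^i(\tau_0),\tau_0)]|\le2\epsilon$. Let $W_t^1:=\mathbb{E}_t[U^1(t,\tau_h^2(t))]$ and $W_t^2:=\mathbb{E}_t[U^2(\rho_h^1(t),t)]$. For $\sigma\in\mathcal{T}$ and $\rho_0,\tau_0\in\mathcal{T}_\sigma$ put $$J^i_\sigma(\rho_0,\tau_0):=\mathbb{E}_\sigma\left[X^i_{\rho_0}1_{\{\rho_0<\tau_0\}}+Y^i_{\tau_0}1_{\{\rho_0>\tau_0\}}+Z^i_{\rho_0}1_{\{\rho_0=\tau_0\}}\right].$$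 The Dynkin game $G^1_\sigma$ (with $\rho_0$ maximizing and $\tau_0$ minimizing $J^1_\sigma$) has value $v^1_\sigma:=\sup_{\rho_0\in\mathcal{T}_\sigma}\inf_{\tau_0\in\mathcal{T}_\sigma}J^1_\sigma=\inf_{\tau_0\in\mathcal{T}_\sigma}\sup_{\rho_0\in\mathcal{T}_\sigma}J^1_\sigma$, and the Dynkin game $G^2_\sigma$ (with $\rho_0$ minimizing and $\tau_0$ maximizing $J^2_\sigma$) has value $v^2_\sigma:=\inf_{\rho_0\in\mathcal{T}_\sigma}\sup_{\tau_0\in\mathcal{T}_\sigma}J^2_\sigma=\sup_{\tau_0\in\mathcal{T}_\sigma}\inf_{\rho_0\in\mathcal{T}_\sigma}J^2_\sigma$. The processes $(v^i_t)_{t\in[0,\infty]}$ are right continuous. Define the stopping times $$\mu_1:=\inf\{t\ge0:\ v_t^1\le W_t^1+\epsilon\},\qquad \mu_2:=\inf\{t\ge0:\ v_t^2\le W_t^2+\epsilon\}.$$ For $\delta>0$ and $i=1,2$, $(\rho^i_{\mu_i+\delta},\tau^i_{\mu_i+\delta})\in\mathcal{T}_{\mu_i+\delta}^2$ is an $\epsilon$-saddle point of $G^i_{\mu_i+\delta}$. Here an $\epsilon$-saddle point of $G^1_\sigma$ is a pair $(\hat\rho,\hat\tau)\in\mathcal{T}_\sigma^2$ with $J^1_\sigma(\rho_0,\hat\tau)-\epsilon<J^1_\sigma(\hat\rho,\hat\tau)<J^1_\sigma(\hat\rho,\tau_0)+\epsilon$ for all $\rho_0,\tau_0\in\mathcal{T}_\sigma$,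 and an $\epsilon$-saddle point of $G^2_\sigma$ is a pair $(\hat\rho,\hat\tau)\in\mathcal{T}_\sigma^2$ with $J^2_\sigma(\hat\rho,\tau_0)-\epsilon<J^2_\sigma(\hat\rho,\hat\tau)<J^2_\sigma(\rho_0,\hat\tau)+\epsilon$ for all $\rho_0,\tau_0\in\mathcal{T}_\sigma$. *)

theory Defs
  imports "HOL-Probability.Probability"
begin

text \<open>
  The time axis \<open>[0,\<infinity>]\<close> is the type \<^typ>\<open>ennreal\<close>.  Processes, stopping times and strategies are
  total functions on the sample type; only their values on \<^term>\<open>space M\<close> matter.
\<close>

datatype player = P1 | P2

type_synonym 'a stime = "'a \<Rightarrow> ennreal"
type_synonym 'a strategy = "'a stime \<times> (ennreal \<Rightarrow> 'a stime)"
type_synonym 'a payoff = "player \<Rightarrow> ennreal \<Rightarrow> ennreal \<Rightarrow> 'a \<Rightarrow> real"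

section \<open>The filtered space and the payoffs\<close>

text \<open>
  On a space without nonempty null events, almost sure statements hold surely and conditional
  expectations are unique, so (in)equalities between random variables below are pointwise on
  \<^term>\<open>space M\<close>; as the space is moreover countable, essential suprema and infima are pointwise ones.
\<close>

locale countable_filtered_space = prob_space M + filtration "space M" F
  for M :: "'a measure" and F :: "ennreal \<Rightarrow> 'a measure" +
  assumes countable_space: "countable (space M)"
    and full_support: "A \<in> sets M \<Longrightarrow> A \<noteq> {} \<Longrightarrow> 0 < prob A"
    and F_infinity: "sets (F \<infinity>) = sets M"
    and sets_M_eq: "sets M = sigma_sets (space M) (\<Union>t\<in>{..<\<infinity>}. sets (F t))"
    and F_right_continuous: "t < \<infinity> \<Longrightarrow> sets (F t) = (\<Inter>s\<in>{t<..}. sets (F s))"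
    and F_complete: "N \<in> null_sets M \<Longrightarrow> A \<subseteq> N \<Longrightarrow> A \<in> sets (F 0)"

text \<open>
  \<open>U i\<close> is the payoff already extended to \<open>[0,\<infinity>]\<^sup>2\<close>: the three limit assumptions say that the limits
  at infinity along finite times exist and that its values at infinity are these limits.
\<close>

locale stopping_game = countable_filtered_space M F
  for M :: "'a measure" and F :: "ennreal \<Rightarrow> 'a measure" +
  fixes U :: "'a payoff"
  assumes U_bounded: "\<exists>C. \<forall>s<\<infinity>. \<forall>t<\<infinity>. \<forall>\<omega>\<in>space M. \<bar>U i s t \<omega>\<bar> \<le> C"
    and U_measurable: "s < \<infinity> \<Longrightarrow> t < \<infinity> \<Longrightarrow> U i s t \<in> borel_measurable (F (max s t))"
    and U_lim_snd: "s < \<infinity> \<Longrightarrow> \<omega> \<in> space M \<Longrightarrow>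
      ((\<lambda>b::real. U i s (ennreal b) \<omega>) \<longlongrightarrow> U i s \<infinity> \<omega>) at_top"
    and U_lim_fst: "t < \<infinity> \<Longrightarrow> \<omega> \<in> space M \<Longrightarrow>
      ((\<lambda>a::real. U i (ennreal a) t \<omega>) \<longlongrightarrow> U i \<infinity> t \<omega>) at_top"
    and U_lim_both: "\<omega> \<in> space M \<Longrightarrow>
      ((\<lambda>(a::real, b::real). U i (ennreal a) (ennreal b) \<omega>) \<longlongrightarrow> U i \<infinity> \<infinity> \<omega>)
        (at_top \<times>\<^sub>F at_top)"

text \<open>Subtraction on \<^typ>\<open>ennreal\<close> is truncated and has \<open>\<infinity> - \<infinity> = \<infinity>\<close>, whereas \<open>\<bar>\<infinity> - \<infinity>\<bar>\<close> has to be \<open>0\<close>.\<close>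

definition time_dist :: "ennreal \<Rightarrow> ennreal \<Rightarrow> ennreal" where
  "time_dist s t = (if s = t then 0 else max s t - min s t)"

definition payoff_modulus :: "'a measure \<Rightarrow> 'a payoff \<Rightarrow> (ennreal \<Rightarrow> real) \<Rightarrow> bool" where
  "payoff_modulus M U r \<longleftrightarrow>
     (\<forall>x. 0 \<le> r x) \<and> bounded (range r) \<and> mono r \<and> r 0 = 0 \<and> (r \<longlongrightarrow> 0) (at_right 0) \<and>
     (\<forall>i s t s' t'. \<forall>\<omega>\<in>space M.
        \<bar>U i s t \<omega> - U i s' t' \<omega>\<bar> \<le> r (time_dist s s' + time_dist t t'))"

section \<open>Stopping strategies and equilibria\<close>

definition stopping_times :: "(ennreal \<Rightarrow> 'a measure) \<Rightarrow> 'a stime set" where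
  "stopping_times F = {\<sigma>. stopping_time F \<sigma>}"

definition stopping_times_from :: "'a measure \<Rightarrow> (ennreal \<Rightarrow> 'a measure) \<Rightarrow> 'a stime \<Rightarrow> 'a stime set" where
  "stopping_times_from M F \<sigma> = {\<tau>. stopping_time F \<tau> \<and> (\<forall>\<omega>\<in>space M. \<sigma> \<omega> \<le> \<tau> \<omega>)}"

definition stopping_times_after :: "'a measure \<Rightarrow> (ennreal \<Rightarrow> 'a measure) \<Rightarrow> 'a stime \<Rightarrow> 'a stime set" where
  "stopping_times_after M F \<sigma> = {\<tau>. stopping_time F \<tau> \<and> (\<forall>\<omega>\<in>space M. \<sigma> \<omega> < \<tau> \<omega>)}"

definition reactions :: "'a measure \<Rightarrow> (ennreal \<Rightarrow> 'a measure) \<Rightarrow> (ennreal \<Rightarrow> 'a stime) set" where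
  "reactions M F = {\<phi>. (\<lambda>(t, \<omega>). \<phi> t \<omega>) \<in> borel \<Otimes>\<^sub>M M \<rightarrow>\<^sub>M borel \<and>
     (\<forall>t<\<infinity>. \<phi> t \<in> stopping_times_after M F (\<lambda>_. t))}"

definition strategies :: "'a measure \<Rightarrow> (ennreal \<Rightarrow> 'a measure) \<Rightarrow> 'a strategy set" where
  "strategies M F = stopping_times F \<times> reactions M F"

text \<open>\<open>realized \<rho> \<tau>\<close> is \<open>\<rho>[\<tau>]\<close>.\<close>

definition realized :: "'a strategy \<Rightarrow> 'a strategy \<Rightarrow> 'a stime" where
  "realized \<rho> \<tau> \<omega> =
     (if fst \<rho> \<omega> \<le> fst \<tau> \<omega> then fst \<rho> \<omega> else snd \<rho> (fst \<tau> \<omega>) \<omega>)"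

definition expected_payoff :: "'a measure \<Rightarrow> 'a payoff \<Rightarrow> player \<Rightarrow> 'a strategy \<Rightarrow> 'a strategy \<Rightarrow> real" where
  "expected_payoff M U i \<rho> \<tau> = (\<integral>\<omega>. U i (realized \<rho> \<tau> \<omega>) (realized \<tau> \<rho> \<omega>) \<omega> \<partial>M)"

definition nash_equilibrium ::
  "'a measure \<Rightarrow> (ennreal \<Rightarrow> 'a measure) \<Rightarrow> 'a payoff \<Rightarrow> real \<Rightarrow> 'a strategy \<Rightarrow> 'a strategy \<Rightarrow> bool" where
  "nash_equilibrium M F U \<eta> \<rho>' \<tau>' \<longleftrightarrow>
     \<rho>' \<in> strategies M F \<and> \<tau>' \<in> strategies M F \<and>
     (\<forall>\<rho>\<in>strategies M F. expected_payoff M U P1 \<rho> \<tau>' \<le> expected_payoff M U P1 \<rho>' \<tau>' + \<eta>) \<and>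
     (\<forall>\<tau>\<in>strategies M F. expected_payoff M U P2 \<rho>' \<tau> \<le> expected_payoff M U P2 \<rho>' \<tau>' + \<eta>)"

section \<open>The auxiliary Dynkin games\<close>

definition cond_at :: "'a measure \<Rightarrow> (ennreal \<Rightarrow> 'a measure) \<Rightarrow> 'a stime \<Rightarrow> ('a \<Rightarrow> real) \<Rightarrow> 'a \<Rightarrow> real" where
  "cond_at M F \<sigma> f = real_cond_exp M (filtration.pre_sigma (space M) F \<sigma>) f"

primrec X_proc :: "'a measure \<Rightarrow> (ennreal \<Rightarrow> 'a measure) \<Rightarrow> 'a payoff \<Rightarrow> player \<Rightarrow> ennreal \<Rightarrow> 'a \<Rightarrow> real" where
  "X_proc M F U P1 t \<omega> = (INF \<sigma>\<in>stopping_times_from M F (\<lambda>_. t).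
      real_cond_exp M (F t) (\<lambda>\<omega>. U P1 t (\<sigma> \<omega>) \<omega>) \<omega>)"
| "X_proc M F U P2 t \<omega> = (SUP \<sigma>\<in>stopping_times_from M F (\<lambda>_. t).
      real_cond_exp M (F t) (\<lambda>\<omega>. U P2 t (\<sigma> \<omega>) \<omega>) \<omega>)"

primrec Y_proc :: "'a measure \<Rightarrow> (ennreal \<Rightarrow> 'a measure) \<Rightarrow> 'a payoff \<Rightarrow> player \<Rightarrow> ennreal \<Rightarrow> 'a \<Rightarrow> real" where
  "Y_proc M F U P1 t \<omega> = (SUP \<sigma>\<in>stopping_times_from M F (\<lambda>_. t).
      real_cond_exp M (F t) (\<lambda>\<omega>. U P1 (\<sigma> \<omega>) t \<omega>) \<omega>)"
| "Y_proc M F U P2 t \<omega> = (INF \<sigma>\<in>stopping_times_from M F (\<lambda>_. t).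
      real_cond_exp M (F t) (\<lambda>\<omega>. U P2 (\<sigma> \<omega>) t \<omega>) \<omega>)"

definition Z_proc :: "'a payoff \<Rightarrow> player \<Rightarrow> ennreal \<Rightarrow> 'a \<Rightarrow> real" where
  "Z_proc U i t \<omega> = U i t t \<omega>"

definition dynkin_payoff ::
  "'a measure \<Rightarrow> (ennreal \<Rightarrow> 'a measure) \<Rightarrow> 'a payoff \<Rightarrow> player \<Rightarrow> 'a stime \<Rightarrow> 'a stime \<Rightarrow> 'a stime \<Rightarrow> 'a \<Rightarrow> real"
where
  "dynkin_payoff M F U i \<sigma> \<rho>0 \<tau>0 = cond_at M F \<sigma> (\<lambda>\<omega>.
     if \<rho>0 \<omega> < \<tau>0 \<omega> then X_proc M F U i (\<rho>0 \<omega>) \<omega>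
     else if \<rho>0 \<omega> > \<tau>0 \<omega> then Y_proc M F U i (\<tau>0 \<omega>) \<omega>
     else Z_proc U i (\<rho>0 \<omega>) \<omega>)"

text \<open>
  The value is the lower value of the first game and the upper value of the second one (\<open>\<rho>0\<close> is always
  the outer variable); that it coincides with the value for the other order is not built in.
\<close>

primrec dynkin_value ::
  "'a measure \<Rightarrow> (ennreal \<Rightarrow> 'a measure) \<Rightarrow> 'a payoff \<Rightarrow> player \<Rightarrow> 'a stime \<Rightarrow> 'a \<Rightarrow> real" where
  "dynkin_value M F U P1 \<sigma> \<omega> =
     (SUP \<rho>0\<in>stopping_times_from M F \<sigma>. INF \<tau>0\<in>stopping_times_from M F \<sigma>.
        dynkin_payoff M F U P1 \<sigma> \<rho>0 \<tau>0 \<omega>)"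
| "dynkin_value M F U P2 \<sigma> \<omega> =
     (INF \<rho>0\<in>stopping_times_from M F \<sigma>. SUP \<tau>0\<in>stopping_times_from M F \<sigma>.
        dynkin_payoff M F U P2 \<sigma> \<rho>0 \<tau>0 \<omega>)"

primrec saddle_point ::
  "'a measure \<Rightarrow> (ennreal \<Rightarrow> 'a measure) \<Rightarrow> 'a payoff \<Rightarrow> real \<Rightarrow> player \<Rightarrow> 'a stime \<Rightarrow> 'a stime \<Rightarrow> 'a stime \<Rightarrow> bool"
where
  "saddle_point M F U \<epsilon> P1 \<sigma> \<rho>' \<tau>' \<longleftrightarrow>
     \<rho>' \<in> stopping_times_from M F \<sigma> \<and> \<tau>' \<in> stopping_times_from M F \<sigma> \<and>
     (\<forall>\<rho>0\<in>stopping_times_from M F \<sigma>. \<forall>\<tau>0\<in>stopping_times_from M F \<sigma>. \<forall>\<omega>\<in>space M.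
        dynkin_payoff M F U P1 \<sigma> \<rho>0 \<tau>' \<omega> - \<epsilon> < dynkin_payoff M F U P1 \<sigma> \<rho>' \<tau>' \<omega> \<and>
        dynkin_payoff M F U P1 \<sigma> \<rho>' \<tau>' \<omega> < dynkin_payoff M F U P1 \<sigma> \<rho>' \<tau>0 \<omega> + \<epsilon>)"
| "saddle_point M F U \<epsilon> P2 \<sigma> \<rho>' \<tau>' \<longleftrightarrow>
     \<rho>' \<in> stopping_times_from M F \<sigma> \<and> \<tau>' \<in> stopping_times_from M F \<sigma> \<and>
     (\<forall>\<rho>0\<in>stopping_times_from M F \<sigma>. \<forall>\<tau>0\<in>stopping_times_from M F \<sigma>. \<forall>\<omega>\<in>space M.
        dynkin_payoff M F U P2 \<sigma> \<rho>' \<tau>0 \<omega> - \<epsilon> < dynkin_payoff M F U P2 \<sigma> \<rho>' \<tau>' \<omega> \<and>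
        dynkin_payoff M F U P2 \<sigma> \<rho>' \<tau>' \<omega> < dynkin_payoff M F U P2 \<sigma> \<rho>0 \<tau>' \<omega> + \<epsilon>)"

section \<open>The candidate equilibrium\<close>

text \<open>
  \<open>rb i n\<close> and \<open>tb i n\<close> stand for the near-optimizers at the grid time \<open>n h\<close>, and
  \<open>grid_reaction h (rb i)\<close>, \<open>grid_reaction h (tb i)\<close> for the reactions obtained from them.
\<close>

definition grid_optimizers ::
  "'a measure \<Rightarrow> (ennreal \<Rightarrow> 'a measure) \<Rightarrow> 'a payoff \<Rightarrow> real \<Rightarrow> real \<Rightarrow>
     (player \<Rightarrow> nat \<Rightarrow> 'a stime) \<Rightarrow> (player \<Rightarrow> nat \<Rightarrow> 'a stime) \<Rightarrow> bool" where
  "grid_optimizers M F U \<epsilon> h rb tb \<longleftrightarrow> (\<forall>i n. let t = ennreal (real n * h) in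
     rb i n \<in> stopping_times_from M F (\<lambda>_. t) \<and> tb i n \<in> stopping_times_from M F (\<lambda>_. t) \<and>
     (\<forall>\<omega>\<in>space M.
        \<bar>real_cond_exp M (F t) (\<lambda>\<omega>. U i (rb i n \<omega>) t \<omega>) \<omega> - Y_proc M F U i t \<omega>\<bar> \<le> \<epsilon> \<and>
        \<bar>real_cond_exp M (F t) (\<lambda>\<omega>. U i t (tb i n \<omega>) \<omega>) \<omega> - X_proc M F U i t \<omega>\<bar> \<le> \<epsilon>))"

definition grid_reaction :: "real \<Rightarrow> (nat \<Rightarrow> 'a stime) \<Rightarrow> ennreal \<Rightarrow> 'a stime" where
  "grid_reaction h b t \<omega> = (if t = \<infinity> then \<infinity> else b (nat \<lfloor>enn2real t / h\<rfloor> + 1) \<omega>)"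

definition small_grid ::
  "'a measure \<Rightarrow> (ennreal \<Rightarrow> 'a measure) \<Rightarrow> 'a payoff \<Rightarrow> (ennreal \<Rightarrow> real) \<Rightarrow> real \<Rightarrow> real \<Rightarrow>
     (player \<Rightarrow> nat \<Rightarrow> 'a stime) \<Rightarrow> (player \<Rightarrow> nat \<Rightarrow> 'a stime) \<Rightarrow> bool" where
  "small_grid M F U r \<epsilon> h rb tb \<longleftrightarrow> r (ennreal h) < \<epsilon> / 3 \<and>
     (\<forall>i. \<forall>\<rho>0\<in>stopping_times F. \<forall>\<tau>0\<in>stopping_times F. \<forall>\<omega>\<in>space M.
        \<bar>X_proc M F U i (\<rho>0 \<omega>) \<omega>
          - cond_at M F \<rho>0 (\<lambda>\<omega>. U i (\<rho>0 \<omega>) (grid_reaction h (tb i) (\<rho>0 \<omega>) \<omega>) \<omega>) \<omega>\<bar> \<le> 2 * \<epsilon> \<and>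
        \<bar>Y_proc M F U i (\<tau>0 \<omega>) \<omega>
          - cond_at M F \<tau>0 (\<lambda>\<omega>. U i (grid_reaction h (rb i) (\<tau>0 \<omega>) \<omega>) (\<tau>0 \<omega>) \<omega>) \<omega>\<bar> \<le> 2 * \<epsilon>)"

primrec W_proc ::
  "'a measure \<Rightarrow> (ennreal \<Rightarrow> 'a measure) \<Rightarrow> 'a payoff \<Rightarrow> real \<Rightarrow>
     (player \<Rightarrow> nat \<Rightarrow> 'a stime) \<Rightarrow> (player \<Rightarrow> nat \<Rightarrow> 'a stime) \<Rightarrow> player \<Rightarrow> ennreal \<Rightarrow> 'a \<Rightarrow> real" where
  "W_proc M F U h rb tb P1 t =
     real_cond_exp M (F t) (\<lambda>\<omega>. U P1 t (grid_reaction h (tb P2) t \<omega>) \<omega>)"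
| "W_proc M F U h rb tb P2 t =
     real_cond_exp M (F t) (\<lambda>\<omega>. U P2 (grid_reaction h (rb P1) t \<omega>) t \<omega>)"

definition mu ::
  "'a measure \<Rightarrow> (ennreal \<Rightarrow> 'a measure) \<Rightarrow> 'a payoff \<Rightarrow> real \<Rightarrow> real \<Rightarrow>
     (player \<Rightarrow> nat \<Rightarrow> 'a stime) \<Rightarrow> (player \<Rightarrow> nat \<Rightarrow> 'a stime) \<Rightarrow> player \<Rightarrow> 'a stime" where
  "mu M F U \<epsilon> h rb tb i \<omega> =
     Inf {t. dynkin_value M F U i (\<lambda>_. t) \<omega> \<le> W_proc M F U h rb tb i t \<omega> + \<epsilon>}"

text \<open>
  In the next two definitions \<open>m1\<close>, \<open>m2\<close> are the times \<open>\<mu>\<^sub>1\<close>, \<open>\<mu>\<^sub>2\<close>, and \<open>sr\<close>, \<open>st\<close> are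
  the \<open>\<rho>\<close>-component of the saddle point of the second game from \<open>\<mu>\<^sub>2 + \<delta>\<close> and the \<open>\<tau>\<close>-component of the
  saddle point of the first game from \<open>\<mu>\<^sub>1 + \<delta>\<close>.
\<close>

definition rho_star ::
  "real \<Rightarrow> (player \<Rightarrow> nat \<Rightarrow> 'a stime) \<Rightarrow> 'a stime \<Rightarrow> 'a stime \<Rightarrow> real \<Rightarrow> 'a stime \<Rightarrow> 'a strategy" where
  "rho_star h rb m1 m2 \<delta> sr =
     ((\<lambda>\<omega>. if m1 \<omega> \<le> m2 \<omega> then m1 \<omega> else sr \<omega>),
      (\<lambda>t \<omega>. if t \<ge> min (m1 \<omega>) (m2 \<omega>) + ennreal \<delta> \<and> m1 \<omega> > m2 \<omega>
         then grid_reaction h (rb P2) t \<omega> else grid_reaction h (rb P1) t \<omega>))"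

definition tau_star ::
  "real \<Rightarrow> (player \<Rightarrow> nat \<Rightarrow> 'a stime) \<Rightarrow> 'a stime \<Rightarrow> 'a stime \<Rightarrow> real \<Rightarrow> 'a stime \<Rightarrow> 'a strategy" where
  "tau_star h tb m1 m2 \<delta> st =
     ((\<lambda>\<omega>. if m1 \<omega> \<le> m2 \<omega> then st \<omega> else m2 \<omega>),
      (\<lambda>t \<omega>. if t \<ge> min (m1 \<omega>) (m2 \<omega>) + ennreal \<delta> \<and> m1 \<omega> \<le> m2 \<omega>
         then grid_reaction h (tb P1) t \<omega> else grid_reaction h (tb P2) t \<omega>))"

end

theory Submission
  imports Defs
begin

text \<open>
  On a countable space without null events every \<open>\<F>\<^sub>t\<close> is generated by a countable partition into
  atoms of positive probability, so conditional expectations are averages over atoms and all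
  arguments are pathwise. The value \<open>v\<close> of a Dynkin game is a submartingale as long as stopping
  costs the maximizer at least \<open>\<epsilon>\<close>, and it is right continuous because the payoffs are uniformly
  continuous in time; stopping once the cost drops to \<open>\<epsilon>\<close> is therefore almost optimal for the
  maximizer, so the game has a value and \<open>\<epsilon>\<close>-saddle points.

  In the candidate equilibrium a player who deviates before \<open>\<mu>\<^sub>1 \<and> \<mu>\<^sub>2\<close> gets \<open>W < v - \<epsilon>\<close>, which by the
  submartingale property is less than the expected value of \<open>v\<close> at \<open>\<mu>\<^sub>1 \<and> \<mu>\<^sub>2\<close>; a player who stops
  later than prescribed is held to the value of the zero-sum game after \<open>\<mu>\<^sub>i + \<delta>\<close>, which by right
  continuity is close to \<open>v\<close> at \<open>\<mu>\<^sub>i\<close>. The equilibrium itself pays at least \<open>v - 2\<epsilon>\<close> at \<open>\<mu>\<^sub>1 \<and> \<mu>\<^sub>2\<close>.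
\<close>

section \<open>Atoms and conditional expectations\<close>

text \<open>The delay \<delta> before the punishment starts answers an obstacle: a player who stops
  as prescribed at \<mu> must still meet the selfish reaction, because \<open>W\<close> and hence
  \<mu> are defined by it, and an immediate switch would change the payoff at exactly that time. The
  price is the window from \<mu> to \<mu> + \<delta>, in which a deviator also collects
  \<open>W\<close>. There \<open>W\<close> moves little, since reactions are constant between grid
  points, but the rate depends on the sample point; so \<delta> is chosen to let the estimate fail
  only on an event \<open>bad\<close> of small probability. Where the constant comes from: a late
  deviation gains at most 2\<epsilon> from the punishing reaction, 2\<epsilon> from the saddle
  point, \<epsilon> from moving the value from \<mu> + \<delta> back to \<mu> and \<epsilon> from
  the definition of \<mu>; the event \<open>bad\<close> adds at most one more \<epsilon>. The total
  7\<epsilon> lies below 18\<epsilon>. One argument serves both players: for \<open>U P1\<close>,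
  and for \<open>U P2\<close> with its arguments exchanged, the deviator is the maximizer and moves
  the first argument.\<close>

context countable_filtered_space
begin

definition atom :: "ennreal \<Rightarrow> 'a \<Rightarrow> 'a set" where
  "atom t \<omega> = {\<omega>'\<in>space M. \<forall>A\<in>sets (F t). \<omega> \<in> A \<longrightarrow> \<omega>' \<in> A}"

lemma sets_F_subset: "sets (F t) \<subseteq> sets M"
  using sets_F_mono[of t "\<infinity>"] F_infinity by simp

lemma subalgebra_F: "subalgebra M (F t)"
  using sets_F_subset space_F by (auto simp: subalgebra_def)

lemma atom_self: "\<omega> \<in> space M \<Longrightarrow> \<omega> \<in> atom t \<omega>"
  by (auto simp: atom_def)

lemma atom_space: "\<omega>' \<in> atom t \<omega> \<Longrightarrow> \<omega>' \<in> space M"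
  by (auto simp: atom_def)

lemma atom_subset: "A \<in> sets (F t) \<Longrightarrow> \<omega> \<in> A \<Longrightarrow> atom t \<omega> \<subseteq> A"
  by (auto simp: atom_def)

text \<open>One separating set for each of the countably many points outside the atom suffices, so
  the intersection that defines the atom, possibly over uncountably many sets, reduces to a
  countable one.\<close>

lemma atom_in_F: "atom t \<omega> \<in> sets (F t)"
proof -
  let ?N = "space M - atom t \<omega>"
  obtain A where A: "\<And>x. x \<in> ?N \<Longrightarrow> A x \<in> sets (F t) \<and> \<omega> \<in> A x \<and> x \<notin> A x"
  proof -
    have "\<forall>x\<in>?N. \<exists>A. A \<in> sets (F t) \<and> \<omega> \<in> A \<and> x \<notin> A"
      by (auto simp: atom_def)
    then show ?thesis using that by metis
  qed
  have "(\<Union>x\<in>?N. space (F t) - A x) \<in> sets (F t)"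
    using A countable_space by (intro sets.countable_UN') auto
  moreover have "atom t \<omega> = space (F t) - (\<Union>x\<in>?N. space (F t) - A x)"
    using A by (auto simp: space_F atom_space) (auto simp: atom_def)
  ultimately show ?thesis by (metis sets.compl_sets)
qed

lemma atom_in_M: "atom t \<omega> \<in> sets M"
  using atom_in_F sets_F_subset by blast

text \<open>Separation is symmetric: a set containing \<omega>' but not \<omega> has a complement in
  \<open>F t\<close> that separates the other way. So the atoms at one time partition the
  space.\<close>

lemma atom_eq:
  assumes "\<omega> \<in> space M" "\<omega>' \<in> atom t \<omega>"
  shows "atom t \<omega>' = atom t \<omega>"
proof -
  have "\<omega> \<in> A \<longleftrightarrow> \<omega>' \<in> A" if "A \<in> sets (F t)" for A
  proof
    assume "\<omega>' \<in> A"
    show "\<omega> \<in> A"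
    proof (rule ccontr)
      assume "\<omega> \<notin> A"
      then have "\<omega> \<in> space (F t) - A" "space (F t) - A \<in> sets (F t)"
        using assms(1) sets.compl_sets[OF that] by (simp_all add: space_F)
      then have "\<omega>' \<in> space (F t) - A" using assms(2) atom_subset by blast
      then show False using \<open>\<omega>' \<in> A\<close> by simp
    qed
  qed (use assms that atom_subset in blast)
  then show ?thesis by (auto simp: atom_def)
qed

lemma atom_sym: "\<omega> \<in> space M \<Longrightarrow> \<omega>' \<in> atom t \<omega> \<Longrightarrow> \<omega> \<in> atom t \<omega>'"
  using atom_eq atom_self by blast

text \<open>Every union of atoms is a countable union here. From now on measurability means
  constancy on atoms.\<close>

lemma sets_F_iff: "A \<in> sets (F t) \<longleftrightarrow> A \<subseteq> space M \<and> (\<forall>\<omega>\<in>A. atom t \<omega> \<subseteq> A)"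
proof
  assume "A \<in> sets (F t)"
  then show "A \<subseteq> space M \<and> (\<forall>\<omega>\<in>A. atom t \<omega> \<subseteq> A)"
    using sets.sets_into_space[of A "F t"] atom_subset by (auto simp: space_F)
next
  assume A: "A \<subseteq> space M \<and> (\<forall>\<omega>\<in>A. atom t \<omega> \<subseteq> A)"
  then have "A = (\<Union>\<omega>\<in>A. atom t \<omega>)" using atom_self by blast
  moreover have "(\<Union>\<omega>\<in>A. atom t \<omega>) \<in> sets (F t)"
    using A countable_space countable_subset by (intro sets.countable_UN' image_subsetI atom_in_F) auto
  ultimately show "A \<in> sets (F t)" by simp
qed

lemma sets_M_iff: "A \<in> sets M \<longleftrightarrow> A \<subseteq> space M \<and> (\<forall>\<omega>\<in>A. atom \<infinity> \<omega> \<subseteq> A)"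
  using sets_F_iff[of A \<infinity>] F_infinity by simp

lemma atom_antimono: "s \<le> t \<Longrightarrow> atom t \<omega> \<subseteq> atom s \<omega>"
  using sets_F_mono[of s t] by (auto simp: atom_def)

text \<open>The union \<open>?B\<close> of the later atoms lies in \<open>F s\<close> for every s
  after t, hence in \<open>F t\<close> by right continuity of the filtration; as it contains
  \<omega>, it contains the whole atom at t. Right continuity of the filtration enters only in this
  form.\<close>

lemma atom_right_continuous:
  assumes "t < \<infinity>" "\<omega> \<in> space M" "\<omega>' \<in> atom t \<omega>"
  shows "\<exists>s>t. \<omega>' \<in> atom s \<omega>"
proof -
  let ?B = "\<Union>s\<in>{t<..}. atom s \<omega>"
  have "?B \<in> sets (F s)" if "t < s" for s
    unfolding sets_F_iff
  proof (intro conjI ballI)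
    show "?B \<subseteq> space M" by (auto simp: atom_space)
    fix x assume "x \<in> ?B"
    then obtain q where q: "t < q" "x \<in> atom q \<omega>" by auto
    show "atom s x \<subseteq> ?B"
    proof (cases "q \<le> s")
      case True
      then have "atom s x \<subseteq> atom q \<omega>"
        using atom_antimono[OF True, of x] atom_eq[OF assms(2) q(2)] by simp
      then show ?thesis using q by auto
    next
      case False
      then have "s \<le> q" by simp
      then have "x \<in> atom s \<omega>" using atom_antimono[of s q \<omega>] q by auto
      then show ?thesis using atom_eq[OF assms(2)] that by auto
    qed
  qed
  then have "?B \<in> sets (F t)" using F_right_continuous[OF assms(1)] by auto
  moreover have "\<omega> \<in> ?B"
    using assms by (auto intro!: atom_self bexI[of _ "\<infinity>"])
  ultimately show ?thesis using atom_subset assms(3) by blast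
qed

text \<open>Galmarino's test in atomic form. The event that \<tau> is at most
  \<open>\<tau> \<omega>\<close> is a union of atoms, so
  \<open>\<tau> \<omega>' \<le> \<tau> \<omega>\<close>; then \<omega> lies in the atom of \<omega>'
  at the time \<open>\<tau> \<omega>'\<close>, and the same argument gives the reverse
  inequality.\<close>

lemma stopping_time_iff:
  "stopping_time F \<tau> \<longleftrightarrow> (\<forall>\<omega>\<in>space M. \<forall>\<omega>'\<in>atom (\<tau> \<omega>) \<omega>. \<tau> \<omega>' = \<tau> \<omega>)"
proof
  assume \<tau>: "stopping_time F \<tau>"
  show "\<forall>\<omega>\<in>space M. \<forall>\<omega>'\<in>atom (\<tau> \<omega>) \<omega>. \<tau> \<omega>' = \<tau> \<omega>"
  proof (intro ballI)
    fix \<omega> \<omega>' assume \<omega>: "\<omega> \<in> space M" "\<omega>' \<in> atom (\<tau> \<omega>) \<omega>"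
    have *: "{x\<in>space M. \<tau> x \<le> s} \<in> sets (F s)" for s
      using stopping_timeD[OF \<tau>, of s] by (simp add: pred_def space_F)
    have 1: "\<tau> \<omega>' \<le> \<tau> \<omega>"
      using atom_subset[OF *[of "\<tau> \<omega>"], of \<omega>] \<omega> by auto
    have "\<omega>' \<in> atom (\<tau> \<omega>') \<omega>" using \<omega>(2) atom_antimono[OF 1] by auto
    then have "\<omega> \<in> atom (\<tau> \<omega>') \<omega>'" by (rule atom_sym[OF \<omega>(1)])
    then have "\<tau> \<omega> \<le> \<tau> \<omega>'"
      using atom_subset[OF *[of "\<tau> \<omega>'"], of \<omega>'] \<omega> atom_space by auto
    with 1 show "\<tau> \<omega>' = \<tau> \<omega>" by simp
  qed
next
  assume *: "\<forall>\<omega>\<in>space M. \<forall>\<omega>'\<in>atom (\<tau> \<omega>) \<omega>. \<tau> \<omega>' = \<tau> \<omega>"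
  show "stopping_time F \<tau>"
  proof
    fix t
    have "{x\<in>space M. \<tau> x \<le> t} \<in> sets (F t)"
      unfolding sets_F_iff
    proof (intro conjI ballI subsetI)
      fix \<omega> \<omega>' assume "\<omega> \<in> {x\<in>space M. \<tau> x \<le> t}" "\<omega>' \<in> atom t \<omega>"
      then show "\<omega>' \<in> {x\<in>space M. \<tau> x \<le> t}"
        using * atom_antimono[of "\<tau> \<omega>" t \<omega>] atom_space by auto
    qed auto
    then show "Measurable.pred (F t) (\<lambda>x. \<tau> x \<le> t)" by (simp add: pred_def space_F)
  qed
qed

lemma stopping_time_atom:
  "stopping_time F \<tau> \<Longrightarrow> \<omega> \<in> space M \<Longrightarrow> \<omega>' \<in> atom (\<tau> \<omega>) \<omega> \<Longrightarrow> \<tau> \<omega>' = \<tau> \<omega>"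
  by (simp add: stopping_time_iff)

lemma stopping_time_atom_late:
  "stopping_time F \<tau> \<Longrightarrow> \<omega> \<in> space M \<Longrightarrow> \<tau> \<omega> \<le> t \<Longrightarrow> \<omega>' \<in> atom t \<omega> \<Longrightarrow> \<tau> \<omega>' = \<tau> \<omega>"
  using atom_antimono stopping_time_atom by blast

lemma stopping_time_atom_early:
  assumes "stopping_time F \<tau>" "\<omega> \<in> space M" "t \<le> \<tau> \<omega>" "\<omega>' \<in> atom t \<omega>"
  shows "t \<le> \<tau> \<omega>'"
proof (rule ccontr)
  assume "\<not> t \<le> \<tau> \<omega>'"
  moreover have "\<omega> \<in> atom t \<omega>'" using atom_sym assms by blast
  ultimately have "\<tau> \<omega> = \<tau> \<omega>'"
    using assms atom_space by (intro stopping_time_atom_late[of _ _ t]) auto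
  with \<open>\<not> t \<le> \<tau> \<omega>'\<close> assms show False by auto
qed

lemma stopping_time_atom_less:
  assumes "stopping_time F \<tau>" "\<omega> \<in> space M" "t < \<tau> \<omega>" "\<omega>' \<in> atom t \<omega>"
  shows "t < \<tau> \<omega>'"
  using stopping_time_atom_early[OF assms(1,2) _ assms(4)] assms(3)
    stopping_time_atom_late[of \<tau> \<omega>' t \<omega>] atom_sym[OF assms(2,4)] atom_space[OF assms(4)] assms(1)
  by (metis order_le_less)

lemma measurable_F_iff:
  fixes f :: "'a \<Rightarrow> 'b::{second_countable_topology, t1_space}"
  shows "f \<in> borel_measurable (F t) \<longleftrightarrow> (\<forall>\<omega>\<in>space M. \<forall>\<omega>'\<in>atom t \<omega>. f \<omega>' = f \<omega>)"
proof
  assume f: "f \<in> borel_measurable (F t)"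
  show "\<forall>\<omega>\<in>space M. \<forall>\<omega>'\<in>atom t \<omega>. f \<omega>' = f \<omega>"
  proof (intro ballI)
    fix \<omega> \<omega>' assume \<omega>: "\<omega> \<in> space M" "\<omega>' \<in> atom t \<omega>"
    have "f -` {f \<omega>} \<inter> space (F t) \<in> sets (F t)"
      by (intro measurable_sets[OF f]) auto
    then show "f \<omega>' = f \<omega>" using atom_subset[of _ t \<omega>] \<omega> by (auto simp: space_F)
  qed
next
  assume *: "\<forall>\<omega>\<in>space M. \<forall>\<omega>'\<in>atom t \<omega>. f \<omega>' = f \<omega>"
  show "f \<in> borel_measurable (F t)"
  proof (rule measurableI)
    fix A assume "A \<in> sets (borel :: 'b measure)"
    show "f -` A \<inter> space (F t) \<in> sets (F t)"
      unfolding sets_F_iff using * by (auto simp: space_F atom_space)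
  qed auto
qed

lemma measurable_M_iff:
  fixes f :: "'a \<Rightarrow> 'b::{second_countable_topology, t1_space}"
  shows "f \<in> borel_measurable M \<longleftrightarrow> (\<forall>\<omega>\<in>space M. \<forall>\<omega>'\<in>atom \<infinity> \<omega>. f \<omega>' = f \<omega>)"
  using measurable_F_iff[of f \<infinity>] measurable_cong_sets[OF F_infinity refl, of borel] by blast

section \<open>Bounded random variables and their averages over atoms\<close>

lemma prob_atom_pos: "\<omega> \<in> space M \<Longrightarrow> 0 < prob (atom t \<omega>)"
  using full_support[OF atom_in_M] atom_self by blast

text \<open>Boundedness gives integrability over every event, so that the rules for
  \<open>ce\<close> need no separate integrability conditions.\<close>

definition nice :: "('a \<Rightarrow> real) \<Rightarrow> bool" where
  "nice f \<longleftrightarrow> f \<in> borel_measurable M \<and> (\<exists>C. \<forall>\<omega>\<in>space M. \<bar>f \<omega>\<bar> \<le> C)"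

lemma niceI:
  "(\<And>\<omega> \<omega>'. \<omega> \<in> space M \<Longrightarrow> \<omega>' \<in> atom \<infinity> \<omega> \<Longrightarrow> f \<omega>' = f \<omega>) \<Longrightarrow> (\<And>\<omega>. \<omega> \<in> space M \<Longrightarrow> \<bar>f \<omega>\<bar> \<le> C) \<Longrightarrow> nice f"
  by (auto simp: nice_def measurable_M_iff)

lemma nice_atom: "nice f \<Longrightarrow> \<omega> \<in> space M \<Longrightarrow> \<omega>' \<in> atom \<infinity> \<omega> \<Longrightarrow> f \<omega>' = f \<omega>"
  by (auto simp: nice_def measurable_M_iff)

lemma nice_integrable: "nice f \<Longrightarrow> integrable M f"
  unfolding nice_def by (metis AE_I2 integrable_const_bound real_norm_def)

lemma nice_set_integrable: "nice f \<Longrightarrow> A \<in> sets M \<Longrightarrow> set_integrable M A f"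
  unfolding set_integrable_def using nice_integrable
  by (intro integrable_mult_indicator) auto

lemma nice_add: "nice f \<Longrightarrow> nice g \<Longrightarrow> nice (\<lambda>\<omega>. f \<omega> + g \<omega>)"
  unfolding nice_def
  by (auto intro!: borel_measurable_add) (metis abs_triangle_ineq add_mono order_trans)

lemma nice_uminus: "nice f \<Longrightarrow> nice (\<lambda>\<omega>. - f \<omega>)"
  unfolding nice_def by auto

lemma nice_diff: "nice f \<Longrightarrow> nice g \<Longrightarrow> nice (\<lambda>\<omega>. f \<omega> - g \<omega>)"
  using nice_add[OF _ nice_uminus, of f g] by simp

lemma nice_const: "nice (\<lambda>_. c)"
  unfolding nice_def by auto

text \<open>A version of the conditional expectation given \<open>F t\<close> that is explicit at
  every point of the space; the denominator is positive there by \<open>prob_atom_pos\<close>. With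
  a stopping time inserted, \<open>ce (\<sigma> \<omega>) f \<omega>\<close> is the conditional
  expectation at \<sigma>.\<close>

definition ce :: "ennreal \<Rightarrow> ('a \<Rightarrow> real) \<Rightarrow> 'a \<Rightarrow> real" where
  "ce t f \<omega> = (LINT x:atom t \<omega>|M. f x) / prob (atom t \<omega>)"

lemma ce_atom: "\<omega> \<in> space M \<Longrightarrow> \<omega>' \<in> atom t \<omega> \<Longrightarrow> ce t f \<omega>' = ce t f \<omega>"
  by (simp add: ce_def atom_eq[of \<omega> \<omega>' t])

lemma ce_stopping_atom:
  "stopping_time F \<sigma> \<Longrightarrow> \<omega> \<in> space M \<Longrightarrow> \<sigma> \<omega> \<le> t \<Longrightarrow> \<omega>' \<in> atom t \<omega> \<Longrightarrow> ce (\<sigma> \<omega>') f \<omega>' = ce (\<sigma> \<omega>) f \<omega>"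
  using stopping_time_atom_late[of \<sigma> \<omega> t \<omega>'] ce_atom[of \<omega> \<omega>' "\<sigma> \<omega>" f] atom_antimono[of "\<sigma> \<omega>" t \<omega>]
  by auto

lemma ce_mono:
  assumes "nice f" "nice g" "\<omega> \<in> space M" "\<And>x. x \<in> atom t \<omega> \<Longrightarrow> f x \<le> g x"
  shows "ce t f \<omega> \<le> ce t g \<omega>"
  unfolding ce_def using assms atom_in_M prob_atom_pos[of \<omega> t]
  by (intro divide_right_mono set_integral_mono nice_set_integrable) auto

lemma ce_cong:
  assumes "\<And>x. x \<in> atom t \<omega> \<Longrightarrow> f x = g x"
  shows "ce t f \<omega> = ce t g \<omega>"
  unfolding ce_def using assms atom_in_M by (subst set_lebesgue_integral_cong[of _ _ f g]) auto

lemma ce_const: "\<omega> \<in> space M \<Longrightarrow> ce t (\<lambda>_. c) \<omega> = c"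
  unfolding ce_def using prob_atom_pos[of \<omega> t]
  by (simp add: set_lebesgue_integral_def atom_in_M)

lemma ce_eqI: "\<omega> \<in> space M \<Longrightarrow> (\<And>x. x \<in> atom t \<omega> \<Longrightarrow> f x = c) \<Longrightarrow> ce t f \<omega> = c"
  using ce_cong[of t \<omega> f "\<lambda>_. c"] ce_const by simp

lemma ce_add: "nice f \<Longrightarrow> nice g \<Longrightarrow> ce t (\<lambda>x. f x + g x) \<omega> = ce t f \<omega> + ce t g \<omega>"
  unfolding ce_def
  by (simp add: set_integral_add nice_set_integrable atom_in_M add_divide_distrib)

lemma ce_uminus: "ce t (\<lambda>x. - f x) \<omega> = - ce t f \<omega>"
  unfolding ce_def set_lebesgue_integral_def by simp

lemma ce_diff: "nice f \<Longrightarrow> nice g \<Longrightarrow> ce t (\<lambda>x. f x - g x) \<omega> = ce t f \<omega> - ce t g \<omega>"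
  using ce_add[OF _ nice_uminus, of f g] by (simp add: ce_uminus)

lemma ce_add_const:
  "nice f \<Longrightarrow> \<omega> \<in> space M \<Longrightarrow> ce t (\<lambda>x. f x + c) \<omega> = ce t f \<omega> + c"
  by (simp add: ce_add nice_const ce_const)

lemma ce_le:
  "nice f \<Longrightarrow> \<omega> \<in> space M \<Longrightarrow> (\<And>x. x \<in> atom t \<omega> \<Longrightarrow> f x \<le> c) \<Longrightarrow> ce t f \<omega> \<le> c"
  using ce_mono[of f "\<lambda>_. c" \<omega> t] nice_const ce_const by simp

lemma ce_ge:
  "nice f \<Longrightarrow> \<omega> \<in> space M \<Longrightarrow> (\<And>x. x \<in> atom t \<omega> \<Longrightarrow> c \<le> f x) \<Longrightarrow> c \<le> ce t f \<omega>"
  using ce_mono[of "\<lambda>_. c" f \<omega> t] nice_const ce_const by simp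

lemma ce_abs_le:
  "nice f \<Longrightarrow> \<omega> \<in> space M \<Longrightarrow> (\<And>x. x \<in> space M \<Longrightarrow> \<bar>f x\<bar> \<le> C) \<Longrightarrow> \<bar>ce t f \<omega>\<bar> \<le> C"
  using ce_le[of f \<omega> t C] ce_ge[of f \<omega> t "-C"] atom_space by (force simp: abs_le_iff)

lemma nice_ce: "stopping_time F \<sigma> \<Longrightarrow> nice f \<Longrightarrow> nice (\<lambda>\<omega>. ce (\<sigma> \<omega>) f \<omega>)"
proof -
  assume a: "stopping_time F \<sigma>" "nice f"
  then obtain C where "\<forall>\<omega>\<in>space M. \<bar>f \<omega>\<bar> \<le> C" by (auto simp: nice_def)
  then show ?thesis using a ce_stopping_atom[of \<sigma> _ \<infinity>] ce_abs_le
    by (intro niceI[where C=C]) auto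
qed

section \<open>Agreement with conditional expectations, and the tower property\<close>

lemma real_cond_exp_eq_average:
  assumes G: "subalgebra M G" and f: "integrable M f"
    and A: "A \<in> sets G" "\<omega> \<in> A" "\<And>B. B \<in> sets G \<Longrightarrow> \<omega> \<in> B \<Longrightarrow> A \<subseteq> B"
  shows "real_cond_exp M G f \<omega> = (LINT x:A|M. f x) / prob A"
proof -
  interpret G: finite_measure_subalgebra M G using G by unfold_locales
  have AM: "A \<in> sets M" using A G by (auto simp: subalgebra_def)
  have \<omega>: "\<omega> \<in> space M" using AM A(2) sets.sets_into_space by blast
  let ?E = "real_cond_exp M G f"
  \<comment> \<open>A conditional expectation is fixed only almost everywhere, but it is
    \<open>G\<close>-measurable, so its level set through \<omega> contains the minimal set
    \<open>A\<close>. Being constant on \<open>A\<close>, it must equal the average.\<close>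
  have const: "?E x = ?E \<omega>" if "x \<in> A" for x
  proof -
    have "?E -` {?E \<omega>} \<inter> space G \<in> sets G"
      by (intro measurable_sets[OF borel_measurable_cond_exp]) auto
    then show ?thesis using A(3)[of "?E -` {?E \<omega>} \<inter> space G"] \<omega> that G
      by (auto simp: subalgebra_def)
  qed
  have "(LINT x:A|M. f x) = (LINT x:A|M. ?E x)"
    using f A(1) by (rule G.real_cond_exp_intA)
  also have "\<dots> = (LINT x:A|M. ?E \<omega>)"
    using const AM by (intro set_lebesgue_integral_cong) auto
  also have "\<dots> = ?E \<omega> * prob A"
    using AM by (simp add: set_lebesgue_integral_def)
  finally show ?thesis using full_support[OF AM] A(2) by (metis empty_iff less_irrefl nonzero_mult_div_cancel_right)
qed

lemma real_cond_exp_eq_ce: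
  "nice f \<Longrightarrow> \<omega> \<in> space M \<Longrightarrow> real_cond_exp M (F t) f \<omega> = ce t f \<omega>"
  unfolding ce_def
  by (intro real_cond_exp_eq_average subalgebra_F nice_integrable atom_in_F atom_self atom_subset) auto

text \<open>The atoms of the stopped sigma-algebra are the atoms taken at the time that \<sigma>
  shows at the point, because \<sigma> is constant on them. This turns \<open>cond_at\<close> into
  averages.\<close>

lemma sets_pre_sigma_iff:
  assumes \<sigma>: "stopping_time F \<sigma>"
  shows "A \<in> sets (pre_sigma \<sigma>) \<longleftrightarrow> A \<subseteq> space M \<and> (\<forall>\<omega>\<in>A. atom (\<sigma> \<omega>) \<omega> \<subseteq> A)"
proof
  assume A: "A \<in> sets (pre_sigma \<sigma>)"
  then have "A \<subseteq> space M" using sets.sets_into_space space_pre_sigma by metis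
  moreover have "atom (\<sigma> \<omega>) \<omega> \<subseteq> A" if "\<omega> \<in> A" for \<omega>
    using atom_subset[OF sets_pre_sigmaD[OF \<sigma> A, of "\<sigma> \<omega>"], of \<omega>] that by auto
  ultimately show "A \<subseteq> space M \<and> (\<forall>\<omega>\<in>A. atom (\<sigma> \<omega>) \<omega> \<subseteq> A)" by auto
next
  assume A: "A \<subseteq> space M \<and> (\<forall>\<omega>\<in>A. atom (\<sigma> \<omega>) \<omega> \<subseteq> A)"
  show "A \<in> sets (pre_sigma \<sigma>)"
  proof (rule sets_pre_sigmaI[OF \<sigma>])
    fix t show "{\<omega>\<in>A. \<sigma> \<omega> \<le> t} \<in> sets (F t)"
      unfolding sets_F_iff
    proof (intro conjI ballI subsetI)
      fix \<omega> \<omega>' assume *: "\<omega> \<in> {\<omega>\<in>A. \<sigma> \<omega> \<le> t}" "\<omega>' \<in> atom t \<omega>"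
      then have "\<omega>' \<in> atom (\<sigma> \<omega>) \<omega>" using atom_antimono[of "\<sigma> \<omega>" t] by auto
      then show "\<omega>' \<in> {\<omega>\<in>A. \<sigma> \<omega> \<le> t}"
        using * A stopping_time_atom[OF \<sigma>, of \<omega> \<omega>'] by auto
    qed (use A in auto)
  qed
qed

lemma subalgebra_pre_sigma: "stopping_time F \<sigma> \<Longrightarrow> subalgebra M (pre_sigma \<sigma>)"
  unfolding subalgebra_def
proof (intro conjI subsetI)
  fix A assume "stopping_time F \<sigma>" "A \<in> sets (pre_sigma \<sigma>)"
  then show "A \<in> sets M"
    using atom_antimono[of _ \<infinity>] by (simp add: sets_pre_sigma_iff sets_M_iff) (meson order_trans top_greatest)
qed (simp add: space_pre_sigma)

lemma atom_in_pre_sigma: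
  assumes \<sigma>: "stopping_time F \<sigma>" "\<omega> \<in> space M"
  shows "atom (\<sigma> \<omega>) \<omega> \<in> sets (pre_sigma \<sigma>)"
  unfolding sets_pre_sigma_iff[OF \<sigma>(1)]
proof (intro conjI ballI)
  fix x assume "x \<in> atom (\<sigma> \<omega>) \<omega>"
  then have "\<sigma> x = \<sigma> \<omega>" "atom (\<sigma> \<omega>) x = atom (\<sigma> \<omega>) \<omega>"
    by (rule stopping_time_atom[OF assms], rule atom_eq[OF assms(2)])
  then show "atom (\<sigma> x) x \<subseteq> atom (\<sigma> \<omega>) \<omega>" by simp
qed (use atom_space in blast)

lemma cond_at_eq_ce:
  assumes "stopping_time F \<sigma>" "nice f" "\<omega> \<in> space M"
  shows "cond_at M F \<sigma> f \<omega> = ce (\<sigma> \<omega>) f \<omega>"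
  unfolding cond_at_def ce_def using assms
  by (intro real_cond_exp_eq_average subalgebra_pre_sigma nice_integrable atom_in_pre_sigma)
     (auto simp: atom_self sets_pre_sigma_iff)

lemma tower_set:
  assumes \<sigma>: "stopping_time F \<sigma>" and f: "nice f" and A: "A \<subseteq> space M" "\<And>\<omega>. \<omega> \<in> A \<Longrightarrow> atom (\<sigma> \<omega>) \<omega> \<subseteq> A"
  shows "(LINT \<omega>:A|M. ce (\<sigma> \<omega>) f \<omega>) = (LINT \<omega>:A|M. f \<omega>)"
proof -
  interpret G: finite_measure_subalgebra M "pre_sigma \<sigma>"
    using subalgebra_pre_sigma[OF \<sigma>] by unfold_locales
  have 1: "A \<in> sets (pre_sigma \<sigma>)" using assms by (auto simp: sets_pre_sigma_iff)
  then have 2: "A \<in> sets M" using subalgebra_pre_sigma[OF \<sigma>] by (auto simp: subalgebra_def)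
  have "(LINT \<omega>:A|M. f \<omega>) = (LINT \<omega>:A|M. real_cond_exp M (pre_sigma \<sigma>) f \<omega>)"
    using nice_integrable[OF f] 1 by (rule G.real_cond_exp_intA)
  also have "\<dots> = (LINT \<omega>:A|M. ce (\<sigma> \<omega>) f \<omega>)"
    using cond_at_eq_ce[OF \<sigma> f] A(1) 2
    by (intro set_lebesgue_integral_cong) (auto simp: cond_at_def)
  finally show ?thesis by simp
qed

lemma tower:
  assumes "stopping_time F \<sigma>" "nice f"
  shows "(\<integral>\<omega>. ce (\<sigma> \<omega>) f \<omega> \<partial>M) = (\<integral>\<omega>. f \<omega> \<partial>M)"
  using tower_set[OF assms, of "space M"] atom_space
  unfolding set_integral_space[OF nice_integrable[OF assms(2)]]
    set_integral_space[OF nice_integrable[OF nice_ce[OF assms]]] by blast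

text \<open>The inequality at the single point \<omega> spreads over its atom at t, which is
  therefore a union of atoms taken at \<sigma>.\<close>

lemma ce_tower:
  assumes "stopping_time F \<sigma>" "nice f" "\<omega> \<in> space M" "t \<le> \<sigma> \<omega>"
  shows "ce t (\<lambda>x. ce (\<sigma> x) f x) \<omega> = ce t f \<omega>"
proof -
  have "atom (\<sigma> x) x \<subseteq> atom t \<omega>" if "x \<in> atom t \<omega>" for x
    using stopping_time_atom_early[OF assms(1,3,4) that] atom_antimono atom_eq[OF assms(3) that] by blast
  then show ?thesis
    unfolding ce_def[of t] using assms atom_space by (subst tower_set) auto
qed

lemma ce_ce: "nice f \<Longrightarrow> \<omega> \<in> space M \<Longrightarrow> t \<le> s \<Longrightarrow> ce t (ce s f) \<omega> = ce t f \<omega>"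
  using ce_tower[OF stopping_time_const, of f \<omega> t s] by simp

text \<open>Passing to the smaller atom changes the average through the discarded part and through
  the normalisation, each contributing at most \<open>C\<close> times the relative mass lost. The
  bound depends on \<open>f\<close> only through \<open>C\<close>, so \<open>f\<close> may itself
  vary with the later time.\<close>

lemma ce_close:
  assumes f: "nice f" "\<And>x. x \<in> space M \<Longrightarrow> \<bar>f x\<bar> \<le> C" and \<omega>: "\<omega> \<in> space M" and "t \<le> s"
  shows "\<bar>ce t f \<omega> - ce s f \<omega>\<bar> \<le> 2 * C * (1 - prob (atom s \<omega>) / prob (atom t \<omega>))"
proof -
  let ?S = "atom s \<omega>" and ?T = "atom t \<omega>"
  have sub: "?S \<subseteq> ?T" using atom_antimono assms(4) .
  note m = atom_in_M[of s \<omega>] atom_in_M[of t \<omega>]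
  note p = prob_atom_pos[OF \<omega>, of s] prob_atom_pos[OF \<omega>, of t]
  have dp: "prob (?T - ?S) = prob ?T - prob ?S" using m sub by (simp add: finite_measure_Diff)
  have "(LINT x:?T|M. f x) = (LINT x:?S \<union> (?T - ?S)|M. f x)" using sub by (simp add: Un_absorb1)
  also have "\<dots> = (LINT x:?S|M. f x) + (LINT x:?T - ?S|M. f x)"
    using m f by (intro set_integral_Un nice_set_integrable) auto
  finally have split: "(LINT x:?T|M. f x) = (LINT x:?S|M. f x) + (LINT x:?T - ?S|M. f x)" .
  have b: "\<bar>LINT x:?T - ?S|M. f x\<bar> \<le> C * (prob ?T - prob ?S)"
  proof -
    have "\<bar>LINT x:?T - ?S|M. f x\<bar> \<le> (LINT x:?T - ?S|M. \<bar>f x\<bar>)"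
      using set_integral_norm_bound[OF nice_set_integrable[OF f(1), of "?T - ?S"]] m by simp
    also have "\<dots> \<le> (LINT x:?T - ?S|M. C)"
      using m f(2) atom_space
      by (intro set_integral_mono set_integrable_abs nice_set_integrable nice_const f(1)) auto
    also have "\<dots> = C * (prob ?T - prob ?S)"
      using m dp by (simp add: set_lebesgue_integral_def)
    finally show ?thesis .
  qed
  have c: "\<bar>ce s f \<omega>\<bar> \<le> C" using ce_abs_le[OF f(1) \<omega> f(2)] .
  have "ce t f \<omega> - ce s f \<omega> = ((LINT x:?T - ?S|M. f x) - ce s f \<omega> * (prob ?T - prob ?S)) / prob ?T"
    using p by (simp add: ce_def[of t] split) (simp add: ce_def field_simps)
  then have "\<bar>ce t f \<omega> - ce s f \<omega>\<bar> = \<bar>(LINT x:?T - ?S|M. f x) - ce s f \<omega> * (prob ?T - prob ?S)\<bar> / prob ?T"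
    using p by simp
  also have "\<dots> \<le> (C * (prob ?T - prob ?S) + C * (prob ?T - prob ?S)) / prob ?T"
  proof (rule divide_right_mono)
    have "\<bar>ce s f \<omega> * (prob ?T - prob ?S)\<bar> \<le> C * (prob ?T - prob ?S)"
      using c dp by (simp add: abs_mult) (metis measure_nonneg mult_right_mono abs_of_nonneg)
    then show "\<bar>(LINT x:?T - ?S|M. f x) - ce s f \<omega> * (prob ?T - prob ?S)\<bar>
      \<le> C * (prob ?T - prob ?S) + C * (prob ?T - prob ?S)" using b by linarith
  qed (use p in simp)
  also have "\<dots> = 2 * C * (1 - prob ?S / prob ?T)" using p by (simp add: field_simps)
  finally show ?thesis .
qed

text \<open>By \<open>atom_right_continuous\<close> the atoms shortly after t increase to the atom
  at t; continuity of the measure from below does the rest.\<close>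

lemma prob_atom_right_continuous:
  assumes "t < \<infinity>" "\<omega> \<in> space M" "0 < e"
  obtains d :: real where "0 < d"
    "\<And>s. t \<le> s \<Longrightarrow> s \<le> t + ennreal d \<Longrightarrow> 1 - prob (atom s \<omega>) / prob (atom t \<omega>) < e"
proof -
  let ?s = "\<lambda>n::nat. t + ennreal (1 / real (Suc n))"
  have inc: "incseq (\<lambda>n. atom (?s n) \<omega>)"
    by (intro incseq_SucI atom_antimono add_left_mono ennreal_leI) (simp add: field_simps)
  have "(\<Union>n. atom (?s n) \<omega>) = atom t \<omega>"
  proof (intro equalityI subsetI)
    fix x assume "x \<in> atom t \<omega>"
    then obtain s where s: "t < s" "x \<in> atom s \<omega>" using atom_right_continuous assms by blast
    \<comment> \<open>An intermediate time is finite even if \<open>s\<close> is not, so its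
      distance to t is a positive real that can be compared with
      \<open>1 / real (Suc n)\<close>.\<close>
    then obtain q where q: "t < q" "q < s" using dense by blast
    then have "q < \<infinity>" using order_less_le_trans[OF q(2), of \<infinity>] by simp
    have "0 < enn2real (q - t)"
      using q assms(1) \<open>q < \<infinity>\<close> by (intro enn2real_positive_iff[THEN iffD2])
        (auto simp: diff_gt_0_iff_gt_ennreal less_top[symmetric])
    then obtain n where "1 / real (Suc n) < enn2real (q - t)"
      using nat_approx_posE by blast
    then have "ennreal (1 / real (Suc n)) \<le> ennreal (enn2real (q - t))"
      by (intro ennreal_leI) (rule less_imp_le)
    also have "\<dots> = q - t" using \<open>q < \<infinity>\<close> by (simp add: less_top[symmetric])
    finally have "?s n \<le> t + (q - t)" by (intro add_left_mono)
    also have "\<dots> = q" using q assms(1) by (simp add: ennreal_minus_cancel_iff add_diff_inverse_ennreal less_imp_le)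
    also have "\<dots> \<le> s" using q by simp
    finally have "x \<in> atom (?s n) \<omega>" using s atom_antimono by blast
    then show "x \<in> (\<Union>n. atom (?s n) \<omega>)" by blast
  next
    fix x assume "x \<in> (\<Union>n. atom (?s n) \<omega>)"
    then show "x \<in> atom t \<omega>" using atom_antimono[of t "?s _" \<omega>] by auto
  qed
  then have "(\<lambda>n. prob (atom (?s n) \<omega>)) \<longlonglongrightarrow> prob (atom t \<omega>)"
    using finite_Lim_measure_incseq[OF _ inc] atom_in_M by auto
  then have "(\<lambda>n. 1 - prob (atom (?s n) \<omega>) / prob (atom t \<omega>)) \<longlonglongrightarrow> 1 - prob (atom t \<omega>) / prob (atom t \<omega>)"
    using prob_atom_pos[OF assms(2)] by (intro tendsto_intros) (auto simp: less_le)
  then have "(\<lambda>n. 1 - prob (atom (?s n) \<omega>) / prob (atom t \<omega>)) \<longlonglongrightarrow> 0"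
    using prob_atom_pos[OF assms(2), of t] by simp
  then obtain n where n: "1 - prob (atom (?s n) \<omega>) / prob (atom t \<omega>) < e"
    using order_tendstoD(2)[OF _ assms(3)] eventually_sequentially by (metis (no_types, lifting) order_refl)
  show ?thesis
  proof (rule that)
    show "(0::real) < 1 / real (Suc n)" by simp
    fix s assume "t \<le> s" "s \<le> ?s n"
    then have "prob (atom (?s n) \<omega>) \<le> prob (atom s \<omega>)"
      by (intro finite_measure_mono atom_antimono atom_in_M)
    then have "prob (atom (?s n) \<omega>) / prob (atom t \<omega>) \<le> prob (atom s \<omega>) / prob (atom t \<omega>)"
      using prob_atom_pos[OF assms(2), of t] by (intro divide_right_mono) auto
    with n show "1 - prob (atom s \<omega>) / prob (atom t \<omega>) < e" by linarith
  qed
qed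

end

section \<open>The value of the Dynkin game\<close>

lemma time_dist_le:
  assumes "q \<le> a" "a \<le> b" "b \<le> s"
  shows "time_dist a b \<le> time_dist q s"
  using assms by (auto simp: time_dist_def max_def min_def intro: ennreal_mono_minus order_trans[OF ennreal_minus_mono])

lemma time_dist_same[simp]: "time_dist t t = 0"
  by (simp add: time_dist_def)

lemma time_dist_commute: "time_dist s t = time_dist t s"
  by (auto simp: time_dist_def max.commute min.commute)

context countable_filtered_space
begin

section \<open>Constructing stopping times\<close>

abbreviation T :: "'a stime \<Rightarrow> 'a stime set" where
  "T \<equiv> stopping_times_from M F"

text \<open>When the selected branch stops, \<open>m\<close> has passed, and the atom is small
  enough for \<open>E\<close> to be constant on it. A branch has to lie after \<open>m\<close> only
  where it is selected.\<close>

lemma stopping_time_if: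
  assumes "stopping_time F m" "stopping_time F \<sigma>" "stopping_time F \<tau>"
    and E: "\<And>\<omega> \<omega>'. \<omega> \<in> space M \<Longrightarrow> \<omega>' \<in> atom (m \<omega>) \<omega> \<Longrightarrow> E \<omega>' = E \<omega>"
    and ge: "\<And>\<omega>. \<omega> \<in> space M \<Longrightarrow> E \<omega> \<Longrightarrow> m \<omega> \<le> \<sigma> \<omega>" "\<And>\<omega>. \<omega> \<in> space M \<Longrightarrow> \<not> E \<omega> \<Longrightarrow> m \<omega> \<le> \<tau> \<omega>"
  shows "stopping_time F (\<lambda>\<omega>. if E \<omega> then \<sigma> \<omega> else \<tau> \<omega>)"
  unfolding stopping_time_iff
proof (intro ballI)
  fix \<omega> \<omega>' assume \<omega>: "\<omega> \<in> space M" and x: "\<omega>' \<in> atom (if E \<omega> then \<sigma> \<omega> else \<tau> \<omega>) \<omega>"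
  have "m \<omega> \<le> (if E \<omega> then \<sigma> \<omega> else \<tau> \<omega>)" using ge[OF \<omega>] by simp
  then have "E \<omega>' = E \<omega>" using E[OF \<omega>] atom_antimono x by blast
  then show "(if E \<omega>' then \<sigma> \<omega>' else \<tau> \<omega>') = (if E \<omega> then \<sigma> \<omega> else \<tau> \<omega>)"
    using x stopping_time_atom[OF assms(2) \<omega>] stopping_time_atom[OF assms(3) \<omega>] by (simp split: if_splits)
qed

lemma stopping_time_atom_infinity:
  "stopping_time F \<tau> \<Longrightarrow> \<omega> \<in> space M \<Longrightarrow> \<omega>' \<in> atom \<infinity> \<omega> \<Longrightarrow> \<tau> \<omega>' = \<tau> \<omega>"
  by (rule stopping_time_atom_late[of _ _ \<infinity>]) auto

lemma T_iff: "\<tau> \<in> T \<sigma> \<longleftrightarrow> stopping_time F \<tau> \<and> (\<forall>\<omega>\<in>space M. \<sigma> \<omega> \<le> \<tau> \<omega>)"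
  by (simp add: stopping_times_from_def)

lemma T_stopping: "\<tau> \<in> T \<sigma> \<Longrightarrow> stopping_time F \<tau>"
  by (simp add: T_iff)

lemma T_atom_ge:
  assumes "stopping_time F \<sigma>" "\<tau> \<in> T \<sigma>" "\<omega> \<in> space M"
  shows "\<forall>x\<in>atom (\<sigma> \<omega>) \<omega>. \<sigma> \<omega> \<le> \<tau> x"
  using assms atom_space stopping_time_atom[OF assms(1,3)] by (metis T_iff)

lemma infinity_in_T: "(\<lambda>_. \<infinity>) \<in> T \<sigma>"
  by (simp add: T_iff stopping_time_const)

lemma const_in_T: "(\<lambda>_. t) \<in> T (\<lambda>_. t)"
  by (simp add: T_iff stopping_time_const)

lemma max_in_T: "stopping_time F \<tau> \<Longrightarrow> stopping_time F \<sigma> \<Longrightarrow> (\<lambda>\<omega>. max (\<tau> \<omega>) (\<sigma> \<omega>)) \<in> T \<sigma>"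
  by (simp add: T_iff stopping_time_max)

lemma max_const_in_T: "stopping_time F \<tau> \<Longrightarrow> (\<lambda>\<omega>. max (\<tau> \<omega>) t) \<in> T (\<lambda>_. t)"
  by (intro max_in_T stopping_time_const)

text \<open>Choosing a strategy separately on every atom gives a stopping time because an event
  decided at \<open>\<sigma>\<close> stays decided later.\<close>

lemma paste_stopping_times:
  assumes \<sigma>: "stopping_time F \<sigma>"
    and ex: "\<And>\<omega>. \<omega> \<in> space M \<Longrightarrow> \<exists>\<kappa>\<in>T (\<lambda>_. \<sigma> \<omega>). Q (\<sigma> \<omega>) \<omega> \<kappa>"
    and local: "\<And>t \<omega> \<omega>' \<kappa> \<kappa>'. \<omega> \<in> space M \<Longrightarrow> Q t \<omega> \<kappa> \<Longrightarrow> \<omega>' \<in> atom t \<omega> \<Longrightarrow>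
      (\<And>x. x \<in> atom t \<omega> \<Longrightarrow> \<kappa>' x = \<kappa> x) \<Longrightarrow> Q t \<omega>' \<kappa>'"
  shows "\<exists>\<tau>\<in>T \<sigma>. \<forall>\<omega>\<in>space M. Q (\<sigma> \<omega>) \<omega> \<tau>"
proof -
  have "\<exists>\<kappa>. \<kappa> \<in> T (\<lambda>_. \<sigma> \<omega>) \<and> (\<forall>\<omega>'\<in>atom (\<sigma> \<omega>) \<omega>. Q (\<sigma> \<omega>) \<omega>' \<kappa>)" if "\<omega> \<in> space M" for \<omega>
    using ex[OF that] local[OF that] by blast
  then have ex': "\<exists>\<kappa>. \<kappa> \<in> T (\<lambda>_. t) \<and> (\<forall>\<omega>'\<in>A. Q t \<omega>' \<kappa>)"
    if "\<omega> \<in> space M" "t = \<sigma> \<omega>" "A = atom t \<omega>" for t A \<omega>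
    using that by blast
  \<comment> \<open>The choice is a function of the time and the atom, not of the point: all points
    of an atom share one selected stopping time, and this is what makes the pasted time a stopping
    time.\<close>
  define sel where "sel t A = (SOME \<kappa>. \<kappa> \<in> T (\<lambda>_. t) \<and> (\<forall>\<omega>'\<in>A. Q t \<omega>' \<kappa>))" for t A
  have sel: "sel (\<sigma> \<omega>) (atom (\<sigma> \<omega>) \<omega>) \<in> T (\<lambda>_. \<sigma> \<omega>)"
      "\<forall>\<omega>'\<in>atom (\<sigma> \<omega>) \<omega>. Q (\<sigma> \<omega>) \<omega>' (sel (\<sigma> \<omega>) (atom (\<sigma> \<omega>) \<omega>))"
    if "\<omega> \<in> space M" for \<omega>
    using someI_ex[OF ex'[OF that refl refl], folded sel_def] by auto
  define \<tau> where "\<tau> \<omega> = sel (\<sigma> \<omega>) (atom (\<sigma> \<omega>) \<omega>) \<omega>" for \<omega>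
  have agree: "\<tau> x = sel (\<sigma> \<omega>) (atom (\<sigma> \<omega>) \<omega>) x" if "\<omega> \<in> space M" "x \<in> atom (\<sigma> \<omega>) \<omega>" for \<omega> x
    using stopping_time_atom[OF \<sigma> that] atom_eq[OF that] by (simp add: \<tau>_def)
  have ge: "\<sigma> \<omega> \<le> \<tau> \<omega>" if "\<omega> \<in> space M" for \<omega>
    using sel(1)[OF that] that by (simp add: T_iff \<tau>_def)
  have "stopping_time F \<tau>"
    unfolding stopping_time_iff
  proof (intro ballI)
    fix \<omega> x assume *: "\<omega> \<in> space M" "x \<in> atom (\<tau> \<omega>) \<omega>"
    then have "x \<in> atom (\<sigma> \<omega>) \<omega>" using atom_antimono[OF ge] by blast
    then have "\<tau> x = sel (\<sigma> \<omega>) (atom (\<sigma> \<omega>) \<omega>) x" by (rule agree[OF *(1)])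
    also have "\<dots> = sel (\<sigma> \<omega>) (atom (\<sigma> \<omega>) \<omega>) \<omega>"
      using * sel(1)[OF *(1)] by (intro stopping_time_atom) (auto simp: T_iff \<tau>_def)
    finally show "\<tau> x = \<tau> \<omega>" by (simp add: \<tau>_def)
  qed
  then have "\<tau> \<in> T \<sigma>" using ge by (simp add: T_iff)
  moreover have "Q (\<sigma> \<omega>) \<omega> \<tau>" if "\<omega> \<in> space M" for \<omega>
  proof (rule local[OF that _ atom_self[OF that]])
    show "Q (\<sigma> \<omega>) \<omega> (sel (\<sigma> \<omega>) (atom (\<sigma> \<omega>) \<omega>))"
      using sel(2)[OF that] atom_self[OF that] by blast
  qed (rule agree[OF that])
  ultimately show ?thesis by blast
qed

text \<open>
  The first argument of \<open>u\<close> is the stopping time of the maximizer. Then \<open>lowX u\<close> and \<open>uppY u\<close> are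
  \<open>X\<^sup>1\<close> and \<open>Y\<^sup>1\<close> for \<open>u = U\<^sup>1\<close>, and they are \<open>Y\<^sup>2\<close> and \<open>X\<^sup>2\<close> for \<open>u s t = U\<^sup>2 t s\<close>. Passing to
  \<open>swap u\<close> exchanges the roles of maximizer and minimizer.
\<close>

definition lowX :: "(ennreal \<Rightarrow> ennreal \<Rightarrow> 'a \<Rightarrow> real) \<Rightarrow> ennreal \<Rightarrow> 'a \<Rightarrow> real" where
  "lowX u t \<omega> = (INF \<sigma>\<in>T (\<lambda>_. t). ce t (\<lambda>\<omega>. u t (\<sigma> \<omega>) \<omega>) \<omega>)"

definition swap :: "(ennreal \<Rightarrow> ennreal \<Rightarrow> 'a \<Rightarrow> real) \<Rightarrow> ennreal \<Rightarrow> ennreal \<Rightarrow> 'a \<Rightarrow> real" where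
  "swap u s t \<omega> = - u t s \<omega>"

definition uppY :: "(ennreal \<Rightarrow> ennreal \<Rightarrow> 'a \<Rightarrow> real) \<Rightarrow> ennreal \<Rightarrow> 'a \<Rightarrow> real" where
  "uppY u t \<omega> = - lowX (swap u) t \<omega>"

definition stop_payoff ::
  "(ennreal \<Rightarrow> ennreal \<Rightarrow> 'a \<Rightarrow> real) \<Rightarrow> 'a stime \<Rightarrow> 'a stime \<Rightarrow> 'a \<Rightarrow> real" where
  "stop_payoff u \<rho> \<tau> \<omega> =
     (if \<rho> \<omega> < \<tau> \<omega> then lowX u (\<rho> \<omega>) \<omega> else if \<tau> \<omega> < \<rho> \<omega> then uppY u (\<tau> \<omega>) \<omega>
      else u (\<rho> \<omega>) (\<rho> \<omega>) \<omega>)"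

text \<open>This is the upper value; it equals the lower value by \<open>upval_swap\<close> below.\<close>

definition upval :: "(ennreal \<Rightarrow> ennreal \<Rightarrow> 'a \<Rightarrow> real) \<Rightarrow> ennreal \<Rightarrow> 'a \<Rightarrow> real" where
  "upval u t \<omega> = (INF \<tau>\<in>T (\<lambda>_. t). SUP \<rho>\<in>T (\<lambda>_. t). ce t (stop_payoff u \<rho> \<tau>) \<omega>)"

definition saddle ::
  "(ennreal \<Rightarrow> ennreal \<Rightarrow> 'a \<Rightarrow> real) \<Rightarrow> real \<Rightarrow> 'a stime \<Rightarrow> 'a stime \<Rightarrow> 'a stime \<Rightarrow> bool" where
  "saddle u \<epsilon> \<sigma> p q \<longleftrightarrow> p \<in> T \<sigma> \<and> q \<in> T \<sigma> \<and> (\<forall>a\<in>T \<sigma>. \<forall>b\<in>T \<sigma>. \<forall>\<omega>\<in>space M.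
     ce (\<sigma> \<omega>) (stop_payoff u a q) \<omega> - \<epsilon> < ce (\<sigma> \<omega>) (stop_payoff u p q) \<omega> \<and>
     ce (\<sigma> \<omega>) (stop_payoff u p q) \<omega> < ce (\<sigma> \<omega>) (stop_payoff u p b) \<omega> + \<epsilon>)"

lemma saddle_cong:
  assumes "\<And>\<omega>. \<omega> \<in> space M \<Longrightarrow> \<sigma> \<omega> = \<sigma>' \<omega>"
  shows "saddle u \<epsilon> \<sigma> p q \<longleftrightarrow> saddle u \<epsilon> \<sigma>' p q"
proof -
  have "T \<sigma> = T \<sigma>'" using assms by (auto simp: T_iff)
  then show ?thesis using assms by (simp add: saddle_def)
qed

lemma swap_swap[simp]: "swap (swap u) = u"
  by (simp add: swap_def fun_eq_iff)

lemma stop_payoff_swap: "stop_payoff (swap u) \<tau> \<rho> \<omega> = - stop_payoff u \<rho> \<tau> \<omega>"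
  by (auto simp: stop_payoff_def uppY_def) (auto simp: swap_def)

end

section \<open>Payoffs with a modulus of continuity, and the rewards \<open>lowX\<close> and
  \<open>uppY\<close>\<close>

locale game_payoff = countable_filtered_space M F
  for M :: "'a measure" and F :: "ennreal \<Rightarrow> 'a measure" +
  fixes u :: "ennreal \<Rightarrow> ennreal \<Rightarrow> 'a \<Rightarrow> real" and r :: "ennreal \<Rightarrow> real" and C :: real
  assumes u_adapted: "\<omega> \<in> space M \<Longrightarrow> \<omega>' \<in> atom (max s t) \<omega> \<Longrightarrow> u s t \<omega>' = u s t \<omega>"
    and u_bounded: "\<omega> \<in> space M \<Longrightarrow> \<bar>u s t \<omega>\<bar> \<le> C"
    and u_modulus: "\<omega> \<in> space M \<Longrightarrow>
      \<bar>u s t \<omega> - u s' t' \<omega>\<bar> \<le> r (time_dist s s' + time_dist t t')"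
    and r_mono: "mono r"
    and r_lim: "(r \<longlongrightarrow> 0) (at_right 0)"
begin

text \<open>Bound, modulus and adaptedness survive the exchange of arguments and the change of sign.
  Facts about one player thus become facts about the other by instantiating the locale at
  \<open>swap u\<close>.\<close>

lemma game_payoff_swap: "game_payoff M F (swap u) r C"
proof unfold_locales
  fix s t s' t' \<omega> assume "\<omega> \<in> space M"
  then show "\<bar>swap u s t \<omega> - swap u s' t' \<omega>\<bar> \<le> r (time_dist s s' + time_dist t t')"
    using u_modulus[of \<omega> t' s' t s] by (simp add: swap_def time_dist_commute add.commute)
qed (auto simp: swap_def r_mono r_lim max.commute intro: u_adapted u_bounded)

lemma nice_u:
  assumes "stopping_time F \<rho>" "stopping_time F \<tau>"
  shows "nice (\<lambda>\<omega>. u (\<rho> \<omega>) (\<tau> \<omega>) \<omega>)"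
proof (rule niceI[OF _ u_bounded])
  fix \<omega> \<omega>' assume *: "\<omega> \<in> space M" "\<omega>' \<in> atom \<infinity> \<omega>"
  then have "\<omega>' \<in> atom (max (\<rho> \<omega>) (\<tau> \<omega>)) \<omega>" using atom_antimono[of _ \<infinity> \<omega>] by auto
  moreover have "\<rho> \<omega>' = \<rho> \<omega>" "\<tau> \<omega>' = \<tau> \<omega>"
    by (rule stopping_time_atom_infinity[OF assms(1) *] stopping_time_atom_infinity[OF assms(2) *])+
  ultimately show "u (\<rho> \<omega>') (\<tau> \<omega>') \<omega>' = u (\<rho> \<omega>) (\<tau> \<omega>) \<omega>"
    using u_adapted * by simp
qed

lemma nice_u1: "stopping_time F \<tau> \<Longrightarrow> nice (\<lambda>\<omega>. u t (\<tau> \<omega>) \<omega>)"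
  by (rule nice_u[OF stopping_time_const])

lemma lowX_abs: "\<omega> \<in> space M \<Longrightarrow> \<sigma> \<in> T (\<lambda>_. t) \<Longrightarrow> \<bar>ce t (\<lambda>\<omega>. u t (\<sigma> \<omega>) \<omega>) \<omega>\<bar> \<le> C"
  by (intro ce_abs_le nice_u1 u_bounded T_stopping)

lemma lowX_le:
  assumes "\<omega> \<in> space M" "\<sigma> \<in> T (\<lambda>_. t)"
  shows "lowX u t \<omega> \<le> ce t (\<lambda>\<omega>. u t (\<sigma> \<omega>) \<omega>) \<omega>"
  unfolding lowX_def
proof (rule cINF_lower[OF _ assms(2)])
  show "bdd_below ((\<lambda>\<sigma>. ce t (\<lambda>\<omega>. u t (\<sigma> \<omega>) \<omega>) \<omega>) ` T (\<lambda>_. t))"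
  proof (rule bdd_belowI2[of _ "-C"])
    fix \<sigma> assume "\<sigma> \<in> T (\<lambda>_. t)"
    from lowX_abs[OF assms(1) this] show "-C \<le> ce t (\<lambda>\<omega>. u t (\<sigma> \<omega>) \<omega>) \<omega>" by linarith
  qed
qed

lemma lowX_ge:
  "(\<And>\<sigma>. \<sigma> \<in> T (\<lambda>_. t) \<Longrightarrow> c \<le> ce t (\<lambda>\<omega>. u t (\<sigma> \<omega>) \<omega>) \<omega>) \<Longrightarrow> c \<le> lowX u t \<omega>"
  unfolding lowX_def using infinity_in_T by (intro cINF_greatest) auto

lemma lowX_near:
  assumes "0 < \<eta>"
  shows "\<exists>\<sigma>\<in>T (\<lambda>_. t). ce t (\<lambda>\<omega>. u t (\<sigma> \<omega>) \<omega>) \<omega> \<le> lowX u t \<omega> + \<eta>"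
proof (rule ccontr)
  assume "\<not> ?thesis"
  then have "lowX u t \<omega> + \<eta> \<le> lowX u t \<omega>" by (intro lowX_ge) auto
  with assms show False by simp
qed

lemma lowX_bounded: "\<omega> \<in> space M \<Longrightarrow> \<bar>lowX u t \<omega>\<bar> \<le> C"
proof -
  assume \<omega>: "\<omega> \<in> space M"
  have "-C \<le> ce t (\<lambda>\<omega>. u t (\<sigma> \<omega>) \<omega>) \<omega>" if "\<sigma> \<in> T (\<lambda>_. t)" for \<sigma>
    using lowX_abs[OF \<omega> that] by linarith
  then have "-C \<le> lowX u t \<omega>" by (rule lowX_ge)
  then show ?thesis
    using lowX_le[OF \<omega> infinity_in_T, of t] lowX_abs[OF \<omega> infinity_in_T, of t] by linarith
qed

lemma lowX_atom: "\<omega> \<in> space M \<Longrightarrow> \<omega>' \<in> atom t \<omega> \<Longrightarrow> lowX u t \<omega>' = lowX u t \<omega>"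
  unfolding lowX_def by (simp add: ce_atom[of \<omega> \<omega>'])

lemma lowX_le_diag: "\<omega> \<in> space M \<Longrightarrow> lowX u t \<omega> \<le> u t t \<omega>"
  using lowX_le[OF _ const_in_T, of \<omega> t] ce_eqI[of \<omega> t "u t t" "u t t \<omega>"] u_adapted[of \<omega> _ t t] by simp

lemma lowX_infinity: "\<omega> \<in> space M \<Longrightarrow> lowX u \<infinity> \<omega> = u \<infinity> \<infinity> \<omega>"
proof (rule antisym[OF lowX_le_diag lowX_ge])
  fix \<sigma> assume \<omega>: "\<omega> \<in> space M" and \<sigma>: "\<sigma> \<in> T (\<lambda>_. \<infinity>)"
  then show "u \<infinity> \<infinity> \<omega> \<le> ce \<infinity> (\<lambda>\<omega>. u \<infinity> (\<sigma> \<omega>) \<omega>) \<omega>"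
    using u_adapted[of \<omega> _ \<infinity> \<infinity>] atom_space
    by (intro ce_ge nice_u1) (auto simp: T_iff top_unique)
qed

lemma nice_adapted:
  assumes "stopping_time F \<sigma>" "\<And>\<omega> \<omega>' t. \<omega> \<in> space M \<Longrightarrow> \<omega>' \<in> atom t \<omega> \<Longrightarrow> P t \<omega>' = P t \<omega>"
    "\<And>t \<omega>. \<omega> \<in> space M \<Longrightarrow> \<bar>P t \<omega>\<bar> \<le> B"
  shows "nice (\<lambda>\<omega>. P (\<sigma> \<omega>) \<omega> :: real)"
proof (rule niceI[OF _ assms(3)])
  fix \<omega> \<omega>' assume *: "\<omega> \<in> space M" "\<omega>' \<in> atom \<infinity> \<omega>"
  then have "\<omega>' \<in> atom (\<sigma> \<omega>) \<omega>" using atom_antimono[of _ \<infinity> \<omega>] by auto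
  then show "P (\<sigma> \<omega>') \<omega>' = P (\<sigma> \<omega>) \<omega>"
    using stopping_time_atom[OF assms(1) *(1)] assms(2)[OF *(1)] by simp
qed

lemma nice_lowX: "stopping_time F \<sigma> \<Longrightarrow> nice (\<lambda>\<omega>. lowX u (\<sigma> \<omega>) \<omega>)"
  by (rule nice_adapted[OF _ lowX_atom lowX_bounded])

text \<open>Near-optimality at a point involves only the values of the stopping time on one atom, so
  near-optimal times of the individual atoms can be pasted.\<close>

lemma lowX_near_stopping:
  assumes "stopping_time F \<sigma>" "0 < \<eta>"
  shows "\<exists>\<tau>\<in>T \<sigma>. \<forall>\<omega>\<in>space M. ce (\<sigma> \<omega>) (\<lambda>x. u (\<sigma> \<omega>) (\<tau> x) x) \<omega> \<le> lowX u (\<sigma> \<omega>) \<omega> + \<eta>"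
proof (rule paste_stopping_times[OF assms(1)])
  fix \<omega> show "\<exists>\<kappa>\<in>T (\<lambda>_. \<sigma> \<omega>). ce (\<sigma> \<omega>) (\<lambda>x. u (\<sigma> \<omega>) (\<kappa> x) x) \<omega> \<le> lowX u (\<sigma> \<omega>) \<omega> + \<eta>"
    using lowX_near[OF assms(2)] .
next
  fix t \<omega> \<omega>' \<kappa> \<kappa>'
  assume *: "\<omega> \<in> space M" "ce t (\<lambda>x. u t (\<kappa> x) x) \<omega> \<le> lowX u t \<omega> + \<eta>" "\<omega>' \<in> atom t \<omega>"
    "\<And>x. x \<in> atom t \<omega> \<Longrightarrow> \<kappa>' x = \<kappa> x"
  then have "ce t (\<lambda>x. u t (\<kappa>' x) x) \<omega> = ce t (\<lambda>x. u t (\<kappa> x) x) \<omega>"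
    by (intro ce_cong) simp
  then show "ce t (\<lambda>x. u t (\<kappa>' x) x) \<omega>' \<le> lowX u t \<omega>' + \<eta>"
    using * by (simp add: ce_atom[of \<omega> \<omega>'] lowX_atom[of \<omega> \<omega>'])
qed

text \<open>A near-optimal time for s is admissible at the earlier q as well, and only the first
  argument of \<open>u\<close> moves.\<close>

lemma lowX_le_later:
  assumes \<omega>: "\<omega> \<in> space M" and "q \<le> s"
  shows "lowX u q \<omega> \<le> ce q (lowX u s) \<omega> + r (time_dist q s)"
proof (rule field_le_epsilon)
  fix \<eta> :: real assume "0 < \<eta>"
  then obtain \<sigma> where \<sigma>: "\<sigma> \<in> T (\<lambda>_. s)"
    "\<And>x. x \<in> space M \<Longrightarrow> ce s (\<lambda>y. u s (\<sigma> y) y) x \<le> lowX u s x + \<eta>"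
    using lowX_near_stopping[OF stopping_time_const, of \<eta> s] by auto
  note st = T_stopping[OF \<sigma>(1)]
  have "\<sigma> \<in> T (\<lambda>_. q)" using \<sigma>(1) assms(2) by (auto simp: T_iff intro: order_trans)
  then have "lowX u q \<omega> \<le> ce q (\<lambda>y. u q (\<sigma> y) y) \<omega>" by (rule lowX_le[OF \<omega>])
  also have "\<dots> \<le> ce q (\<lambda>y. u s (\<sigma> y) y + r (time_dist q s)) \<omega>"
  proof (intro ce_mono nice_add nice_u1 nice_const st \<omega>)
    fix x assume "x \<in> atom q \<omega>"
    then show "u q (\<sigma> x) x \<le> u s (\<sigma> x) x + r (time_dist q s)"
      using u_modulus[OF atom_space, of x q \<omega> q "\<sigma> x" s "\<sigma> x"] by simp
  qed
  also have "\<dots> = ce q (ce s (\<lambda>y. u s (\<sigma> y) y)) \<omega> + r (time_dist q s)"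
    using assms st by (simp add: ce_add_const nice_u1 ce_ce)
  also have "ce q (ce s (\<lambda>y. u s (\<sigma> y) y)) \<omega> \<le> ce q (\<lambda>x. lowX u s x + \<eta>) \<omega>"
    using \<sigma>(2) nice_ce[OF stopping_time_const nice_u1[OF st], of s s] nice_lowX[OF stopping_time_const, of s]
    by (intro ce_mono nice_add nice_const \<omega>) (auto simp: atom_space)
  also have "\<dots> = ce q (lowX u s) \<omega> + \<eta>"
    using nice_lowX[OF stopping_time_const, of s] \<omega> by (simp add: ce_add_const)
  finally show "lowX u q \<omega> \<le> ce q (lowX u s) \<omega> + r (time_dist q s) + \<eta>" by simp
qed

text \<open>A competitor \<sigma> for q becomes one for s after taking the maximum with s. Both
  arguments of \<open>u\<close> then move by at most \<open>time_dist q s\<close>, whence the factor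
  2.\<close>

lemma lowX_ge_later:
  assumes \<omega>: "\<omega> \<in> space M" and "q \<le> s"
  shows "ce q (lowX u s) \<omega> \<le> lowX u q \<omega> + r (2 * time_dist q s)"
proof -
  have "ce q (lowX u s) \<omega> - r (2 * time_dist q s) \<le> lowX u q \<omega>"
  proof (rule lowX_ge)
    fix \<sigma> assume \<sigma>: "\<sigma> \<in> T (\<lambda>_. q)"
    define \<tau> where "\<tau> x = max (\<sigma> x) s" for x
    have \<tau>: "\<tau> \<in> T (\<lambda>_. s)" unfolding \<tau>_def by (rule max_const_in_T[OF T_stopping[OF \<sigma>]])
    note st = T_stopping[OF \<sigma>] T_stopping[OF \<tau>]
    have "ce q (lowX u s) \<omega> \<le> ce q (ce s (\<lambda>y. u s (\<tau> y) y)) \<omega>"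
      using lowX_le[OF atom_space \<tau>] nice_ce[OF stopping_time_const nice_u1[OF st(2)], of s s]
        nice_lowX[OF stopping_time_const, of s]
      by (intro ce_mono \<omega>) auto
    also have "\<dots> = ce q (\<lambda>y. u s (\<tau> y) y) \<omega>"
      using assms st by (intro ce_ce nice_u1)
    also have "\<dots> \<le> ce q (\<lambda>y. u q (\<sigma> y) y + r (2 * time_dist q s)) \<omega>"
    proof (intro ce_mono nice_add nice_u1 nice_const st \<omega>)
      fix x assume "x \<in> atom q \<omega>"
      then have x: "x \<in> space M" by (rule atom_space)
      then have "q \<le> \<sigma> x" using \<sigma> by (simp add: T_iff)
      then have "time_dist (\<tau> x) (\<sigma> x) \<le> time_dist q s"
        by (auto simp: \<tau>_def max_def time_dist_commute[of s] intro!: time_dist_le)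
      then have "time_dist s q + time_dist (\<tau> x) (\<sigma> x) \<le> 2 * time_dist q s"
        by (simp add: time_dist_commute[of s] mult_2 add_left_mono)
      then have "r (time_dist s q + time_dist (\<tau> x) (\<sigma> x)) \<le> r (2 * time_dist q s)"
        using r_mono by (simp add: monoD)
      then show "u s (\<tau> x) x \<le> u q (\<sigma> x) x + r (2 * time_dist q s)"
        using u_modulus[OF x, of s "\<tau> x" q "\<sigma> x"] by linarith
    qed
    also have "\<dots> = ce q (\<lambda>y. u q (\<sigma> y) y) \<omega> + r (2 * time_dist q s)"
      using assms st by (simp add: ce_add_const nice_u1)
    finally show "ce q (lowX u s) \<omega> - r (2 * time_dist q s) \<le> ce q (\<lambda>y. u q (\<sigma> y) y) \<omega>" by simp
  qed
  then show ?thesis by simp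
qed

lemma uppY_ge:
  assumes "\<omega> \<in> space M" "\<sigma> \<in> T (\<lambda>_. t)"
  shows "ce t (\<lambda>\<omega>. u (\<sigma> \<omega>) t \<omega>) \<omega> \<le> uppY u t \<omega>"
  using game_payoff.lowX_le[OF game_payoff_swap assms] by (simp add: uppY_def swap_def ce_uminus)

lemma uppY_atom: "\<omega> \<in> space M \<Longrightarrow> \<omega>' \<in> atom t \<omega> \<Longrightarrow> uppY u t \<omega>' = uppY u t \<omega>"
  using game_payoff.lowX_atom[OF game_payoff_swap] by (simp add: uppY_def)

lemma uppY_bounded: "\<omega> \<in> space M \<Longrightarrow> \<bar>uppY u t \<omega>\<bar> \<le> C"
  using game_payoff.lowX_bounded[OF game_payoff_swap] by (simp add: uppY_def)

lemma diag_le_uppY: "\<omega> \<in> space M \<Longrightarrow> u t t \<omega> \<le> uppY u t \<omega>"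
  using game_payoff.lowX_le_diag[OF game_payoff_swap, of \<omega> t] by (simp add: uppY_def swap_def)

lemma uppY_infinity: "\<omega> \<in> space M \<Longrightarrow> uppY u \<infinity> \<omega> = u \<infinity> \<infinity> \<omega>"
  using game_payoff.lowX_infinity[OF game_payoff_swap, of \<omega>] by (simp add: uppY_def swap_def)

section \<open>The upper value and near-optimal strategies of the minimizer\<close>

lemma stop_payoff_bounded: "\<omega> \<in> space M \<Longrightarrow> \<bar>stop_payoff u \<rho> \<tau> \<omega>\<bar> \<le> C"
  by (simp add: stop_payoff_def lowX_bounded uppY_bounded u_bounded)

lemma nice_stop_payoff:
  assumes "stopping_time F \<rho>" "stopping_time F \<tau>"
  shows "nice (stop_payoff u \<rho> \<tau>)"
proof (rule niceI[OF _ stop_payoff_bounded])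
  fix \<omega> \<omega>' assume *: "\<omega> \<in> space M" "\<omega>' \<in> atom \<infinity> \<omega>"
  then have at: "\<omega>' \<in> atom t \<omega>" for t using atom_antimono[of _ \<infinity> \<omega>] by auto
  have "\<rho> \<omega>' = \<rho> \<omega>" "\<tau> \<omega>' = \<tau> \<omega>"
    by (rule stopping_time_atom_infinity[OF assms(1) *] stopping_time_atom_infinity[OF assms(2) *])+
  then show "stop_payoff u \<rho> \<tau> \<omega>' = stop_payoff u \<rho> \<tau> \<omega>"
    using lowX_atom[OF *(1) at] uppY_atom[OF *(1) at] u_adapted[OF *(1) at] by (simp add: stop_payoff_def)
qed

lemma ce_stop_payoff_abs:
  assumes "\<omega> \<in> space M" "stopping_time F \<rho>" "stopping_time F \<tau>"
  shows "\<bar>ce t (stop_payoff u \<rho> \<tau>) \<omega>\<bar> \<le> C"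
  using assms by (intro ce_abs_le nice_stop_payoff stop_payoff_bounded)

lemma bdd_above_stop_payoff:
  assumes "\<omega> \<in> space M" "\<tau> \<in> T (\<lambda>_. t)"
  shows "bdd_above ((\<lambda>\<rho>. ce t (stop_payoff u \<rho> \<tau>) \<omega>) ` T (\<lambda>_. t))"
  using ce_stop_payoff_abs[OF assms(1) T_stopping T_stopping[OF assms(2)]]
  by (intro bdd_aboveI[of _ C]) (auto simp: abs_le_iff)

lemma upval_le:
  assumes "\<omega> \<in> space M" "\<tau> \<in> T (\<lambda>_. t)" "\<And>\<rho>. \<rho> \<in> T (\<lambda>_. t) \<Longrightarrow> ce t (stop_payoff u \<rho> \<tau>) \<omega> \<le> c"
  shows "upval u t \<omega> \<le> c"
proof -
  have "upval u t \<omega> \<le> (SUP \<rho>\<in>T (\<lambda>_. t). ce t (stop_payoff u \<rho> \<tau>) \<omega>)"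
    unfolding upval_def
  proof (rule cINF_lower[OF _ assms(2)])
    show "bdd_below ((\<lambda>\<tau>. SUP \<rho>\<in>T (\<lambda>_. t). ce t (stop_payoff u \<rho> \<tau>) \<omega>) ` T (\<lambda>_. t))"
    proof (intro bdd_belowI2[of _ "-C"])
      fix \<tau>' assume *: "\<tau>' \<in> T (\<lambda>_. t)"
      have "-C \<le> ce t (stop_payoff u (\<lambda>_. \<infinity>) \<tau>') \<omega>"
        using ce_stop_payoff_abs[OF assms(1) stopping_time_const T_stopping[OF *], of t \<infinity>] by linarith
      also have "\<dots> \<le> (SUP \<rho>\<in>T (\<lambda>_. t). ce t (stop_payoff u \<rho> \<tau>') \<omega>)"
        using bdd_above_stop_payoff[OF assms(1) *] infinity_in_T by (intro cSUP_upper)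
      finally show "-C \<le> (SUP \<rho>\<in>T (\<lambda>_. t). ce t (stop_payoff u \<rho> \<tau>') \<omega>)" .
    qed
  qed
  also have "\<dots> \<le> c" using assms(3) infinity_in_T by (intro cSUP_least) auto
  finally show ?thesis .
qed

lemma upval_response:
  assumes "\<omega> \<in> space M" "\<tau> \<in> T (\<lambda>_. t)" "0 < \<eta>"
  shows "\<exists>\<rho>\<in>T (\<lambda>_. t). upval u t \<omega> - \<eta> \<le> ce t (stop_payoff u \<rho> \<tau>) \<omega>"
proof (rule ccontr)
  assume "\<not> ?thesis"
  then have "upval u t \<omega> \<le> upval u t \<omega> - \<eta>" by (intro upval_le[OF assms(1,2)]) auto
  with assms show False by simp
qed

lemma upval_ge:
  assumes "\<And>\<tau>. \<tau> \<in> T (\<lambda>_. t) \<Longrightarrow> \<exists>\<rho>\<in>T (\<lambda>_. t). c \<le> ce t (stop_payoff u \<rho> \<tau>) \<omega>" "\<omega> \<in> space M"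
  shows "c \<le> upval u t \<omega>"
  unfolding upval_def
proof (rule cINF_greatest)
  fix \<tau> assume *: "\<tau> \<in> T (\<lambda>_. t)"
  then obtain \<rho> where "\<rho> \<in> T (\<lambda>_. t)" "c \<le> ce t (stop_payoff u \<rho> \<tau>) \<omega>" using assms(1) by blast
  then show "c \<le> (SUP \<rho>\<in>T (\<lambda>_. t). ce t (stop_payoff u \<rho> \<tau>) \<omega>)"
    using bdd_above_stop_payoff[OF assms(2) *] by (intro cSUP_upper2)
qed (use infinity_in_T in blast)

lemma upval_near:
  assumes "\<omega> \<in> space M" "0 < \<eta>"
  shows "\<exists>\<tau>\<in>T (\<lambda>_. t). \<forall>\<rho>\<in>T (\<lambda>_. t). ce t (stop_payoff u \<rho> \<tau>) \<omega> \<le> upval u t \<omega> + \<eta>"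
proof (rule ccontr)
  assume *: "\<not> ?thesis"
  have "upval u t \<omega> + \<eta> \<le> upval u t \<omega>"
  proof (rule upval_ge[OF _ assms(1)])
    fix \<tau> assume "\<tau> \<in> T (\<lambda>_. t)"
    then show "\<exists>\<rho>\<in>T (\<lambda>_. t). upval u t \<omega> + \<eta> \<le> ce t (stop_payoff u \<rho> \<tau>) \<omega>"
      using * by (meson less_imp_le not_le)
  qed
  with assms show False by simp
qed

lemma upval_bounded: "\<omega> \<in> space M \<Longrightarrow> \<bar>upval u t \<omega>\<bar> \<le> C"
  unfolding abs_le_iff
proof
  assume \<omega>: "\<omega> \<in> space M"
  note b = ce_stop_payoff_abs[OF \<omega> T_stopping T_stopping, of _ "\<lambda>_. t" _ "\<lambda>_. t" t]
  show "upval u t \<omega> \<le> C"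
    using b[OF _ infinity_in_T] by (intro upval_le[OF \<omega> infinity_in_T]) (auto simp: abs_le_iff)
  have "-C \<le> upval u t \<omega>"
    using b[OF infinity_in_T] infinity_in_T by (intro upval_ge[OF _ \<omega>]) (force simp: abs_le_iff)
  then show "- upval u t \<omega> \<le> C" by simp
qed

lemma upval_atom: "\<omega> \<in> space M \<Longrightarrow> \<omega>' \<in> atom t \<omega> \<Longrightarrow> upval u t \<omega>' = upval u t \<omega>"
  unfolding upval_def by (simp add: ce_atom[of \<omega> \<omega>'])

lemma nice_upval: "stopping_time F \<sigma> \<Longrightarrow> nice (\<lambda>\<omega>. upval u (\<sigma> \<omega>) \<omega>)"
  by (rule nice_adapted[OF _ upval_atom upval_bounded])

text \<open>The maximizer may stop at once: it then receives \<open>lowX\<close> if the minimizer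
  continues, and the diagonal payoff, which is no smaller, if the minimizer stops too.\<close>

lemma lowX_le_upval:
  assumes \<omega>: "\<omega> \<in> space M"
  shows "lowX u t \<omega> \<le> upval u t \<omega>"
proof (rule upval_ge[OF bexI[OF _ const_in_T] \<omega>])
  fix \<tau> assume \<tau>: "\<tau> \<in> T (\<lambda>_. t)"
  show "lowX u t \<omega> \<le> ce t (stop_payoff u (\<lambda>_. t) \<tau>) \<omega>"
  proof (intro ce_ge nice_stop_payoff stopping_time_const T_stopping[OF \<tau>] \<omega>)
    fix x assume x: "x \<in> atom t \<omega>"
    then have "t \<le> \<tau> x" using \<tau> atom_space by (auto simp: T_iff)
    then show "lowX u t \<omega> \<le> stop_payoff u (\<lambda>_. t) \<tau> x"
      using lowX_atom[OF \<omega> x] lowX_le_diag[OF atom_space[OF x], of t] by (auto simp: stop_payoff_def)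
  qed
qed

lemma upval_le_uppY:
  assumes \<omega>: "\<omega> \<in> space M"
  shows "upval u t \<omega> \<le> uppY u t \<omega>"
proof (rule upval_le[OF \<omega> const_in_T])
  fix \<rho> assume \<rho>: "\<rho> \<in> T (\<lambda>_. t)"
  show "ce t (stop_payoff u \<rho> (\<lambda>_. t)) \<omega> \<le> uppY u t \<omega>"
  proof (intro ce_le nice_stop_payoff stopping_time_const T_stopping[OF \<rho>] \<omega>)
    fix x assume x: "x \<in> atom t \<omega>"
    then have "t \<le> \<rho> x" using \<rho> atom_space by (auto simp: T_iff)
    then show "stop_payoff u \<rho> (\<lambda>_. t) x \<le> uppY u t \<omega>"
      using uppY_atom[OF \<omega> x] diag_le_uppY[OF atom_space[OF x], of t] by (auto simp: stop_payoff_def)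
  qed
qed

text \<open>Opponents are asked to lie after \<sigma> only on the atom of \<omega>, not on the whole
  space; this makes the property depend on the atom alone, as pasting demands.\<close>

lemma upval_near_stopping:
  assumes \<sigma>: "stopping_time F \<sigma>" and "0 < \<eta>"
  shows "\<exists>\<tau>\<in>T \<sigma>. \<forall>\<omega>\<in>space M. \<forall>\<rho>. stopping_time F \<rho> \<longrightarrow> (\<forall>x\<in>atom (\<sigma> \<omega>) \<omega>. \<sigma> \<omega> \<le> \<rho> x) \<longrightarrow>
    ce (\<sigma> \<omega>) (stop_payoff u \<rho> \<tau>) \<omega> \<le> upval u (\<sigma> \<omega>) \<omega> + \<eta>"
proof (rule paste_stopping_times[OF \<sigma>])
  fix \<omega> assume \<omega>: "\<omega> \<in> space M"
  let ?t = "\<sigma> \<omega>"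
  obtain \<tau> where \<tau>: "\<tau> \<in> T (\<lambda>_. ?t)"
    "\<And>\<rho>. \<rho> \<in> T (\<lambda>_. ?t) \<Longrightarrow> ce ?t (stop_payoff u \<rho> \<tau>) \<omega> \<le> upval u ?t \<omega> + \<eta>"
    using upval_near[OF \<omega> assms(2)] by blast
  show "\<exists>\<kappa>\<in>T (\<lambda>_. ?t). \<forall>\<rho>. stopping_time F \<rho> \<longrightarrow> (\<forall>x\<in>atom ?t \<omega>. ?t \<le> \<rho> x) \<longrightarrow>
    ce ?t (stop_payoff u \<rho> \<kappa>) \<omega> \<le> upval u ?t \<omega> + \<eta>"
  proof (intro bexI[OF _ \<tau>(1)] allI impI)
    fix \<rho> assume \<rho>: "stopping_time F \<rho>" "\<forall>x\<in>atom ?t \<omega>. ?t \<le> \<rho> x"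
    have "ce ?t (stop_payoff u \<rho> \<tau>) \<omega> = ce ?t (stop_payoff u (\<lambda>x. max (\<rho> x) ?t) \<tau>) \<omega>"
      using \<rho>(2) by (intro ce_cong) (simp only: stop_payoff_def max_absorb1)
    also have "\<dots> \<le> upval u ?t \<omega> + \<eta>" by (rule \<tau>(2)[OF max_const_in_T[OF \<rho>(1)]])
    finally show "ce ?t (stop_payoff u \<rho> \<tau>) \<omega> \<le> upval u ?t \<omega> + \<eta>" .
  qed
next
  fix t \<omega> \<omega>' \<kappa> \<kappa>'
  assume *: "\<omega> \<in> space M" "\<forall>\<rho>. stopping_time F \<rho> \<longrightarrow> (\<forall>x\<in>atom t \<omega>. t \<le> \<rho> x) \<longrightarrow>
    ce t (stop_payoff u \<rho> \<kappa>) \<omega> \<le> upval u t \<omega> + \<eta>" "\<omega>' \<in> atom t \<omega>"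
    "\<And>x. x \<in> atom t \<omega> \<Longrightarrow> \<kappa>' x = \<kappa> x"
  have "ce t (stop_payoff u \<rho> \<kappa>') \<omega> = ce t (stop_payoff u \<rho> \<kappa>) \<omega>" for \<rho>
    using *(4) by (intro ce_cong) (simp add: stop_payoff_def)
  then show "\<forall>\<rho>. stopping_time F \<rho> \<longrightarrow> (\<forall>x\<in>atom t \<omega>'. t \<le> \<rho> x) \<longrightarrow>
    ce t (stop_payoff u \<rho> \<kappa>') \<omega>' \<le> upval u t \<omega>' + \<eta>"
    using *(2) by (simp add: ce_atom[OF *(1,3)] upval_atom[OF *(1,3)] atom_eq[OF *(1,3)])
qed

end

section \<open>Hitting times and right continuity of averages\<close>

lemma less_add_ennreal: "t < \<infinity> \<Longrightarrow> 0 < d \<Longrightarrow> t < t + ennreal d"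
  using ennreal_add_left_cancel_less[of t 0 "ennreal d"] by simp

context countable_filtered_space
begin

text \<open>The infimum need not be attained, so the information at the infimum does not obviously
  decide it. But \<omega>' stays in the atom of \<omega> up to some strictly later \<open>b\<close>,
  and the hitting times below \<open>b\<close> determine the infimum.\<close>

lemma stopping_time_hitting:
  assumes adapted: "\<And>s \<omega> \<omega>'. \<omega> \<in> space M \<Longrightarrow> \<omega>' \<in> atom s \<omega> \<Longrightarrow> A s \<omega> \<Longrightarrow> A s \<omega>'"
  shows "stopping_time F (\<lambda>\<omega>. Inf {s. A s \<omega>})"
  unfolding stopping_time_iff
proof (intro ballI)
  fix \<omega> \<omega>' assume \<omega>: "\<omega> \<in> space M" and \<omega>': "\<omega>' \<in> atom (Inf {s. A s \<omega>}) \<omega>"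
  let ?t = "Inf {s. A s \<omega>}"
  have "?t \<le> Inf {s. A s \<omega>'}"
  proof (rule Inf_greatest, rule ccontr)
    fix s assume s: "s \<in> {s. A s \<omega>'}" "\<not> ?t \<le> s"
    then have "s \<le> ?t" by simp
    then have "\<omega>' \<in> atom s \<omega>" using atom_antimono \<omega>' by blast
    then have "A s \<omega>" using s adapted[of \<omega>' \<omega> s] atom_sym[OF \<omega>] atom_space by auto
    then have "?t \<le> s" by (intro Inf_lower) simp
    with s show False by simp
  qed
  moreover have "Inf {s. A s \<omega>'} \<le> ?t"
  proof (cases "?t < \<infinity>")
    case True
    obtain b where b: "?t < b" "\<omega>' \<in> atom b \<omega>"
      using atom_right_continuous[OF True \<omega> \<omega>'] by blast
    show ?thesis
    proof (rule dense_ge_bounded[OF b(1)])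
      fix y assume y: "?t < y" "y < b"
      then obtain s where s: "A s \<omega>" "s < y" by (auto simp: Inf_less_iff)
      then have "s \<le> b" using y by simp
      then have "\<omega>' \<in> atom s \<omega>" using atom_antimono b(2) by blast
      then have "Inf {s. A s \<omega>'} \<le> s" using adapted[OF \<omega> _ s(1)] by (intro Inf_lower) simp
      then show "Inf {s. A s \<omega>'} \<le> y" using s by simp
    qed
  next
    case False
    then have "?t = top" using top.not_eq_extremum unfolding infinity_ennreal_def by blast
    then show ?thesis by (simp only: top_greatest)
  qed
  ultimately show "Inf {s. A s \<omega>'} = ?t" by (rule antisym[rotated])
qed

text \<open>An infinite infimum is settled by \<open>P \<infinity>\<close>. For a finite one it
  remains to show that \<open>P\<close> is inherited from points arbitrarily close on the right,
  which right continuity of the processes supplies.\<close>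

lemma Inf_attained:
  fixes P :: "ennreal \<Rightarrow> bool"
  assumes "P \<infinity>"
    and lim: "Inf {s. P s} < \<infinity> \<Longrightarrow>
      (\<And>d::real. 0 < d \<Longrightarrow> \<exists>s. Inf {s. P s} \<le> s \<and> s \<le> Inf {s. P s} + ennreal d \<and> P s) \<Longrightarrow> P (Inf {s. P s})"
  shows "P (Inf {s. P s})"
proof (cases "Inf {s. P s} < \<infinity>")
  case True
  show ?thesis
  proof (rule lim[OF True])
    fix d :: real assume "0 < d"
    then have "Inf {s. P s} < Inf {s. P s} + ennreal d" by (rule less_add_ennreal[OF True])
    then obtain s where "P s" "s < Inf {s. P s} + ennreal d" by (auto simp: Inf_less_iff)
    then show "\<exists>s. Inf {s. P s} \<le> s \<and> s \<le> Inf {s. P s} + ennreal d \<and> P s"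
      by (intro exI[of _ s]) (auto intro: Inf_lower less_imp_le)
  qed
next
  case False
  then have "Inf {s. P s} = \<infinity>" using top.not_eq_extremum unfolding infinity_ennreal_def by blast
  then show ?thesis using assms(1) by (simp only:)
qed

text \<open>One \<open>d\<close> serves all functions with the same bound. This uniformity matters
  in applications to functions such as \<open>lowX u s\<close>, which change with s.\<close>

lemma ce_right_close:
  assumes "t < \<infinity>" "\<omega> \<in> space M" "0 < e" "0 \<le> B"
  obtains d :: real where "0 < d"
    "\<And>s f. t \<le> s \<Longrightarrow> s \<le> t + ennreal d \<Longrightarrow> nice f \<Longrightarrow> (\<And>x. x \<in> space M \<Longrightarrow> \<bar>f x\<bar> \<le> B) \<Longrightarrow>
      \<bar>ce t f \<omega> - ce s f \<omega>\<bar> < e"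
proof -
  \<comment> \<open>The denominator \<open>2 * B + 1\<close> covers \<open>B = 0\<close> and makes
    the final estimate strict.\<close>
  obtain d where d: "0 < d" "\<And>s. t \<le> s \<Longrightarrow> s \<le> t + ennreal d \<Longrightarrow>
      1 - prob (atom s \<omega>) / prob (atom t \<omega>) < e / (2 * B + 1)"
    using prob_atom_right_continuous[OF assms(1,2), of "e / (2 * B + 1)"] assms(3,4) by auto
  show ?thesis
  proof (rule that[OF d(1)])
    fix s f assume *: "t \<le> s" "s \<le> t + ennreal d" "nice f" "\<And>x. x \<in> space M \<Longrightarrow> \<bar>f x\<bar> \<le> B"
    have "\<bar>ce t f \<omega> - ce s f \<omega>\<bar> \<le> 2 * B * (1 - prob (atom s \<omega>) / prob (atom t \<omega>))"
      using * assms(2) by (intro ce_close)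
    also have "\<dots> \<le> 2 * B * (e / (2 * B + 1))"
      using d(2)[OF *(1,2)] assms(4) by (intro mult_left_mono) auto
    also have "\<dots> < e" using assms(3,4) by (simp add: field_simps)
    finally show "\<bar>ce t f \<omega> - ce s f \<omega>\<bar> < e" .
  qed
qed

end

context game_payoff
begin

section \<open>The upper value as a process in time\<close>

lemma r_nonneg: "\<omega> \<in> space M \<Longrightarrow> 0 \<le> r x"
proof -
  assume "\<omega> \<in> space M"
  then have "0 \<le> r 0" using u_modulus[of \<omega> 0 0 0 0] by simp
  also have "\<dots> \<le> r x" using r_mono by (simp add: monoD)
  finally show ?thesis .
qed

lemma C_nonneg: "\<omega> \<in> space M \<Longrightarrow> 0 \<le> C"
  using u_bounded[of \<omega> 0 0] by linarith

lemma r_small: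
  assumes "0 < e"
  obtains d :: real where "0 < d" "\<And>x. x \<le> ennreal d \<Longrightarrow> r x < e"
proof -
  have "eventually (\<lambda>x. r x < e) (at_right 0)" using r_lim assms by (rule order_tendstoD)
  then obtain b where b: "0 < b" "\<And>y. 0 < y \<Longrightarrow> y < b \<Longrightarrow> r y < e"
    unfolding eventually_at_right[OF ennreal_zero_less_top] by blast
  \<comment> \<open>A single small value \<open>r c\<close> bounds \<open>r\<close> on the whole
    interval from 0 to \<open>c\<close>, endpoint 0 included, by monotonicity.\<close>
  obtain c where c: "0 < c" "c < b" using dense[OF b(1)] by blast
  then have "c < \<infinity>" by (auto intro: order_less_le_trans)
  then have c': "c = ennreal (enn2real c)" by simp
  show ?thesis
  proof (rule that)
    show "0 < enn2real c" using c \<open>c < \<infinity>\<close> by (simp add: enn2real_positive_iff)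
    fix x assume "x \<le> ennreal (enn2real c)"
    then have "r x \<le> r c" using r_mono c' by (simp add: monoD)
    then show "r x < e" using b(2)[OF c] by simp
  qed
qed

text \<open>The minimizer may wait until \<open>m\<close> and play almost optimally from then on.\<close>

lemma upval_le_continuation:
  assumes \<omega>: "\<omega> \<in> space M" and m: "stopping_time F m" and t: "t \<le> m \<omega>" and K: "0 \<le> K"
    and early: "\<And>s x. x \<in> atom t \<omega> \<Longrightarrow> t \<le> s \<Longrightarrow> s < m x \<Longrightarrow>
      lowX u s x \<le> ce s (\<lambda>y. upval u (m y) y) x + K"
  shows "upval u t \<omega> \<le> ce t (\<lambda>y. upval u (m y) y) \<omega> + K"
proof (rule field_le_epsilon)
  let ?w = "\<lambda>y. upval u (m y) y"
  fix \<eta>' :: real assume "0 < \<eta>'"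
  define \<eta> where "\<eta> = \<eta>' / 2"
  have \<eta>: "0 < \<eta>" using \<open>0 < \<eta>'\<close> by (simp add: \<eta>_def)
  obtain \<tau> where \<tau>: "\<tau> \<in> T m" and near: "\<And>x \<rho>. x \<in> space M \<Longrightarrow> stopping_time F \<rho> \<Longrightarrow>
      (\<And>y. y \<in> atom (m x) x \<Longrightarrow> m x \<le> \<rho> y) \<Longrightarrow>
      ce (m x) (stop_payoff u \<rho> \<tau>) x \<le> upval u (m x) x + \<eta>"
    using upval_near_stopping[OF m \<eta>] by blast
  note \<tau>s = T_stopping[OF \<tau>]
  have tm: "t \<le> m x" if "x \<in> atom t \<omega>" for x
    using stopping_time_atom_early[OF m \<omega> t that] .
  have m\<tau>: "m x \<le> \<tau> x" if "x \<in> space M" for x using \<tau> that by (simp add: T_iff)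
  \<comment> \<open>A nearly best reply to waiting. The minimizer's time lies after t only on the
    atom of \<omega>; taking the maximum with t makes it admissible everywhere and changes nothing
    on that atom.\<close>
  obtain \<rho> where \<rho>: "\<rho> \<in> T (\<lambda>_. t)"
    "upval u t \<omega> - \<eta> \<le> ce t (stop_payoff u \<rho> (\<lambda>x. max (\<tau> x) t)) \<omega>"
    using upval_response[OF \<omega> max_const_in_T[OF \<tau>s] \<eta>] by blast
  note \<rho>s = T_stopping[OF \<rho>(1)]
  have max\<tau>: "max (\<tau> x) t = \<tau> x" if "x \<in> atom t \<omega>" for x
    using tm[OF that] m\<tau>[OF atom_space[OF that]] by (simp add: max_absorb1)
  \<comment> \<open>Conditioning at whichever comes first: if the maximizer stops, the payoff is
    \<open>lowX\<close> and \<open>early\<close> controls it; if \<open>m\<close> arrives, play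
    continues against the near-optimal \<tau>.\<close>
  define q where "q x = min (\<rho> x) (m x)" for x
  have q: "stopping_time F q" unfolding q_def by (rule stopping_time_min[OF \<rho>s m])
  have tq: "t \<le> q x" if "x \<in> atom t \<omega>" for x
    using tm[OF that] \<rho>(1) atom_space[OF that] by (simp add: q_def T_iff)
  note nD = nice_stop_payoff[OF \<rho>s \<tau>s] and nw = nice_upval[OF m]
  have "ce t (stop_payoff u \<rho> (\<lambda>x. max (\<tau> x) t)) \<omega> = ce t (stop_payoff u \<rho> \<tau>) \<omega>"
    by (intro ce_cong) (simp only: stop_payoff_def max\<tau>)
  also have "\<dots> = ce t (\<lambda>x. ce (q x) (stop_payoff u \<rho> \<tau>) x) \<omega>"
    by (rule ce_tower[symmetric, OF q nD \<omega> tq[OF atom_self[OF \<omega>]]])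
  also have "\<dots> \<le> ce t (\<lambda>x. ce (q x) ?w x + (\<eta> + K)) \<omega>"
  proof (intro ce_mono nice_add nice_const nice_ce q nD nw \<omega>)
    fix x assume x: "x \<in> atom t \<omega>"
    note xM = atom_space[OF x]
    show "ce (q x) (stop_payoff u \<rho> \<tau>) x \<le> ce (q x) ?w x + (\<eta> + K)"
    proof (cases "\<rho> x < m x")
      case True
      have "ce (\<rho> x) (stop_payoff u \<rho> \<tau>) x = lowX u (\<rho> x) x"
      proof (rule ce_eqI[OF xM])
        fix y assume y: "y \<in> atom (\<rho> x) x"
        have "\<rho> x < m y" by (rule stopping_time_atom_less[OF m xM True y])
        then have "\<rho> x < \<tau> y" using m\<tau>[OF atom_space[OF y]] by simp
        then show "stop_payoff u \<rho> \<tau> y = lowX u (\<rho> x) x"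
          using stopping_time_atom[OF \<rho>s xM y] lowX_atom[OF xM y] by (simp add: stop_payoff_def)
      qed
      also have "\<dots> \<le> ce (\<rho> x) ?w x + K"
        using \<rho>(1) xM by (intro early x True) (auto simp: T_iff)
      finally show ?thesis using True \<eta> by (simp add: q_def min_absorb1 less_imp_le)
    next
      case False
      then have mx: "m x \<le> \<rho> x" by simp
      have "ce (m x) (stop_payoff u \<rho> \<tau>) x \<le> upval u (m x) x + \<eta>"
        by (intro near xM \<rho>s) (rule stopping_time_atom_early[OF \<rho>s xM mx])
      also have "upval u (m x) x = ce (m x) ?w x"
        using stopping_time_atom[OF m xM] upval_atom[OF xM] by (intro ce_eqI[symmetric, OF xM]) simp
      finally show ?thesis using mx K by (simp add: q_def min_absorb2)
    qed
  qed
  also have "\<dots> = ce t ?w \<omega> + (\<eta> + K)"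
    using ce_tower[OF q nw \<omega> tq[OF atom_self[OF \<omega>]]] by (simp add: ce_add_const nice_ce q nw \<omega>)
  finally show "upval u t \<omega> \<le> ce t ?w \<omega> + K + \<eta>'" using \<rho>(2) by (simp add: \<eta>_def)
qed

text \<open>Waiting until s costs the minimizer little: up to the modulus \<open>lowX u q\<close>
  lies below the conditional mean of \<open>lowX u s\<close>, which lies below that of the
  value.\<close>

lemma upval_le_later:
  assumes \<omega>: "\<omega> \<in> space M" and "t \<le> s"
  shows "upval u t \<omega> \<le> ce t (upval u s) \<omega> + r (time_dist t s)"
proof (rule upval_le_continuation[OF \<omega> stopping_time_const assms(2) r_nonneg[OF \<omega>]])
  fix q x assume *: "x \<in> atom t \<omega>" "t \<le> q" "q < s"
  note x = atom_space[OF *(1)]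
  have "lowX u q x \<le> ce q (lowX u s) x + r (time_dist q s)"
    using * by (intro lowX_le_later x) simp
  also have "ce q (lowX u s) x \<le> ce q (upval u s) x"
    using nice_lowX[OF stopping_time_const, of s] nice_upval[OF stopping_time_const, of s]
    by (intro ce_mono x lowX_le_upval atom_space) auto
  also have "r (time_dist q s) \<le> r (time_dist t s)"
    using * by (intro monoD[OF r_mono] time_dist_le) auto
  finally show "lowX u q x \<le> ce q (upval u s) x + r (time_dist t s)" by simp
qed

text \<open>Let \<open>G\<close> be the largest possible violation. Before \<open>m\<close> the maximizer loses \<open>\<epsilon>\<close> by stopping,
  so a violation is at most \<open>max 0 (G - \<epsilon>)\<close>; hence \<open>G \<le> 0\<close>.\<close>

lemma upval_submartingale:
  assumes \<omega>: "\<omega> \<in> space M" and m: "stopping_time F m" and t: "t \<le> m \<omega>" and "0 < \<epsilon>"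
    and gap: "\<And>s x. x \<in> atom t \<omega> \<Longrightarrow> t \<le> s \<Longrightarrow> s < m x \<Longrightarrow> lowX u s x + \<epsilon> \<le> upval u s x"
  shows "upval u t \<omega> \<le> ce t (\<lambda>y. upval u (m y) y) \<omega>"
proof -
  let ?w = "\<lambda>y. upval u (m y) y"
  \<comment> \<open>All pairs of a point of the atom and a time between t and \<open>m\<close>. The
    violation is taken over all of them at once, since the bound for one pair uses the bounds for
    later pairs.\<close>
  define N where "N = {(s, x). x \<in> atom t \<omega> \<and> t \<le> s \<and> s \<le> m x}"
  define g where "g = (\<lambda>(s, x). upval u s x - ce s ?w x)"
  define G where "G = (SUP p\<in>N. g p)"
  have N: "(t, \<omega>) \<in> N" using atom_self[OF \<omega>] t by (simp add: N_def)
  have "g p \<le> 2 * C" if "p \<in> N" for p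
  proof -
    obtain s x where p: "p = (s, x)" by (cases p)
    then have x: "x \<in> space M" using that atom_space by (auto simp: N_def)
    have "\<bar>ce s ?w x\<bar> \<le> C" by (intro ce_abs_le nice_upval m upval_bounded x)
    then show ?thesis using upval_bounded[OF x, of s] by (simp add: g_def p)
  qed
  then have bdd: "bdd_above (g ` N)" by (intro bdd_aboveI2)
  have le: "g p \<le> G" if "p \<in> N" for p unfolding G_def by (rule cSUP_upper[OF that bdd])
  have step: "g p \<le> max 0 (G - \<epsilon>)" if "p \<in> N" for p
  proof -
    obtain s x where p: "p = (s, x)" and x: "x \<in> atom t \<omega>" and ts: "t \<le> s" "s \<le> m x"
      using \<open>p \<in> N\<close> by (cases p) (auto simp: N_def)
    note xM = atom_space[OF x]
    have "upval u s x \<le> ce s ?w x + max 0 (G - \<epsilon>)"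
    \<comment> \<open>At an earlier stop \<open>lowX\<close> is \<epsilon> below the value, and the
      value exceeds its conditional mean by at most \<open>G\<close>. So
      \<open>G - \<epsilon>\<close> can serve as \<open>K\<close>, truncated at 0 because
      \<open>K\<close> must be nonnegative.\<close>
    proof (rule upval_le_continuation[OF xM m ts(2)])
      fix s' y assume y: "y \<in> atom s x" "s \<le> s'" "s' < m y"
      have y': "y \<in> atom t \<omega>" using y(1) atom_antimono[OF ts(1), of x] atom_eq[OF \<omega> x] by blast
      then have "g (s', y) \<le> G" using y ts by (intro le) (auto simp: N_def)
      moreover have "lowX u s' y + \<epsilon> \<le> upval u s' y" using y ts by (intro gap y') auto
      ultimately show "lowX u s' y \<le> ce s' ?w y + max 0 (G - \<epsilon>)" by (simp add: g_def)
    qed simp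
    then show ?thesis by (simp add: p g_def)
  qed
  have "(SUP p\<in>N. g p) \<le> max 0 (G - \<epsilon>)"
    using N step by (intro cSUP_least) blast+
  then have "G \<le> max 0 (G - \<epsilon>)" by (simp only: G_def)
  then have "G \<le> 0" using \<open>0 < \<epsilon>\<close> by simp
  then show ?thesis using le[OF N] by (simp add: g_def)
qed

lemma time_dist_add: "t \<le> s \<Longrightarrow> s \<le> t + ennreal d \<Longrightarrow> t < \<infinity> \<Longrightarrow> time_dist t s \<le> ennreal d"
  by (auto simp: time_dist_def max_def min_def less_top[symmetric] ennreal_minus_le_iff add.commute)

text \<open>These two halves of right continuity keep the inequality
  \<open>upval \<le> lowX + \<eta>\<close> valid in the limit. The upper half for
  \<open>upval\<close> is obtained by symmetry once the value is known to exist.\<close>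

lemma right_estimates:
  assumes "t < \<infinity>" "\<omega> \<in> space M" "0 < e"
  obtains d :: real where "0 < d"
    "\<And>s. t \<le> s \<Longrightarrow> s \<le> t + ennreal d \<Longrightarrow> lowX u s \<omega> \<le> lowX u t \<omega> + e"
    "\<And>s. t \<le> s \<Longrightarrow> s \<le> t + ennreal d \<Longrightarrow> upval u t \<omega> \<le> upval u s \<omega> + e"
proof -
  obtain d1 where d1: "0 < d1" "\<And>s f. t \<le> s \<Longrightarrow> s \<le> t + ennreal d1 \<Longrightarrow> nice f \<Longrightarrow>
      (\<And>x. x \<in> space M \<Longrightarrow> \<bar>f x\<bar> \<le> C) \<Longrightarrow> \<bar>ce t f \<omega> - ce s f \<omega>\<bar> < e / 2"
    using ce_right_close[OF assms(1,2), of "e/2" C] C_nonneg[OF assms(2)] assms(3) by auto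
  obtain d2 where d2: "0 < d2" "\<And>x. x \<le> ennreal d2 \<Longrightarrow> r x < e / 2"
    using r_small[of "e/2"] assms(3) by auto
  show ?thesis
  \<comment> \<open>Half of \<open>d2\<close>, because \<open>lowX_ge_later\<close> evaluates the
    modulus at twice the distance.\<close>
  proof (rule that[of "min d1 (d2 / 2)"])
    fix s assume s: "t \<le> s" "s \<le> t + ennreal (min d1 (d2 / 2))"
    have s': "s \<le> t + ennreal d1" "s \<le> t + ennreal (d2 / 2)"
      using s(2) by (auto elim!: order_trans intro!: add_left_mono ennreal_leI)
    have "2 * time_dist t s \<le> 2 * ennreal (d2 / 2)"
      using s(1) s'(2) assms(1) by (intro mult_left_mono time_dist_add) auto
    also have "\<dots> = ennreal d2" using d2(1) by (simp add: ennreal_mult'[symmetric] flip: ennreal_numeral)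
    finally have r2: "r (2 * time_dist t s) < e / 2" by (rule d2(2))
    have "r (time_dist t s) \<le> r (2 * time_dist t s)"
      by (intro monoD[OF r_mono]) (simp add: mult_2 add_increasing)
    with r2 have r1: "r (time_dist t s) < e / 2" by simp
    have "\<bar>ce t (lowX u s) \<omega> - ce s (lowX u s) \<omega>\<bar> < e / 2"
      using nice_lowX[OF stopping_time_const, of s] by (intro d1(2) s(1) s'(1) lowX_bounded)
    moreover have "ce s (lowX u s) \<omega> = lowX u s \<omega>" by (intro ce_eqI assms(2) lowX_atom)
    ultimately show "lowX u s \<omega> \<le> lowX u t \<omega> + e" using lowX_ge_later[OF assms(2) s(1)] r2 by linarith
    have "\<bar>ce t (upval u s) \<omega> - ce s (upval u s) \<omega>\<bar> < e / 2"
      using nice_upval[OF stopping_time_const, of s] by (intro d1(2) s(1) s'(1) upval_bounded)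
    moreover have "ce s (upval u s) \<omega> = upval u s \<omega>" by (intro ce_eqI assms(2) upval_atom)
    ultimately show "upval u t \<omega> \<le> upval u s \<omega> + e" using upval_le_later[OF assms(2) s(1)] r1 by linarith
  qed (use d1 d2 in auto)
qed

text \<open>If the minimizer stops first, \<open>uppY\<close> dominates the value. Otherwise the
  maximizer receives \<open>lowX\<close> or the larger diagonal payoff, and at the hitting time both
  are at least the value minus \<eta>.\<close>

lemma maximizer_near:
  assumes \<omega>: "\<omega> \<in> space M" and "0 < \<eta>"
  shows "\<exists>\<rho>\<in>T (\<lambda>_. t). \<forall>\<tau>\<in>T (\<lambda>_. t). upval u t \<omega> - \<eta> \<le> ce t (stop_payoff u \<rho> \<tau>) \<omega>"
proof -
  \<comment> \<open>The condition \<open>t \<le> s\<close> puts the hitting time after t. The set is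
    never empty: at infinity \<open>lowX\<close>, \<open>upval\<close> and \<open>uppY\<close>
    coincide.\<close>
  define A where "A s x \<longleftrightarrow> t \<le> s \<and> upval u s x \<le> lowX u s x + \<eta>" for s x
  define \<rho> where "\<rho> x = Inf {s. A s x}" for x
  have \<rho>s: "stopping_time F \<rho>"
    unfolding \<rho>_def by (rule stopping_time_hitting) (simp add: A_def lowX_atom upval_atom)
  have t\<rho>: "t \<le> \<rho> x" for x unfolding \<rho>_def by (rule Inf_greatest) (simp add: A_def)
  then have \<rho>T: "\<rho> \<in> T (\<lambda>_. t)" using \<rho>s by (simp add: T_iff)
  have hit: "A (\<rho> x) x" if x: "x \<in> space M" for x
    unfolding \<rho>_def
  proof (rule Inf_attained[where P="\<lambda>s. A s x"])
    show "A \<infinity> x"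
      using upval_le_uppY[OF x, of \<infinity>] uppY_infinity[OF x] lowX_infinity[OF x] assms(2) by (simp add: A_def)
    let ?s = "Inf {s. A s x}"
    assume s: "?s < \<infinity>" "\<And>d::real. 0 < d \<Longrightarrow> \<exists>q. ?s \<le> q \<and> q \<le> ?s + ennreal d \<and> A q x"
    have "upval u ?s x \<le> lowX u ?s x + \<eta>"
    proof (rule field_le_epsilon)
      fix e :: real assume "0 < e"
      then have e: "0 < e / 2" by simp
      obtain d where d: "0 < d"
        "\<And>q. ?s \<le> q \<Longrightarrow> q \<le> ?s + ennreal d \<Longrightarrow> lowX u q x \<le> lowX u ?s x + e / 2"
        "\<And>q. ?s \<le> q \<Longrightarrow> q \<le> ?s + ennreal d \<Longrightarrow> upval u ?s x \<le> upval u q x + e / 2"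
        using right_estimates[OF s(1) x e] by blast
      obtain q where q: "?s \<le> q" "q \<le> ?s + ennreal d" "A q x" using s(2)[OF d(1)] by blast
      then have "upval u q x \<le> lowX u q x + \<eta>" by (simp add: A_def)
      then show "upval u ?s x \<le> lowX u ?s x + \<eta> + e"
        using d(2)[OF q(1,2)] d(3)[OF q(1,2)] by linarith
    qed
    then show "A ?s x" using t\<rho>[of x] unfolding A_def[of "Inf _"] \<rho>_def by blast
  qed
  show ?thesis
  proof (intro bexI[OF _ \<rho>T] ballI)
    fix \<tau> assume \<tau>: "\<tau> \<in> T (\<lambda>_. t)"
    define m where "m x = min (\<rho> x) (\<tau> x)" for x
    have m: "stopping_time F m" unfolding m_def by (rule stopping_time_min[OF \<rho>s T_stopping[OF \<tau>]])
    have "upval u t \<omega> \<le> ce t (\<lambda>x. upval u (m x) x) \<omega>"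
    proof (rule upval_submartingale[OF \<omega> m _ assms(2)])
      show "t \<le> m \<omega>" using \<rho>T \<tau> \<omega> by (simp add: m_def T_iff)
      fix s x assume *: "x \<in> atom t \<omega>" "t \<le> s" "s < m x"
      have "\<not> A s x"
      proof
        assume "A s x"
        then have "\<rho> x \<le> s" unfolding \<rho>_def by (intro Inf_lower) simp
        moreover have "s < \<rho> x" using *(3) by (simp add: m_def)
        ultimately show False by simp
      qed
      then show "lowX u s x + \<eta> \<le> upval u s x" using *(2) by (simp add: A_def)
    qed
    also have "\<dots> \<le> ce t (\<lambda>x. stop_payoff u \<rho> \<tau> x + \<eta>) \<omega>"
    proof (intro ce_mono nice_upval m nice_add nice_const nice_stop_payoff \<rho>s T_stopping[OF \<tau>] \<omega>)
      fix x assume "x \<in> atom t \<omega>"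
      then have x: "x \<in> space M" by (rule atom_space)
      show "upval u (m x) x \<le> stop_payoff u \<rho> \<tau> x + \<eta>"
        using hit[OF x] upval_le_uppY[OF x, of "\<tau> x"] lowX_le_diag[OF x, of "\<rho> x"] assms(2)
        by (auto simp: m_def A_def stop_payoff_def min_def not_le not_less)
    qed
    also have "\<dots> = ce t (stop_payoff u \<rho> \<tau>) \<omega> + \<eta>"
      by (intro ce_add_const nice_stop_payoff \<rho>s T_stopping[OF \<tau>] \<omega>)
    finally show "upval u t \<omega> - \<eta> \<le> ce t (stop_payoff u \<rho> \<tau>) \<omega>" by simp
  qed
qed

section \<open>Existence of the value and of saddle points\<close>

lemma upval_swap_le:
  assumes \<omega>: "\<omega> \<in> space M"
  shows "upval (swap u) t \<omega> \<le> - upval u t \<omega>"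
proof (rule field_le_epsilon)
  fix \<eta> :: real assume "0 < \<eta>"
  obtain \<rho> where \<rho>: "\<rho> \<in> T (\<lambda>_. t)"
    "\<And>\<tau>. \<tau> \<in> T (\<lambda>_. t) \<Longrightarrow> upval u t \<omega> - \<eta> \<le> ce t (stop_payoff u \<rho> \<tau>) \<omega>"
    using maximizer_near[OF \<omega> \<open>0 < \<eta>\<close>] by blast
  show "upval (swap u) t \<omega> \<le> - upval u t \<omega> + \<eta>"
  \<comment> \<open>In the swapped game the maximizer of \<open>u\<close> is the minimizer, so its
    near-optimal time \<rho> bounds the swapped upper value.\<close>
  proof (rule game_payoff.upval_le[OF game_payoff_swap \<omega> \<rho>(1)])
    fix \<tau> assume "\<tau> \<in> T (\<lambda>_. t)"
    moreover have "ce t (stop_payoff (swap u) \<tau> \<rho>) \<omega> = - ce t (stop_payoff u \<rho> \<tau>) \<omega>"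
      by (simp add: stop_payoff_swap[abs_def] ce_uminus[symmetric])
    ultimately show "ce t (stop_payoff (swap u) \<tau> \<rho>) \<omega> \<le> - upval u t \<omega> + \<eta>"
      using \<rho>(2)[of \<tau>] by simp
  qed
qed

text \<open>The inequality still missing is the weak one: near-optimal minimizing times of the two
  games are played against each other. As \<open>- upval (swap u)\<close> is the lower value, this
  says that the game has a value.\<close>

lemma upval_swap:
  assumes \<omega>: "\<omega> \<in> space M"
  shows "upval (swap u) t \<omega> = - upval u t \<omega>"
proof (rule antisym[OF upval_swap_le[OF \<omega>]])
  have "- upval (swap u) t \<omega> \<le> upval u t \<omega>"
  proof (rule field_le_epsilon)
    fix \<eta> :: real assume "0 < \<eta>"
    then have "0 < \<eta> / 2" by simp
    obtain \<tau> where \<tau>: "\<tau> \<in> T (\<lambda>_. t)"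
      "\<And>\<rho>. \<rho> \<in> T (\<lambda>_. t) \<Longrightarrow> ce t (stop_payoff u \<rho> \<tau>) \<omega> \<le> upval u t \<omega> + \<eta> / 2"
      using upval_near[OF \<omega> \<open>0 < \<eta> / 2\<close>] by blast
    obtain \<rho> where \<rho>: "\<rho> \<in> T (\<lambda>_. t)"
      "\<And>\<tau>. \<tau> \<in> T (\<lambda>_. t) \<Longrightarrow> ce t (stop_payoff (swap u) \<tau> \<rho>) \<omega> \<le> upval (swap u) t \<omega> + \<eta> / 2"
      using game_payoff.upval_near[OF game_payoff_swap \<omega> \<open>0 < \<eta> / 2\<close>] by blast
    have "ce t (stop_payoff (swap u) \<tau> \<rho>) \<omega> = - ce t (stop_payoff u \<rho> \<tau>) \<omega>"
      by (simp add: stop_payoff_swap[abs_def] ce_uminus[symmetric])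
    then show "- upval (swap u) t \<omega> \<le> upval u t \<omega> + \<eta>"
      using \<tau>(2)[OF \<rho>(1)] \<rho>(2)[OF \<tau>(1)] by simp
  qed
  then show "- upval u t \<omega> \<le> upval (swap u) t \<omega>" by simp
qed

text \<open>A lower estimate for the swapped value is an upper estimate for the value.\<close>

lemma upval_right_upper:
  assumes "t < \<infinity>" "\<omega> \<in> space M" "0 < e"
  obtains d :: real where "0 < d"
    "\<And>s. t \<le> s \<Longrightarrow> s \<le> t + ennreal d \<Longrightarrow> upval u s \<omega> \<le> upval u t \<omega> + e"
proof -
  obtain d where "0 < d" "\<And>s. t \<le> s \<Longrightarrow> s \<le> t + ennreal d \<Longrightarrow> upval (swap u) t \<omega> \<le> upval (swap u) s \<omega> + e"
    using game_payoff.right_estimates[OF game_payoff_swap assms] by blast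
  then show ?thesis by (intro that[of d]) (simp, fastforce simp: upval_swap[OF assms(2)] algebra_simps)
qed

lemma maximizer_near_stopping:
  assumes "stopping_time F \<sigma>" "0 < \<eta>"
  shows "\<exists>\<rho>\<in>T \<sigma>. \<forall>\<omega>\<in>space M. \<forall>\<tau>. stopping_time F \<tau> \<longrightarrow> (\<forall>x\<in>atom (\<sigma> \<omega>) \<omega>. \<sigma> \<omega> \<le> \<tau> x) \<longrightarrow>
    upval u (\<sigma> \<omega>) \<omega> - \<eta> \<le> ce (\<sigma> \<omega>) (stop_payoff u \<rho> \<tau>) \<omega>"
proof -
  have eq: "ce t (stop_payoff (swap u) \<tau> \<rho>) \<omega> = - ce t (stop_payoff u \<rho> \<tau>) \<omega>" for t \<omega> \<rho> \<tau>
    by (simp add: stop_payoff_swap[abs_def] ce_uminus[symmetric])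
  have iff: "- a \<le> - b + \<eta> \<longleftrightarrow> b - \<eta> \<le> a" for a b :: real by linarith
  show ?thesis
    using game_payoff.upval_near_stopping[OF game_payoff_swap assms]
    by (simp only: eq upval_swap iff cong: ball_cong)
qed

text \<open>Against \<open>q\<close> the time \<open>a\<close> gains less than \<epsilon> over
  \<open>p\<close>, and replacing \<open>q\<close> by a near-optimal minimizing time
  \<open>b\<close> lowers the payoff of \<open>p\<close> by less than another \<epsilon>. Against
  \<open>b\<close> the payoff exceeds the value by at most \<eta>.\<close>

lemma saddle_bound:
  assumes \<sigma>: "stopping_time F \<sigma>" and pq: "saddle u \<epsilon> \<sigma> p q" and a: "a \<in> T \<sigma>" and \<omega>: "\<omega> \<in> space M"
  shows "ce (\<sigma> \<omega>) (stop_payoff u a q) \<omega> \<le> upval u (\<sigma> \<omega>) \<omega> + 2 * \<epsilon>"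
proof (rule field_le_epsilon)
  fix \<eta> :: real assume "0 < \<eta>"
  then obtain b where b: "b \<in> T \<sigma>" "\<And>\<rho>. stopping_time F \<rho> \<Longrightarrow> (\<forall>x\<in>atom (\<sigma> \<omega>) \<omega>. \<sigma> \<omega> \<le> \<rho> x) \<Longrightarrow>
      ce (\<sigma> \<omega>) (stop_payoff u \<rho> b) \<omega> \<le> upval u (\<sigma> \<omega>) \<omega> + \<eta>"
    using upval_near_stopping[OF \<sigma>] \<omega> by blast
  have p: "p \<in> T \<sigma>" using pq by (simp add: saddle_def)
  have "ce (\<sigma> \<omega>) (stop_payoff u p b) \<omega> \<le> upval u (\<sigma> \<omega>) \<omega> + \<eta>"
    by (intro b(2) T_stopping[OF p] T_atom_ge[OF \<sigma> p \<omega>])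
  moreover have "ce (\<sigma> \<omega>) (stop_payoff u a q) \<omega> - \<epsilon> < ce (\<sigma> \<omega>) (stop_payoff u p q) \<omega>"
    "ce (\<sigma> \<omega>) (stop_payoff u p q) \<omega> < ce (\<sigma> \<omega>) (stop_payoff u p b) \<omega> + \<epsilon>"
    using pq a b(1) \<omega> unfolding saddle_def by blast+
  ultimately show "ce (\<sigma> \<omega>) (stop_payoff u a q) \<omega> \<le> upval u (\<sigma> \<omega>) \<omega> + 2 * \<epsilon> + \<eta>" by linarith
qed

lemma saddle_exists:
  assumes \<sigma>: "stopping_time F \<sigma>" and "0 < \<epsilon>"
  shows "\<exists>p q. saddle u \<epsilon> \<sigma> p q"
proof -
  \<comment> \<open>The errors of both players add up to 2\<eta>, and the saddle point inequalities
    are strict, so half of \<epsilon> would not do.\<close>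
  define \<eta> where "\<eta> = \<epsilon> / 3"
  have \<eta>: "0 < \<eta>" using assms(2) by (simp add: \<eta>_def)
  note at = T_atom_ge[OF \<sigma>]
  obtain q where q: "q \<in> T \<sigma>" "\<And>\<omega> \<rho>. \<omega> \<in> space M \<Longrightarrow> \<rho> \<in> T \<sigma> \<Longrightarrow>
      ce (\<sigma> \<omega>) (stop_payoff u \<rho> q) \<omega> \<le> upval u (\<sigma> \<omega>) \<omega> + \<eta>"
    using upval_near_stopping[OF \<sigma> \<eta>] at T_stopping by blast
  obtain p where p: "p \<in> T \<sigma>" "\<And>\<omega> \<tau>. \<omega> \<in> space M \<Longrightarrow> \<tau> \<in> T \<sigma> \<Longrightarrow>
      upval u (\<sigma> \<omega>) \<omega> - \<eta> \<le> ce (\<sigma> \<omega>) (stop_payoff u p \<tau>) \<omega>"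
    using maximizer_near_stopping[OF \<sigma> \<eta>] at T_stopping by blast
  have "2 * \<eta> < \<epsilon>" using assms(2) by (simp add: \<eta>_def)
  then have "saddle u \<epsilon> \<sigma> p q"
    unfolding saddle_def using p(2)[OF _ q(1)] q(2)[OF _ p(1)] p q by (smt (verit))
  then show ?thesis by blast
qed

end

section \<open>Unilateral deviations\<close>

context countable_filtered_space
begin

definition react_value ::
  "(ennreal \<Rightarrow> ennreal \<Rightarrow> 'a \<Rightarrow> real) \<Rightarrow> (ennreal \<Rightarrow> 'a stime) \<Rightarrow> ennreal \<Rightarrow> 'a \<Rightarrow> real" where
  "react_value u \<kappa> t \<omega> = ce t (\<lambda>x. u t (\<kappa> t x) x) \<omega>"

text \<open>This is \<open>mu\<close> once \<open>upval\<close> and \<open>react_value\<close> are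
  identified with the Dynkin value and \<open>W_proc\<close>; see \<open>\<mu>1_eq\<close> and
  \<open>\<mu>2_eq\<close>.\<close>

definition stop_now ::
  "(ennreal \<Rightarrow> ennreal \<Rightarrow> 'a \<Rightarrow> real) \<Rightarrow> real \<Rightarrow> (ennreal \<Rightarrow> 'a stime) \<Rightarrow> 'a stime" where
  "stop_now u \<epsilon> \<kappa> \<omega> = Inf {t. upval u t \<omega> \<le> react_value u \<kappa> t \<omega> + \<epsilon>}"

end

context game_payoff
begin

lemma stop_now_stopping: "stopping_time F (stop_now u \<epsilon> \<kappa>)"
proof -
  have "stopping_time F (\<lambda>\<omega>. Inf {t. upval u t \<omega> \<le> react_value u \<kappa> t \<omega> + \<epsilon>})"
    by (rule stopping_time_hitting) (simp add: react_value_def ce_atom[of _ _ _ "\<lambda>x. u _ (\<kappa> _ x) x"] upval_atom)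
  then show ?thesis by (simp add: stop_now_def[abs_def])
qed

end

text \<open>
  The maximizer of \<open>u\<close> is the player who may deviate: \<open>\<kappa>\<close> is the opponent's selfish and \<open>\<kappa>'\<close> the
  opponent's punishing reaction, \<open>\<rho>1\<close> the own reaction, \<open>m2\<close> the time at which the opponent wants to
  stop, and \<open>E\<close> the event that the maximizer stops first.
\<close>

locale stopping_candidate = game_payoff M F u r C
  for M :: "'a measure" and F u r C +
  fixes \<epsilon> :: real and \<kappa> \<kappa>' \<rho>1 :: "ennreal \<Rightarrow> 'a stime" and m2 :: "'a stime" and E :: "'a \<Rightarrow> bool"
  assumes \<epsilon>_pos: "0 < \<epsilon>"
    and \<kappa>_T: "\<kappa> t \<in> T (\<lambda>_. t)"
    and \<kappa>_step: "t < \<infinity> \<Longrightarrow> \<exists>d::real>0. \<forall>s. t \<le> s \<and> s \<le> t + ennreal d \<longrightarrow> \<kappa> s = \<kappa> t"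
    and \<kappa>'_T: "\<kappa>' t \<in> T (\<lambda>_. t)"
    and \<kappa>'_near: "\<omega> \<in> space M \<Longrightarrow> ce t (\<lambda>x. u t (\<kappa>' t x) x) \<omega> \<le> lowX u t \<omega> + 2 * \<epsilon>"
    and \<rho>1_T: "\<rho>1 t \<in> T (\<lambda>_. t)"
    and \<rho>1_near: "\<omega> \<in> space M \<Longrightarrow> uppY u t \<omega> - 2 * \<epsilon> \<le> ce t (\<lambda>x. u (\<rho>1 t x) t x) \<omega>"
    and m2: "stopping_time F m2"
    and E_atom: "\<omega> \<in> space M \<Longrightarrow> \<omega>' \<in> atom (min (stop_now u \<epsilon> \<kappa> \<omega>) (m2 \<omega>)) \<omega> \<Longrightarrow> E \<omega>' = E \<omega>"
    and E_le: "\<omega> \<in> space M \<Longrightarrow> E \<omega> \<Longrightarrow> stop_now u \<epsilon> \<kappa> \<omega> \<le> m2 \<omega>"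
    and not_E_le: "\<omega> \<in> space M \<Longrightarrow> \<not> E \<omega> \<Longrightarrow> m2 \<omega> \<le> stop_now u \<epsilon> \<kappa> \<omega>"
begin

section \<open>The prescribed stop, its payoff, and deviations before it\<close>

abbreviation W :: "ennreal \<Rightarrow> 'a \<Rightarrow> real" where "W \<equiv> react_value u \<kappa>"

abbreviation m1 :: "'a stime" where "m1 \<equiv> stop_now u \<epsilon> \<kappa>"

definition m :: "'a stime" where "m \<omega> = min (m1 \<omega>) (m2 \<omega>)"

lemma W_atom: "\<omega> \<in> space M \<Longrightarrow> \<omega>' \<in> atom t \<omega> \<Longrightarrow> W t \<omega>' = W t \<omega>"
  unfolding react_value_def by (rule ce_atom)

lemma W_bounded: "\<omega> \<in> space M \<Longrightarrow> \<bar>W t \<omega>\<bar> \<le> C"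
  unfolding react_value_def by (rule lowX_abs[OF _ \<kappa>_T])

lemma lowX_le_W: "\<omega> \<in> space M \<Longrightarrow> lowX u t \<omega> \<le> W t \<omega>"
  unfolding react_value_def by (rule lowX_le[OF _ \<kappa>_T])

text \<open>Just after t the reaction stays the same by \<open>\<kappa>_step\<close>. Only the first
  argument of \<open>u\<close> and the conditioning move, and they are controlled by the modulus and
  by \<open>ce_right_close\<close>.\<close>

lemma W_right_continuous:
  assumes "t < \<infinity>" "\<omega> \<in> space M" "0 < e"
  obtains d :: real where "0 < d"
    "\<And>s. t \<le> s \<Longrightarrow> s \<le> t + ennreal d \<Longrightarrow> \<bar>W s \<omega> - W t \<omega>\<bar> \<le> e"
proof -
  obtain d1 where d1: "0 < d1" "\<And>s f. t \<le> s \<Longrightarrow> s \<le> t + ennreal d1 \<Longrightarrow> nice f \<Longrightarrow>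
      (\<And>x. x \<in> space M \<Longrightarrow> \<bar>f x\<bar> \<le> C) \<Longrightarrow> \<bar>ce t f \<omega> - ce s f \<omega>\<bar> < e / 2"
    using ce_right_close[OF assms(1,2), of "e/2" C] C_nonneg[OF assms(2)] assms(3) by auto
  obtain d2 where d2: "0 < d2" "\<And>x. x \<le> ennreal d2 \<Longrightarrow> r x < e / 2"
    using r_small[of "e/2"] assms(3) by auto
  obtain d3 :: real where d3: "0 < d3" "\<And>s. t \<le> s \<Longrightarrow> s \<le> t + ennreal d3 \<Longrightarrow> \<kappa> s = \<kappa> t"
    using \<kappa>_step[OF assms(1)] by blast
  note st = T_stopping[OF \<kappa>_T]
  show ?thesis
  proof (rule that[of "min d1 (min d2 d3)"])
    fix s assume s: "t \<le> s" "s \<le> t + ennreal (min d1 (min d2 d3))"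
    have s': "s \<le> t + ennreal d1" "s \<le> t + ennreal d2" "s \<le> t + ennreal d3"
      using s(2) by (auto elim!: order_trans intro!: add_left_mono ennreal_leI)
    let ?f = "\<lambda>x. u t (\<kappa> t x) x" and ?g = "\<lambda>x. u s (\<kappa> t x) x"
    have rs: "r (time_dist s t) < e / 2"
      using s(1) s'(2) assms(1) by (subst time_dist_commute) (intro d2(2) time_dist_add)
    have "\<bar>?g x - ?f x\<bar> \<le> e / 2" if "x \<in> space M" for x
      using u_modulus[OF that, of s "\<kappa> t x" t "\<kappa> t x"] rs by simp
    then have "\<bar>ce s (\<lambda>x. ?g x - ?f x) \<omega>\<bar> \<le> e / 2"
      by (intro ce_abs_le nice_diff nice_u1 st assms(2))
    then have "\<bar>ce s ?g \<omega> - ce s ?f \<omega>\<bar> \<le> e / 2"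
      by (simp add: ce_diff nice_u1 st)
    moreover have "\<bar>ce t ?f \<omega> - ce s ?f \<omega>\<bar> < e / 2"
      by (intro d1(2) s(1) s'(1) nice_u1 st u_bounded)
    moreover have "W s \<omega> = ce s ?g \<omega>" by (simp add: react_value_def d3(2)[OF s(1) s'(3)])
    moreover have "W t \<omega> = ce t ?f \<omega>" by (simp add: react_value_def)
    ultimately show "\<bar>W s \<omega> - W t \<omega>\<bar> \<le> e" by linarith
  qed (use d1 d2 d3 in auto)
qed

lemma m1_stopping: "stopping_time F m1"
  by (rule stop_now_stopping)

lemma m_stopping: "stopping_time F m"
  unfolding m_def[abs_def] by (rule stopping_time_min[OF m1_stopping m2])

lemma before_m1: "s < m1 \<omega> \<Longrightarrow> W s \<omega> + \<epsilon> < upval u s \<omega>"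
  unfolding stop_now_def by (meson Inf_lower mem_Collect_eq not_le)

text \<open>The inequality passes to the infimum because \<open>W\<close> is right continuous and
  \<open>upval\<close> at the infimum exceeds its values just afterwards by little. At infinity it
  holds since there \<open>upval \<le> uppY = lowX \<le> W\<close>.\<close>

lemma at_m1:
  assumes \<omega>: "\<omega> \<in> space M"
  shows "upval u (m1 \<omega>) \<omega> \<le> W (m1 \<omega>) \<omega> + \<epsilon>"
  unfolding stop_now_def
proof (rule Inf_attained[where P="\<lambda>t. upval u t \<omega> \<le> W t \<omega> + \<epsilon>"])
  show "upval u \<infinity> \<omega> \<le> W \<infinity> \<omega> + \<epsilon>"
    using upval_le_uppY[OF \<omega>, of \<infinity>] uppY_infinity[OF \<omega>] lowX_infinity[OF \<omega>] lowX_le_W[OF \<omega>, of \<infinity>] \<epsilon>_pos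
    by simp
  let ?s = "Inf {t. upval u t \<omega> \<le> W t \<omega> + \<epsilon>}"
  assume s: "?s < \<infinity>"
    "\<And>d::real. 0 < d \<Longrightarrow> \<exists>q. ?s \<le> q \<and> q \<le> ?s + ennreal d \<and> upval u q \<omega> \<le> W q \<omega> + \<epsilon>"
  show "upval u ?s \<omega> \<le> W ?s \<omega> + \<epsilon>"
  proof (rule field_le_epsilon)
    fix e :: real assume "0 < e"
    then have e: "0 < e / 2" by simp
    obtain d1 where d1: "0 < d1"
      "\<And>q. ?s \<le> q \<Longrightarrow> q \<le> ?s + ennreal d1 \<Longrightarrow> \<bar>W q \<omega> - W ?s \<omega>\<bar> \<le> e / 2"
      using W_right_continuous[OF s(1) \<omega> e] by blast
    obtain d2 where d2: "0 < d2"
      "\<And>q. ?s \<le> q \<Longrightarrow> q \<le> ?s + ennreal d2 \<Longrightarrow> upval u ?s \<omega> \<le> upval u q \<omega> + e / 2"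
      using right_estimates[OF s(1) \<omega> e] by blast
    obtain q where q: "?s \<le> q" "q \<le> ?s + ennreal (min d1 d2)" "upval u q \<omega> \<le> W q \<omega> + \<epsilon>"
      using s(2)[of "min d1 d2"] d1 d2 by auto
    have "q \<le> ?s + ennreal d1" "q \<le> ?s + ennreal d2"
      using q(2) by (auto elim!: order_trans intro!: add_left_mono ennreal_leI)
    then show "upval u ?s \<omega> \<le> W ?s \<omega> + \<epsilon> + e"
      using d1(2)[OF q(1)] d2(2)[OF q(1)] q(3) by linarith
  qed
qed

lemma m_cases:
  assumes "\<omega> \<in> space M"
  shows "E \<omega> \<Longrightarrow> m \<omega> = m1 \<omega>" "\<not> E \<omega> \<Longrightarrow> m \<omega> = m2 \<omega>"
  using E_le[OF assms] not_E_le[OF assms] by (simp_all add: m_def min_absorb1 min_absorb2)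

lemma E_atom_late: "\<omega> \<in> space M \<Longrightarrow> m \<omega> \<le> t \<Longrightarrow> \<omega>' \<in> atom t \<omega> \<Longrightarrow> E \<omega>' = E \<omega>"
  using E_atom atom_antimono unfolding m_def by blast

text \<open>The maximizer's payoff at the times realized by the candidate pair;
  \<open>equilibrium_payoff1\<close> and \<open>equilibrium_payoff2\<close> identify its integral
  with \<open>expected_payoff\<close>.\<close>

definition eq :: "'a \<Rightarrow> real" where
  "eq \<omega> = (if E \<omega> then u (m1 \<omega>) (\<kappa> (m1 \<omega>) \<omega>) \<omega> else u (\<rho>1 (m2 \<omega>) \<omega>) (m2 \<omega>) \<omega>)"

lemma u_top: "\<omega> \<in> space M \<Longrightarrow> \<omega>' \<in> atom \<infinity> \<omega> \<Longrightarrow> u s t \<omega>' = u s t \<omega>"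
  using u_adapted atom_antimono[of "max s t" \<infinity> \<omega>] by auto

lemma E_top: "\<omega> \<in> space M \<Longrightarrow> \<omega>' \<in> atom \<infinity> \<omega> \<Longrightarrow> E \<omega>' = E \<omega>"
  by (rule E_atom_late[of \<omega> \<infinity>]) auto

lemma nice_eq: "nice eq"
proof (rule niceI)
  fix \<omega> \<omega>' assume *: "\<omega> \<in> space M" "\<omega>' \<in> atom \<infinity> \<omega>"
  have "\<kappa> t \<omega>' = \<kappa> t \<omega>" "\<rho>1 t \<omega>' = \<rho>1 t \<omega>" "m1 \<omega>' = m1 \<omega>" "m2 \<omega>' = m2 \<omega>" for t
    by (rule stopping_time_atom_infinity[OF _ *], rule T_stopping[OF \<kappa>_T] T_stopping[OF \<rho>1_T] m1_stopping m2)+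
  then show "eq \<omega>' = eq \<omega>" by (simp add: eq_def E_top[OF *] u_top[OF *])
next
  fix \<omega> assume "\<omega> \<in> space M"
  then show "\<bar>eq \<omega>\<bar> \<le> C" by (simp add: eq_def u_bounded)
qed

lemma ce_eq_E:
  assumes \<omega>: "\<omega> \<in> space M" and "E \<omega>"
  shows "ce (m \<omega>) eq \<omega> = W (m1 \<omega>) \<omega>"
  unfolding react_value_def m_cases(1)[OF assms]
proof (rule ce_cong)
  fix x assume x: "x \<in> atom (m1 \<omega>) \<omega>"
  then show "eq x = u (m1 \<omega>) (\<kappa> (m1 \<omega>) x) x"
    using E_atom_late[OF \<omega> _ x] assms stopping_time_atom[OF m1_stopping \<omega> x] by (simp add: eq_def m_def)
qed

lemma ce_eq_not_E:
  assumes \<omega>: "\<omega> \<in> space M" and "\<not> E \<omega>"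
  shows "uppY u (m2 \<omega>) \<omega> \<le> ce (m \<omega>) eq \<omega> + 2 * \<epsilon>"
proof -
  have "ce (m \<omega>) eq \<omega> = ce (m2 \<omega>) (\<lambda>x. u (\<rho>1 (m2 \<omega>) x) (m2 \<omega>) x) \<omega>"
    unfolding m_cases(2)[OF assms]
  proof (rule ce_cong)
    fix x assume x: "x \<in> atom (m2 \<omega>) \<omega>"
    then show "eq x = u (\<rho>1 (m2 \<omega>) x) (m2 \<omega>) x"
      using E_atom_late[OF \<omega> _ x] assms stopping_time_atom[OF m2 \<omega> x] by (simp add: eq_def m_def)
  qed
  then show ?thesis using \<rho>1_near[OF \<omega>, of "m2 \<omega>"] by simp
qed

text \<open>On \<open>E\<close> the loss is \<epsilon>, by the definition of \<open>m1\<close>; off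
  \<open>E\<close> it is 2\<epsilon>, the error of the reaction \<open>\<rho>1\<close> measured
  against \<open>uppY\<close>.\<close>

lemma upval_m_le:
  assumes \<omega>: "\<omega> \<in> space M"
  shows "upval u (m \<omega>) \<omega> \<le> ce (m \<omega>) eq \<omega> + 2 * \<epsilon>"
proof (cases "E \<omega>")
  case True
  then show ?thesis using ce_eq_E[OF \<omega>] at_m1[OF \<omega>] \<epsilon>_pos m_cases(1)[OF \<omega>] by simp
next
  case False
  then show ?thesis using ce_eq_not_E[OF \<omega>] upval_le_uppY[OF \<omega>] m_cases(2)[OF \<omega>]
    by (metis order_trans)
qed

text \<open>The margin \<epsilon> that holds before \<open>m1\<close> is set against the 2\<epsilon>
  lost at \<open>m\<close>, which leaves \<epsilon>. The submartingale property applies because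
  \<open>lowX\<close> lies below \<open>W\<close>.\<close>

lemma early_stop_le:
  assumes \<omega>: "\<omega> \<in> space M" and t: "t < m \<omega>"
  shows "W t \<omega> \<le> ce t eq \<omega> + \<epsilon>"
proof -
  have "W t \<omega> + \<epsilon> \<le> upval u t \<omega>" using before_m1[of t \<omega>] t by (simp add: m_def)
  also have "\<dots> \<le> ce t (\<lambda>x. upval u (m x) x) \<omega>"
  proof (rule upval_submartingale[OF \<omega> m_stopping less_imp_le[OF t] \<epsilon>_pos])
    fix s x assume "x \<in> atom t \<omega>" "s < m x"
    then show "lowX u s x + \<epsilon> \<le> upval u s x"
      using before_m1[of s x] lowX_le_W[of x s] atom_space by (fastforce simp: m_def)
  qed
  also have "\<dots> \<le> ce t (\<lambda>x. ce (m x) eq x + 2 * \<epsilon>) \<omega>"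
    by (intro ce_mono nice_upval m_stopping nice_add nice_ce nice_eq nice_const \<omega> upval_m_le atom_space)
  also have "\<dots> = ce t eq \<omega> + 2 * \<epsilon>"
    using t by (simp add: ce_add_const nice_ce m_stopping nice_eq \<omega> ce_tower)
  finally show ?thesis by simp
qed

section \<open>Uniformity of right continuity outside a small event\<close>

definition bad :: "real \<Rightarrow> 'a set" where
  "bad d = {\<omega>\<in>space M. \<exists>s. m1 \<omega> \<le> s \<and> s \<le> m1 \<omega> + ennreal d \<and>
     (\<epsilon> < \<bar>W s \<omega> - W (m1 \<omega>) \<omega>\<bar> \<or> upval u (m1 \<omega>) \<omega> + \<epsilon> < upval u s \<omega>)}"

text \<open>The quantifier over uncountably many times does no harm: all ingredients are constant on
  the atoms at infinity.\<close>

lemma bad_in_M: "bad d \<in> sets M"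
  unfolding sets_M_iff
proof (intro conjI ballI subsetI)
  fix \<omega> \<omega>' assume *: "\<omega> \<in> bad d" "\<omega>' \<in> atom \<infinity> \<omega>"
  then have \<omega>: "\<omega> \<in> space M" by (simp add: bad_def)
  have at: "\<omega>' \<in> atom s \<omega>" for s using *(2) atom_antimono[of s \<infinity>] by auto
  show "\<omega>' \<in> bad d"
    using *(1) atom_space[OF *(2)]
    by (simp add: bad_def W_atom[OF \<omega> at] upval_atom[OF \<omega> at] stopping_time_atom_infinity[OF m1_stopping \<omega> *(2)])
qed (auto simp: bad_def)

lemma bad_mono: "c \<le> d \<Longrightarrow> bad c \<subseteq> bad d"
proof
  fix \<omega> assume "c \<le> d" "\<omega> \<in> bad c"
  moreover from \<open>c \<le> d\<close> have "m1 \<omega> + ennreal c \<le> m1 \<omega> + ennreal d" by (intro add_left_mono ennreal_leI)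
  ultimately show "\<omega> \<in> bad d" unfolding bad_def by (blast intro: order_trans)
qed

text \<open>Right continuity holds along every path, though without a common rate. The events
  therefore shrink to the empty set with \<open>d\<close>, and their probabilities tend to
  0.\<close>

lemma bad_small:
  assumes "0 < e"
  obtains d :: real where "0 < d" "prob (bad d) < e"
proof -
  let ?B = "\<lambda>n. bad (1 / real (Suc n))"
  have "decseq ?B" by (intro decseq_SucI bad_mono) (simp add: field_simps)
  moreover have "(\<Inter>n. ?B n) = {}"
  proof (rule ccontr)
    assume "(\<Inter>n. ?B n) \<noteq> {}"
    then obtain \<omega> where *: "\<And>n. \<omega> \<in> ?B n" by blast
    then have \<omega>: "\<omega> \<in> space M" by (simp add: bad_def)
    \<comment> \<open>At an infinite \<open>m1 \<omega>\<close> the interval after it is a single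
      point, and neither inequality in \<open>bad\<close> holds there.\<close>
    have fin: "m1 \<omega> < \<infinity>"
    proof (rule ccontr)
      assume "\<not> m1 \<omega> < \<infinity>"
      then have "m1 \<omega> = top" using top.not_eq_extremum unfolding infinity_ennreal_def by blast
      then show False using *[of 0] \<epsilon>_pos by (auto simp: bad_def top_unique)
    qed
    obtain d1 where d1: "0 < d1"
      "\<And>q. m1 \<omega> \<le> q \<Longrightarrow> q \<le> m1 \<omega> + ennreal d1 \<Longrightarrow> \<bar>W q \<omega> - W (m1 \<omega>) \<omega>\<bar> \<le> \<epsilon>"
      using W_right_continuous[OF fin \<omega> \<epsilon>_pos] by blast
    obtain d2 where d2: "0 < d2"
      "\<And>q. m1 \<omega> \<le> q \<Longrightarrow> q \<le> m1 \<omega> + ennreal d2 \<Longrightarrow> upval u q \<omega> \<le> upval u (m1 \<omega>) \<omega> + \<epsilon>"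
      using upval_right_upper[OF fin \<omega> \<epsilon>_pos] by blast
    obtain n where "1 / real (Suc n) < min d1 d2" using nat_approx_posE[of "min d1 d2"] d1 d2 by auto
    then have "\<omega> \<in> bad (min d1 d2)" using *[of n] bad_mono[of "1 / real (Suc n)" "min d1 d2"] by auto
    then obtain s where s: "m1 \<omega> \<le> s" "s \<le> m1 \<omega> + ennreal (min d1 d2)"
      "\<epsilon> < \<bar>W s \<omega> - W (m1 \<omega>) \<omega>\<bar> \<or> upval u (m1 \<omega>) \<omega> + \<epsilon> < upval u s \<omega>"
      by (auto simp: bad_def)
    have "s \<le> m1 \<omega> + ennreal d1" "s \<le> m1 \<omega> + ennreal d2"
      using s(2) by (auto elim!: order_trans intro!: add_left_mono ennreal_leI)
    then show False using d1(2)[OF s(1)] d2(2)[OF s(1)] s(3) by linarith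
  qed
  ultimately have "(\<lambda>n. prob (?B n)) \<longlonglongrightarrow> prob {}"
    using finite_Lim_measure_decseq[of ?B] bad_in_M by auto
  then have "(\<lambda>n. prob (?B n)) \<longlonglongrightarrow> 0" by simp
  then have "eventually (\<lambda>n. prob (?B n) < e) sequentially" using assms by (rule order_tendstoD)
  then obtain n where "prob (?B n) < e" by (auto simp: eventually_sequentially)
  then show ?thesis by (intro that[of "1 / real (Suc n)"]) auto
qed

text \<open>The payoff of a maximizer with initial time \<open>a\<close> and reaction \<beta>
  against the opponent's candidate strategy, whose initial time is \<open>st\<close> on
  \<open>E\<close> and \<open>m2\<close> off \<open>E\<close>. A tie is a case of its own, since
  both then stop at their initial times.\<close>

definition dev :: "real \<Rightarrow> 'a stime \<Rightarrow> 'a stime \<Rightarrow> (ennreal \<Rightarrow> 'a stime) \<Rightarrow> 'a \<Rightarrow> real" where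
  "dev \<delta> st a \<beta> \<omega> = (let \<tau>0 = if E \<omega> then st \<omega> else m2 \<omega> in
     if a \<omega> < \<tau>0 then u (a \<omega>) (if m \<omega> + ennreal \<delta> \<le> a \<omega> \<and> E \<omega> then \<kappa>' (a \<omega>) \<omega> else \<kappa> (a \<omega>) \<omega>) \<omega>
     else if \<tau>0 < a \<omega> then u (\<beta> \<tau>0 \<omega>) \<tau>0 \<omega> else u (a \<omega>) (a \<omega>) \<omega>)"

lemma m1_plus_stopping: "stopping_time F (\<lambda>\<omega>. m1 \<omega> + ennreal \<delta>)"
  unfolding stopping_time_iff
proof (intro ballI)
  fix \<omega> \<omega>' assume "\<omega> \<in> space M" "\<omega>' \<in> atom (m1 \<omega> + ennreal \<delta>) \<omega>"
  then have "m1 \<omega>' = m1 \<omega>" by (intro stopping_time_atom_late[OF m1_stopping]) auto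
  then show "m1 \<omega>' + ennreal \<delta> = m1 \<omega> + ennreal \<delta>" by simp
qed

section \<open>Comparison of a deviation with the prescribed payoff\<close>

context
  fixes \<delta> :: real and p st a :: "'a stime" and \<beta> :: "ennreal \<Rightarrow> 'a stime"
  assumes saddle: "saddle u \<epsilon> (\<lambda>\<omega>. m1 \<omega> + ennreal \<delta>) p st"
    and a: "stopping_time F a"
    and \<beta>: "\<And>t. t < \<infinity> \<Longrightarrow> \<beta> t \<in> T (\<lambda>_. t)"
begin

abbreviation D :: "'a \<Rightarrow> real" where "D \<equiv> dev \<delta> st a \<beta>"

lemma st_stopping: "stopping_time F st"
  using saddle by (auto simp: saddle_def T_iff)

lemma st_ge: "\<omega> \<in> space M \<Longrightarrow> m1 \<omega> + ennreal \<delta> \<le> st \<omega>"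
  using saddle by (simp add: saddle_def T_iff)

lemma nice_dev: "nice D"
proof (rule niceI)
  fix \<omega> \<omega>' assume *: "\<omega> \<in> space M" "\<omega>' \<in> atom \<infinity> \<omega>"
  have 1: "\<kappa> t \<omega>' = \<kappa> t \<omega>" "\<kappa>' t \<omega>' = \<kappa>' t \<omega>" "m \<omega>' = m \<omega>" "m2 \<omega>' = m2 \<omega>" "st \<omega>' = st \<omega>" "a \<omega>' = a \<omega>" for t
    by (rule stopping_time_atom_infinity[OF _ *],
        rule T_stopping[OF \<kappa>_T] T_stopping[OF \<kappa>'_T] m_stopping m2 st_stopping a)+
  \<comment> \<open>Nothing is assumed about \<beta> at infinity, but \<open>dev\<close> consults it
    only at a time strictly before \<open>a\<close>, which is finite.\<close>
  have 2: "\<beta> t \<omega>' = \<beta> t \<omega>" if "t < s" for s t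
    by (rule stopping_time_atom_infinity[OF T_stopping[OF \<beta>] *]) (use that in \<open>auto intro: order_less_le_trans\<close>)
  show "D \<omega>' = D \<omega>"
    unfolding dev_def Let_def 1 E_top[OF *] u_top[OF *] using 2 by auto
next
  fix \<omega> assume "\<omega> \<in> space M"
  then show "\<bar>D \<omega>\<bar> \<le> C" by (simp add: dev_def Let_def u_bounded)
qed

text \<open>The time that separates the two regimes: a stop before it meets the selfish reaction;
  from it on the deviator is confined to the Dynkin game on \<open>E\<close>, and faces the stop at
  \<open>m2\<close> off \<open>E\<close>.\<close>

definition c :: "'a stime" where "c \<omega> = (if E \<omega> then m1 \<omega> + ennreal \<delta> else m2 \<omega>)"

lemma m_le_c: "\<omega> \<in> space M \<Longrightarrow> m \<omega> \<le> c \<omega>"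
  using m_cases by (auto simp: c_def)

lemma c_stopping: "stopping_time F c"
  unfolding c_def[abs_def]
  by (rule stopping_time_if[OF m_stopping m1_plus_stopping m2 E_atom_late]) (auto simp: m_cases)

lemma dev_before_c:
  assumes \<omega>: "\<omega> \<in> space M" and "a \<omega> < c \<omega>"
  shows "ce (a \<omega>) D \<omega> = W (a \<omega>) \<omega>"
  unfolding react_value_def
proof (rule ce_cong)
  fix x assume x: "x \<in> atom (a \<omega>) \<omega>"
  have ax: "a x = a \<omega>" by (rule stopping_time_atom[OF a \<omega> x])
  have cx: "a \<omega> < c x" by (rule stopping_time_atom_less[OF c_stopping \<omega> assms(2) x])
  show "D x = u (a \<omega>) (\<kappa> (a \<omega>) x) x"
  proof (cases "E x")
    case True
    then have "a \<omega> < m1 x + ennreal \<delta>" "\<not> m1 x + ennreal \<delta> \<le> a \<omega>" "m x = m1 x"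
      using cx m_cases(1)[OF atom_space[OF x]] by (simp_all add: c_def)
    moreover from this(1) have "a \<omega> < st x" using st_ge[OF atom_space[OF x]] by simp
    ultimately show ?thesis using True ax by (simp add: dev_def)
  qed (use cx ax in \<open>simp add: dev_def c_def\<close>)
qed

lemma dev_after_not_E:
  assumes \<omega>: "\<omega> \<in> space M" and E: "\<not> E \<omega>" and ca: "m2 \<omega> \<le> a \<omega>"
  shows "ce (m2 \<omega>) D \<omega> \<le> uppY u (m2 \<omega>) \<omega>"
proof (cases "a \<omega> = m2 \<omega>")
  case True
  let ?t = "m2 \<omega>"
  have "ce ?t D \<omega> = u ?t ?t \<omega>"
  proof (rule ce_eqI[OF \<omega>])
    fix x assume x: "x \<in> atom ?t \<omega>"
    have "\<not> E x" using E_atom_late[OF \<omega> _ x] E m_cases(2)[OF \<omega>] by simp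
    moreover have "m2 x = ?t" by (rule stopping_time_atom[OF m2 \<omega> x])
    moreover have "a x = ?t" using stopping_time_atom[OF a \<omega>, of x] x True by simp
    moreover have "u ?t ?t x = u ?t ?t \<omega>" using u_adapted[OF \<omega>, of x ?t ?t] x by simp
    ultimately show "D x = u ?t ?t \<omega>" by (simp add: dev_def Let_def)
  qed
  then show ?thesis using diag_le_uppY[OF \<omega>] by simp
next
  case False
  let ?t = "m2 \<omega>"
  have less: "?t < a \<omega>" using False ca by simp
  then have fin: "?t < \<infinity>" by (auto intro: order_less_le_trans)
  have "ce ?t D \<omega> = ce ?t (\<lambda>x. u (\<beta> ?t x) ?t x) \<omega>"
  proof (rule ce_cong)
    fix x assume x: "x \<in> atom ?t \<omega>"
    have "\<not> E x" using E_atom_late[OF \<omega> _ x] E m_cases(2)[OF \<omega>] by simp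
    moreover have "m2 x = ?t" by (rule stopping_time_atom[OF m2 \<omega> x])
    moreover have "?t < a x" by (rule stopping_time_atom_less[OF a \<omega> less x])
    ultimately show "D x = u (\<beta> ?t x) ?t x" by (auto simp: dev_def Let_def)
  qed
  then show ?thesis using uppY_ge[OF \<omega> \<beta>[OF fin]] by simp
qed

text \<open>The reduction to the Dynkin game, by conditioning at the first of the two stops. If the
  deviator stops, the punishing reaction leaves at most \<open>lowX\<close> plus 2\<epsilon>; if the
  opponent stops, any answer yields at most \<open>uppY\<close>; at a tie the payoffs agree.\<close>

lemma dev_le_stop_payoff:
  assumes x: "x \<in> space M" and E: "E x" and ax: "m1 x + ennreal \<delta> \<le> a x"
  shows "ce (min (a x) (st x)) D x \<le> ce (min (a x) (st x)) (stop_payoff u a st) x + 2 * \<epsilon>"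
proof -
  have late: "m1 x + ennreal \<delta> \<le> min (a x) (st x)" using ax st_ge[OF x] by simp
  then have ms: "m1 x \<le> min (a x) (st x)"
    by (rule order_trans[rotated]) simp
  \<comment> \<open>Both stops come after \<open>m1\<close>, so \<open>E\<close> and the start of
    the punishment are already decided on the atom over which the payoff is averaged.\<close>
  have *: "E y" "m y = m1 x" if "y \<in> atom (min (a x) (st x)) x" for y
  proof -
    have "m x \<le> min (a x) (st x)" using m_cases(1)[OF x E] ms by simp
    then have "E y = E x" by (rule E_atom_late[OF x _ that])
    then show "E y" using E by simp
    then have "m y = m1 y" by (rule m_cases(1)[OF atom_space[OF that]])
    then show "m y = m1 x" using stopping_time_atom_late[OF m1_stopping x ms that] by simp
  qed
  consider "a x < st x" | "a x = st x" | "st x < a x" by (rule linorder_cases)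
  then show ?thesis
  proof cases
    case 1
    let ?s = "a x"
    have s: "min (a x) (st x) = ?s" using 1 by simp
    have y: "a y = ?s" "?s < st y" if "y \<in> atom ?s x" for y
      using stopping_time_atom[OF a x that] stopping_time_atom_less[OF st_stopping x 1 that] by auto
    have "ce ?s D x = ce ?s (\<lambda>y. u ?s (\<kappa>' ?s y) y) x"
    proof (rule ce_cong)
      fix z assume z: "z \<in> atom ?s x"
      show "D z = u ?s (\<kappa>' ?s z) z"
        using y(2)[OF z] ax by (simp add: dev_def y(1)[OF z] *[unfolded s, OF z])
    qed
    moreover have "ce ?s (stop_payoff u a st) x = lowX u ?s x"
    proof (rule ce_eqI[OF x])
      fix z assume z: "z \<in> atom ?s x"
      show "stop_payoff u a st z = lowX u ?s x"
        using y(2)[OF z] by (simp add: stop_payoff_def y(1)[OF z] lowX_atom[OF x z])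
    qed
    ultimately show ?thesis unfolding s using \<kappa>'_near[OF x, of ?s] by simp
  next
    case 2
    let ?s = "a x"
    have s: "min (a x) (st x) = ?s" using 2 by simp
    have y: "a y = ?s" "st y = ?s" if "y \<in> atom ?s x" for y
      using stopping_time_atom[OF a x that] stopping_time_atom[OF st_stopping x, of y] 2 that by auto
    have "ce ?s D x = ce ?s (stop_payoff u a st) x"
    proof (rule ce_cong)
      fix z assume z: "z \<in> atom ?s x"
      show "D z = stop_payoff u a st z"
        by (simp add: dev_def stop_payoff_def Let_def y[OF z] *[unfolded s, OF z])
    qed
    then show ?thesis unfolding s using \<epsilon>_pos by simp
  next
    case 3
    let ?s = "st x"
    have s: "min (a x) (st x) = ?s" using 3 by simp
    have fin: "?s < \<infinity>" using 3 by (auto intro: order_less_le_trans)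
    have y: "st y = ?s" "?s < a y" if "y \<in> atom ?s x" for y
      using stopping_time_atom[OF st_stopping x that] stopping_time_atom_less[OF a x 3 that] by auto
    have "ce ?s D x = ce ?s (\<lambda>y. u (\<beta> ?s y) ?s y) x"
    proof (rule ce_cong)
      fix z assume z: "z \<in> atom ?s x"
      show "D z = u (\<beta> ?s z) ?s z"
        using y(2)[OF z] by (auto simp: dev_def Let_def y(1)[OF z] *[unfolded s, OF z])
    qed
    moreover have "ce ?s (stop_payoff u a st) x = uppY u ?s x"
    proof (rule ce_eqI[OF x])
      fix z assume z: "z \<in> atom ?s x"
      show "stop_payoff u a st z = uppY u ?s x"
        using y(2)[OF z] by (auto simp: stop_payoff_def y(1)[OF z] uppY_atom[OF x z])
    qed
    ultimately show ?thesis unfolding s using uppY_ge[OF x \<beta>[OF fin]] \<epsilon>_pos by simp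
  qed
qed

lemma dev_after_E:
  assumes \<omega>: "\<omega> \<in> space M" and E: "E \<omega>" and ca: "m1 \<omega> + ennreal \<delta> \<le> a \<omega>"
  shows "ce (m1 \<omega> + ennreal \<delta>) D \<omega> \<le> upval u (m1 \<omega> + ennreal \<delta>) \<omega> + 4 * \<epsilon>"
proof -
  let ?t = "m1 \<omega> + ennreal \<delta>"
  define s where "s x = min (a x) (st x)" for x
  have s: "stopping_time F s" unfolding s_def by (rule stopping_time_min[OF a st_stopping])
  have ts: "?t \<le> s \<omega>" using ca st_ge[OF \<omega>] by (simp add: s_def)
  have at: "m1 x + ennreal \<delta> = ?t" "E x" "?t \<le> a x" if x: "x \<in> atom ?t \<omega>" for x
  proof -
    show "m1 x + ennreal \<delta> = ?t" by (rule stopping_time_atom[OF m1_plus_stopping \<omega> x])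
    have "m \<omega> \<le> ?t" using m_cases(1)[OF \<omega> E] by simp
    then show "E x" using E_atom_late[OF \<omega> _ x] E by simp
    show "?t \<le> a x" by (rule stopping_time_atom_early[OF a \<omega> ca x])
  qed
  note nS = nice_stop_payoff[OF a st_stopping]
  \<comment> \<open>The time \<open>a\<close> lies after the start of the punishment only on the
    atom of \<omega>, while \<open>saddle_bound\<close> asks for this everywhere; the truncation
    agrees with \<open>a\<close> on that atom.\<close>
  define b where "b x = max (a x) (m1 x + ennreal \<delta>)" for x
  have b: "b \<in> T (\<lambda>x. m1 x + ennreal \<delta>)"
    unfolding b_def[abs_def] by (rule max_in_T[OF a m1_plus_stopping])
  have "ce ?t D \<omega> = ce ?t (\<lambda>x. ce (s x) D x) \<omega>"
    by (rule ce_tower[OF s nice_dev \<omega> ts, symmetric])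
  also have "\<dots> \<le> ce ?t (\<lambda>x. ce (s x) (stop_payoff u a st) x + 2 * \<epsilon>) \<omega>"
  proof (intro ce_mono nice_add nice_const nice_ce s nice_dev nS \<omega>)
    fix x assume x: "x \<in> atom ?t \<omega>"
    show "ce (s x) D x \<le> ce (s x) (stop_payoff u a st) x + 2 * \<epsilon>"
      unfolding s_def using at[OF x] by (intro dev_le_stop_payoff atom_space[OF x]) auto
  qed
  also have "\<dots> = ce ?t (stop_payoff u a st) \<omega> + 2 * \<epsilon>"
    using ce_tower[OF s nS \<omega> ts] by (simp add: ce_add_const nice_ce s nS \<omega>)
  also have "ce ?t (stop_payoff u a st) \<omega> = ce ?t (stop_payoff u b st) \<omega>"
    using at by (intro ce_cong) (simp only: stop_payoff_def b_def max_absorb1)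
  also have "\<dots> \<le> upval u ?t \<omega> + 2 * \<epsilon>" by (rule saddle_bound[OF m1_plus_stopping saddle b \<omega>])
  finally show ?thesis by simp
qed

text \<open>The sides are conditioned at different times, which suffices because only integrals are
  compared in the end. The largest error occurs for late deviations on \<open>E\<close>: 4\<epsilon>
  from \<open>dev_after_E\<close>, \<epsilon> for moving the value back to \<open>m1\<close> and
  \<epsilon> from \<open>at_m1\<close>. On \<open>bad \<delta>\<close> the change after
  \<open>m1\<close> is bounded by \<open>2 * C\<close> instead.\<close>

lemma dev_pointwise:
  assumes \<omega>: "\<omega> \<in> space M"
  shows "ce (min (a \<omega>) (c \<omega>)) D \<omega> \<le> ce (min (a \<omega>) (m \<omega>)) eq \<omega> + (6 * \<epsilon> + 2 * C * indicator (bad \<delta>) \<omega>)"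
proof -
  have C0: "0 \<le> C" by (rule C_nonneg[OF \<omega>])
  have Cb: "0 \<le> 2 * C * indicator (bad \<delta>) \<omega>" using C0 by (simp add: indicator_def)
  show ?thesis
  proof (cases "a \<omega> < c \<omega>")
    case True
    then have min: "min (a \<omega>) (c \<omega>) = a \<omega>" by simp
    note D = dev_before_c[OF \<omega> True]
    show ?thesis
    proof (cases "a \<omega> < m \<omega>")
      case am: True
      then show ?thesis
        using early_stop_le[OF \<omega> am] Cb \<epsilon>_pos by (simp add: min D)
    next
      case False
      then have am: "m \<omega> \<le> a \<omega>" by simp
      have E: "E \<omega>" using am True m_cases(2)[OF \<omega>] by (auto simp: c_def split: if_splits)
      have "W (a \<omega>) \<omega> \<le> W (m1 \<omega>) \<omega> + \<epsilon> + 2 * C * indicator (bad \<delta>) \<omega>"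
      proof (cases "\<omega> \<in> bad \<delta>")
        case True
        then show ?thesis using W_bounded[OF \<omega>, of "a \<omega>"] W_bounded[OF \<omega>, of "m1 \<omega>"] \<epsilon>_pos by simp
      next
        case False
        have "m1 \<omega> \<le> a \<omega>" "a \<omega> \<le> m1 \<omega> + ennreal \<delta>"
          using am True E m_cases(1)[OF \<omega>] by (auto simp: c_def)
        then have "\<not> \<epsilon> < \<bar>W (a \<omega>) \<omega> - W (m1 \<omega>) \<omega>\<bar>" using False \<omega> by (auto simp: bad_def)
        then show ?thesis using False by (simp add: abs_le_iff)
      qed
      then show ?thesis using ce_eq_E[OF \<omega> E] am \<epsilon>_pos by (simp add: min D min_absorb2)
    qed
  next
    case False
    then have ca: "c \<omega> \<le> a \<omega>" by simp
    then have mins: "min (a \<omega>) (c \<omega>) = c \<omega>" "min (a \<omega>) (m \<omega>) = m \<omega>"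
      using m_le_c[OF \<omega>] by (auto simp: min_absorb2 intro!: min_absorb2 order_trans[OF m_le_c[OF \<omega>]])
    show ?thesis
    proof (cases "E \<omega>")
      case E: True
      let ?t = "m1 \<omega> + ennreal \<delta>"
      have "upval u ?t \<omega> \<le> upval u (m1 \<omega>) \<omega> + \<epsilon> + 2 * C * indicator (bad \<delta>) \<omega>"
      proof (cases "\<omega> \<in> bad \<delta>")
        case True
        then show ?thesis
          using upval_bounded[OF \<omega>, of ?t] upval_bounded[OF \<omega>, of "m1 \<omega>"] \<epsilon>_pos by simp
      next
        case False
        then have "\<not> upval u (m1 \<omega>) \<omega> + \<epsilon> < upval u ?t \<omega>" using \<omega> by (auto simp: bad_def)
        then show ?thesis using False by simp
      qed
      then show ?thesis
        using dev_after_E[OF \<omega> E] ca E at_m1[OF \<omega>] ce_eq_E[OF \<omega> E] unfolding mins by (simp add: c_def)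
    next
      case E: False
      then show ?thesis
        using dev_after_not_E[OF \<omega> E] ca ce_eq_not_E[OF \<omega> E] Cb \<epsilon>_pos unfolding mins by (simp add: c_def)
    qed
  qed
qed

lemma integral_dev_le: "(\<integral>\<omega>. D \<omega> \<partial>M) \<le> (\<integral>\<omega>. eq \<omega> \<partial>M) + 6 * \<epsilon> + 2 * C * prob (bad \<delta>)"
proof -
  have ac: "stopping_time F (\<lambda>\<omega>. min (a \<omega>) (c \<omega>))" by (rule stopping_time_min[OF a c_stopping])
  have am: "stopping_time F (\<lambda>\<omega>. min (a \<omega>) (m \<omega>))" by (rule stopping_time_min[OF a m_stopping])
  note i = nice_integrable[OF nice_ce[OF am nice_eq]]
  have ib: "integrable M (\<lambda>\<omega>. 2 * C * indicator (bad \<delta>) \<omega>)"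
    using bad_in_M by (intro integrable_mult_right) (simp add: emeasure_eq_measure)
  have "(\<integral>\<omega>. D \<omega> \<partial>M) = (\<integral>\<omega>. ce (min (a \<omega>) (c \<omega>)) D \<omega> \<partial>M)"
    by (rule tower[OF ac nice_dev, symmetric])
  also have "\<dots> \<le> (\<integral>\<omega>. ce (min (a \<omega>) (m \<omega>)) eq \<omega> + (6 * \<epsilon> + 2 * C * indicator (bad \<delta>) \<omega>) \<partial>M)"
    using i ib nice_integrable[OF nice_ce[OF ac nice_dev]]
    by (intro integral_mono dev_pointwise Bochner_Integration.integrable_add integrable_const)
  also have "\<dots> = (\<integral>\<omega>. eq \<omega> \<partial>M) + 6 * \<epsilon> + 2 * C * prob (bad \<delta>)"
    using i ib bad_in_M tower[OF am nice_eq] by (simp add: Bochner_Integration.integral_add prob_space)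
  finally show ?thesis .
qed

end

text \<open>The threshold for \<delta> is read off from \<open>bad\<close> alone, which involves
  neither the saddle point nor the deviation. Hence the quantifiers over these may follow \<delta>,
  as they must: saddle points depend on \<delta>, and all deviations have to be covered at
  once.\<close>

lemma deviation_bound:
  "\<forall>\<^sub>F \<delta> in at_right 0. \<forall>p st a \<beta>. saddle u \<epsilon> (\<lambda>\<omega>. m1 \<omega> + ennreal \<delta>) p st \<longrightarrow>
     stopping_time F a \<longrightarrow> (\<forall>t<\<infinity>. \<beta> t \<in> T (\<lambda>_. t)) \<longrightarrow>
     (\<integral>\<omega>. dev \<delta> st a \<beta> \<omega> \<partial>M) \<le> (\<integral>\<omega>. eq \<omega> \<partial>M) + 18 * \<epsilon>"
proof -
  obtain \<omega> where "\<omega> \<in> space M" using not_empty by blast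
  then have C: "0 \<le> C" by (rule C_nonneg)
  \<comment> \<open>Makes \<open>2 * C * prob (bad d)\<close> at most \<epsilon>, also for
    \<open>C = 0\<close>.\<close>
  obtain d where d: "0 < d" "prob (bad d) < \<epsilon> / (2 * C + 1)"
    using bad_small[of "\<epsilon> / (2 * C + 1)"] \<epsilon>_pos C by auto
  show ?thesis
  proof (rule eventually_at_rightI[OF _ d(1)], intro allI impI)
    fix \<delta> p st a \<beta>
    assume \<delta>: "\<delta> \<in> {0<..<d}" and *: "saddle u \<epsilon> (\<lambda>\<omega>. m1 \<omega> + ennreal \<delta>) p st"
      "stopping_time F a" "\<forall>t<\<infinity>. \<beta> t \<in> T (\<lambda>_. t)"
    have "prob (bad \<delta>) \<le> prob (bad d)"
      using \<delta> by (intro finite_measure_mono bad_mono bad_in_M) simp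
    then have "2 * C * prob (bad \<delta>) \<le> 2 * C * (\<epsilon> / (2 * C + 1))"
      using d(2) C by (intro mult_left_mono) auto
    also have "\<dots> \<le> \<epsilon>" using C \<epsilon>_pos by (simp add: field_simps)
    finally show "(\<integral>\<omega>. dev \<delta> st a \<beta> \<omega> \<partial>M) \<le> (\<integral>\<omega>. eq \<omega> \<partial>M) + 18 * \<epsilon>"
      using integral_dev_le[OF *(1,2)] *(3) \<epsilon>_pos by fastforce
  qed
qed

end

section \<open>Grid reactions\<close>

text \<open>The added 1 leads to a grid point strictly after t even if t is on the grid, so that a
  reaction comes strictly later than the stop it answers.\<close>

definition grid_index :: "real \<Rightarrow> ennreal \<Rightarrow> nat" where
  "grid_index h t = nat \<lfloor>enn2real t / h\<rfloor> + 1"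

lemma grid_reaction_eq: "grid_reaction h b t = (if t = \<infinity> then (\<lambda>_. \<infinity>) else b (grid_index h t))"
  by (auto simp: grid_reaction_def grid_index_def fun_eq_iff)

lemma grid_index_bounds:
  assumes "0 < h" "t < \<infinity>"
  shows "t < ennreal (real (grid_index h t) * h)" "ennreal (real (grid_index h t) * h) \<le> t + ennreal h"
proof -
  define x where "x = enn2real t"
  have t: "t = ennreal x" using assms(2) by (simp add: x_def less_top)
  have x: "0 \<le> x" by (simp add: x_def)
  have "0 \<le> x / h" using x assms(1) by simp
  then have n: "real (grid_index h t) = of_int \<lfloor>x / h\<rfloor> + 1" by (simp add: grid_index_def x_def)
  have "x / h < real (grid_index h t)" "real (grid_index h t) \<le> x / h + 1" unfolding n by linarith+
  then have *: "x < real (grid_index h t) * h" "real (grid_index h t) * h \<le> x + h"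
    using assms(1) by (simp_all add: field_simps)
  have "ennreal x < ennreal (real (grid_index h t) * h)" using * x by (intro ennreal_lessI) auto
  then show "t < ennreal (real (grid_index h t) * h)" by (simp only: t[symmetric])
  have "ennreal (real (grid_index h t) * h) \<le> ennreal (x + h)" by (intro ennreal_leI *)
  also have "\<dots> = t + ennreal h" using x assms(1) t by (simp add: ennreal_plus)
  finally show "ennreal (real (grid_index h t) * h) \<le> t + ennreal h" .
qed

lemma grid_index_step:
  assumes "0 < h" "t < \<infinity>"
  obtains d :: real where "0 < d" "\<And>s. t \<le> s \<Longrightarrow> s \<le> t + ennreal d \<Longrightarrow> s < \<infinity> \<and> grid_index h s = grid_index h t"
proof -
  define x where "x = enn2real t"
  have t: "t = ennreal x" using assms(2) by (simp add: x_def less_top)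
  have x: "0 \<le> x" by (simp add: x_def)
  \<comment> \<open>Half the distance to the next grid point; it is positive also when
    \<open>x\<close> is a grid point, since the floor is right continuous.\<close>
  define d where "d = ((of_int \<lfloor>x / h\<rfloor> + 1) * h - x) / 2"
  have "x / h < of_int \<lfloor>x / h\<rfloor> + 1" by linarith
  then have d: "0 < d" using assms(1) by (simp add: d_def field_simps)
  show ?thesis
  proof (rule that[OF d])
    fix s assume s: "t \<le> s" "s \<le> t + ennreal d"
    have "s \<le> ennreal (x + d)" using s(2) x d by (simp add: t ennreal_plus)
    then have fin: "s < \<infinity>" by (auto intro: order_le_less_trans)
    define y where "y = enn2real s"
    have sy: "s = ennreal y" using fin by (simp add: y_def less_top)
    have "y \<le> x + d"
      using \<open>s \<le> ennreal (x + d)\<close> ennreal_le_iff[of "x + d" y] x d by (simp add: sy del: ennreal_plus)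
    moreover have "x \<le> y" using s(1) fin unfolding x_def y_def by (intro enn2real_mono) auto
    moreover have "x + d < (of_int \<lfloor>x / h\<rfloor> + 1) * h" using d by (simp add: d_def field_simps)
    ultimately have "x / h \<le> y / h" "y / h < of_int \<lfloor>x / h\<rfloor> + 1"
      using assms(1) by (simp_all add: field_simps)
    then have "\<lfloor>y / h\<rfloor> = \<lfloor>x / h\<rfloor>" by linarith
    then show "s < \<infinity> \<and> grid_index h s = grid_index h t"
      using fin by (simp add: grid_index_def x_def y_def)
  qed
qed

context countable_filtered_space
begin

lemma grid_reaction_after:
  assumes "0 < h" "\<And>n. b n \<in> T (\<lambda>_. ennreal (real n * h))" "t < \<infinity>"
  shows "grid_reaction h b t \<in> stopping_times_after M F (\<lambda>_. t)"
  using assms(2)[of "grid_index h t"] grid_index_bounds(1)[OF assms(1,3)] assms(3)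
  by (auto simp: grid_reaction_eq T_iff stopping_times_after_def intro: order_less_le_trans)

lemma after_in_T: "\<tau> \<in> stopping_times_after M F \<sigma> \<Longrightarrow> \<tau> \<in> T \<sigma>"
  by (auto simp: stopping_times_after_def T_iff)

lemma grid_reaction_T:
  assumes "0 < h" "\<And>n. b n \<in> T (\<lambda>_. ennreal (real n * h))"
  shows "grid_reaction h b t \<in> T (\<lambda>_. t)"
proof (cases "t = \<infinity>")
  case True
  then show ?thesis using infinity_in_T by (simp add: grid_reaction_eq)
next
  case False
  then have "t < \<infinity>" by (simp add: less_top)
  then show ?thesis using grid_reaction_after[of h b] assms by (intro after_in_T) auto
qed

lemma grid_reaction_step:
  assumes "0 < h" "t < \<infinity>"
  shows "\<exists>d::real>0. \<forall>s. t \<le> s \<and> s \<le> t + ennreal d \<longrightarrow> grid_reaction h b s = grid_reaction h b t"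
proof -
  obtain d :: real where "0 < d" "\<And>s. t \<le> s \<Longrightarrow> s \<le> t + ennreal d \<Longrightarrow> s < \<infinity> \<and> grid_index h s = grid_index h t"
    using grid_index_step[OF assms] by blast
  then show ?thesis using assms(2) unfolding grid_reaction_eq by (metis order_less_irrefl)
qed

text \<open>Time enters only through a countably valued index, so joint measurability reduces to
  that of each stopping time.\<close>

lemma measurable_grid_reaction:
  assumes "0 < h" "\<And>n. b n \<in> T (\<lambda>_. ennreal (real n * h))"
  shows "(\<lambda>p. grid_reaction h b (fst p) (snd p)) \<in> borel \<Otimes>\<^sub>M M \<rightarrow>\<^sub>M borel"
proof -
  have [measurable]: "b n \<in> borel_measurable M" for n
    using measurable_stopping_time[OF T_stopping[OF assms(2)] sets_F_subset] space_F by simp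
  have [measurable]: "(\<lambda>p. grid_index h (fst p)) \<in> borel \<Otimes>\<^sub>M M \<rightarrow>\<^sub>M count_space UNIV"
    unfolding grid_index_def by measurable
  have "(\<lambda>p. b (grid_index h (fst p)) (snd p)) \<in> borel \<Otimes>\<^sub>M M \<rightarrow>\<^sub>M borel"
    by (rule measurable_compose_countable) measurable
  then show ?thesis unfolding grid_reaction_def grid_index_def by measurable
qed

text \<open>On the atom at the minimum, the time attaining it is constant and the other one has not
  come earlier, so their order is the same at all points.\<close>

lemma le_atom:
  assumes "stopping_time F \<sigma>" "stopping_time F \<tau>" "\<omega> \<in> space M" "\<omega>' \<in> atom (min (\<sigma> \<omega>) (\<tau> \<omega>)) \<omega>"
  shows "\<sigma> \<omega>' \<le> \<tau> \<omega>' \<longleftrightarrow> \<sigma> \<omega> \<le> \<tau> \<omega>"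
proof (cases "\<sigma> \<omega> \<le> \<tau> \<omega>")
  case True
  then have "\<omega>' \<in> atom (\<sigma> \<omega>) \<omega>" using assms(4) by (simp add: min_absorb1)
  then show ?thesis
    using stopping_time_atom[OF assms(1,3)] stopping_time_atom_early[OF assms(2,3) True] True by simp
next
  case False
  then have less: "\<tau> \<omega> < \<sigma> \<omega>" by simp
  then have x: "\<omega>' \<in> atom (\<tau> \<omega>) \<omega>" using assms(4) by (simp add: min_absorb2 less_imp_le)
  then show ?thesis
    using stopping_time_atom[OF assms(2,3) x] stopping_time_atom_less[OF assms(1,3) less x] less
    by auto
qed

lemma nice_cong: "(\<And>\<omega>. \<omega> \<in> space M \<Longrightarrow> f \<omega> = g \<omega>) \<Longrightarrow> nice f \<longleftrightarrow> nice g"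
  unfolding nice_def using measurable_cong[of M f g] by auto

lemma stopping_time_cong_space:
  "(\<And>\<omega>. \<omega> \<in> space M \<Longrightarrow> \<sigma> \<omega> = \<tau> \<omega>) \<Longrightarrow> stopping_time F \<sigma> \<longleftrightarrow> stopping_time F \<tau>"
  by (rule stopping_time_cong) (simp add: space_F)

lemma cond_at_eq_ce_cong:
  assumes "stopping_time F \<sigma>" "nice g" "\<omega> \<in> space M" "\<And>x. x \<in> space M \<Longrightarrow> f x = g x"
  shows "cond_at M F \<sigma> f \<omega> = ce (\<sigma> \<omega>) g \<omega>"
proof -
  have "nice f" using nice_cong[of f g] assms by simp
  then have "cond_at M F \<sigma> f \<omega> = ce (\<sigma> \<omega>) f \<omega>" using assms(1,3) by (intro cond_at_eq_ce)
  also have "\<dots> = ce (\<sigma> \<omega>) g \<omega>" by (intro ce_cong assms(4) atom_space)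
  finally show ?thesis .
qed

end

section \<open>Agreement with the defining formulas, and the error of grid reactions\<close>

context game_payoff
begin

lemma INF_real_cond_exp:
  assumes "\<omega> \<in> space M"
  shows "(INF \<sigma>\<in>T (\<lambda>_. t). real_cond_exp M (F t) (\<lambda>\<omega>. u t (\<sigma> \<omega>) \<omega>) \<omega>) = lowX u t \<omega>"
  unfolding lowX_def using assms
  by (intro INF_cong refl real_cond_exp_eq_ce nice_u1 T_stopping)

lemma SUP_real_cond_exp:
  assumes "\<omega> \<in> space M"
  shows "(SUP \<sigma>\<in>T (\<lambda>_. t). real_cond_exp M (F t) (\<lambda>\<omega>. u (\<sigma> \<omega>) t \<omega>) \<omega>) = uppY u t \<omega>"
proof -
  have "real_cond_exp M (F t) (\<lambda>\<omega>. u (\<sigma> \<omega>) t \<omega>) \<omega> = ce t (\<lambda>\<omega>. u (\<sigma> \<omega>) t \<omega>) \<omega>" if "\<sigma> \<in> T (\<lambda>_. t)" for \<sigma>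
    using assms that by (intro real_cond_exp_eq_ce nice_u T_stopping stopping_time_const)
  then show ?thesis
    unfolding uppY_def lowX_def swap_def ce_uminus Inf_real_def image_image minus_minus
    by (intro SUP_cong refl)
qed

text \<open>The left side is minus the swapped upper value, so this is where the existence of the
  value identifies \<open>dynkin_value\<close> of the first game with \<open>upval\<close>.\<close>

lemma SUP_INF_eq_upval:
  assumes "\<omega> \<in> space M"
  shows "(SUP \<rho>\<in>T (\<lambda>_. t). INF \<tau>\<in>T (\<lambda>_. t). ce t (stop_payoff u \<rho> \<tau>) \<omega>) = upval u t \<omega>"
proof -
  have eq: "ce t (stop_payoff (swap u) \<tau> \<rho>) \<omega> = - ce t (stop_payoff u \<rho> \<tau>) \<omega>" for \<rho> \<tau>
    by (simp add: stop_payoff_swap[abs_def] ce_uminus[symmetric])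
  have "upval u t \<omega> = - upval (swap u) t \<omega>" using upval_swap[OF assms] by simp
  also have "\<dots> = (SUP \<rho>\<in>T (\<lambda>_. t). INF \<tau>\<in>T (\<lambda>_. t). ce t (stop_payoff u \<rho> \<tau>) \<omega>)"
    unfolding upval_def eq by (simp add: Inf_real_def image_image)
  finally show ?thesis by simp
qed

lemma uppY_near_stopping:
  assumes "stopping_time F \<sigma>" "0 < \<eta>"
  shows "\<exists>\<tau>\<in>T \<sigma>. \<forall>\<omega>\<in>space M. uppY u (\<sigma> \<omega>) \<omega> - \<eta> \<le> ce (\<sigma> \<omega>) (\<lambda>x. u (\<tau> x) (\<sigma> \<omega>) x) \<omega>"
proof -
  have iff: "- a \<le> - b + \<eta> \<longleftrightarrow> b - \<eta> \<le> a" for a b :: real by linarith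
  have low: "lowX (swap u) t \<omega> = - uppY u t \<omega>" for t \<omega> by (simp add: uppY_def)
  show ?thesis
    using game_payoff.lowX_near_stopping[OF game_payoff_swap assms]
    by (simp only: low swap_def ce_uminus iff)
qed

lemma lowX_near_family:
  fixes t :: "nat \<Rightarrow> ennreal"
  assumes "0 < \<eta>"
  shows "\<exists>b. \<forall>n. b n \<in> T (\<lambda>_. t n) \<and> (\<forall>\<omega>\<in>space M. ce (t n) (\<lambda>x. u (t n) (b n x) x) \<omega> \<le> lowX u (t n) \<omega> + \<eta>)"
  using lowX_near_stopping[OF stopping_time_const assms] by (intro choice) blast

lemma uppY_near_family:
  fixes t :: "nat \<Rightarrow> ennreal"
  assumes "0 < \<eta>"
  shows "\<exists>b. \<forall>n. b n \<in> T (\<lambda>_. t n) \<and> (\<forall>\<omega>\<in>space M. uppY u (t n) \<omega> - \<eta> \<le> ce (t n) (\<lambda>x. u (b n x) (t n) x) \<omega>)"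
  using uppY_near_stopping[OF stopping_time_const assms] by (intro choice) blast

text \<open>The reaction uses the optimizer of the next grid time s, at most h after t. The errors
  are \<epsilon> for the optimizer, less than \<epsilon> / 3 for moving the first argument from t to
  s, and less than \<epsilon> / 3 for bringing \<open>lowX\<close> back to t.\<close>

lemma grid_reaction_near_lowX:
  assumes h: "0 < h" "r (2 * ennreal h) < \<epsilon> / 3" and \<omega>: "\<omega> \<in> space M"
    and b: "\<And>n. b n \<in> T (\<lambda>_. ennreal (real n * h))"
    and near: "\<And>n x. x \<in> space M \<Longrightarrow>
      ce (ennreal (real n * h)) (\<lambda>x. u (ennreal (real n * h)) (b n x) x) x \<le> lowX u (ennreal (real n * h)) x + \<epsilon>"
  shows "\<bar>lowX u t \<omega> - ce t (\<lambda>x. u t (grid_reaction h b t x) x) \<omega>\<bar> \<le> 2 * \<epsilon>"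
proof -
  have \<epsilon>: "0 < \<epsilon>" using h(2) r_nonneg[OF \<omega>, of "2 * ennreal h"] by simp
  have 1: "lowX u t \<omega> \<le> ce t (\<lambda>x. u t (grid_reaction h b t x) x) \<omega>"
    by (rule lowX_le[OF \<omega> grid_reaction_T[OF h(1) b]])
  have "ce t (\<lambda>x. u t (grid_reaction h b t x) x) \<omega> \<le> lowX u t \<omega> + 2 * \<epsilon>"
  proof (cases "t = \<infinity>")
    case True
    have "ce t (\<lambda>x. u t (grid_reaction h b t x) x) \<omega> = u \<infinity> \<infinity> \<omega>"
      using u_adapted[OF \<omega>, of _ \<infinity> \<infinity>] True by (intro ce_eqI \<omega>) (simp add: grid_reaction_eq)
    then show ?thesis using lowX_infinity[OF \<omega>] True \<epsilon> by simp
  next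
    case False
    then have fin: "t < \<infinity>" by (simp add: less_top)
    define n where "n = grid_index h t"
    define s where "s = ennreal (real n * h)"
    have ts: "t \<le> s" "s \<le> t + ennreal h"
      using grid_index_bounds[OF h(1) fin] by (simp_all add: s_def n_def less_imp_le)
    have td: "time_dist t s \<le> ennreal h" by (rule time_dist_add[OF ts fin])
    have "time_dist t s \<le> 2 * ennreal h"
      using td by (rule order_trans) (simp add: mult_2 add_increasing)
    then have r1: "r (time_dist t s) \<le> r (2 * ennreal h)" using r_mono by (simp add: monoD)
    have r2: "r (2 * time_dist t s) \<le> r (2 * ennreal h)"
      using td r_mono by (intro monoD[OF r_mono] mult_left_mono) auto
    have bs: "stopping_time F (b n)" by (rule T_stopping[OF b])
    have "ce t (\<lambda>x. u t (grid_reaction h b t x) x) \<omega> = ce t (\<lambda>x. u t (b n x) x) \<omega>"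
      using False by (simp add: grid_reaction_eq n_def)
    also have "\<dots> \<le> ce t (\<lambda>x. u s (b n x) x + r (time_dist t s)) \<omega>"
    proof (intro ce_mono nice_add nice_u1 nice_const bs \<omega>)
      fix x assume "x \<in> atom t \<omega>"
      then show "u t (b n x) x \<le> u s (b n x) x + r (time_dist t s)"
        using u_modulus[OF atom_space, of x t \<omega> t "b n x" s "b n x"] by simp
    qed
    also have "\<dots> = ce t (ce s (\<lambda>x. u s (b n x) x)) \<omega> + r (time_dist t s)"
      using ts bs \<omega> by (simp add: ce_add_const nice_u1 ce_ce)
    finally have 2: "ce t (\<lambda>x. u t (grid_reaction h b t x) x) \<omega> \<le>
      ce t (ce s (\<lambda>x. u s (b n x) x)) \<omega> + r (time_dist t s)" .
    have "ce t (ce s (\<lambda>x. u s (b n x) x)) \<omega> \<le> ce t (\<lambda>x. lowX u s x + \<epsilon>) \<omega>"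
      using nice_ce[OF stopping_time_const nice_u1[OF bs], of s s] nice_lowX[OF stopping_time_const, of s]
      by (intro ce_mono nice_add nice_const \<omega>) (auto simp: s_def near atom_space)
    also have "\<dots> = ce t (lowX u s) \<omega> + \<epsilon>"
      using nice_lowX[OF stopping_time_const, of s] \<omega> by (simp add: ce_add_const)
    finally show ?thesis using 2 lowX_ge_later[OF \<omega> ts(1)] r1 r2 h(2) \<epsilon> by linarith
  qed
  with 1 show ?thesis by linarith
qed

lemma grid_reaction_near_uppY:
  assumes h: "0 < h" "r (2 * ennreal h) < \<epsilon> / 3" and \<omega>: "\<omega> \<in> space M"
    and b: "\<And>n. b n \<in> T (\<lambda>_. ennreal (real n * h))"
    and near: "\<And>n x. x \<in> space M \<Longrightarrow> uppY u (ennreal (real n * h)) x - \<epsilon> \<le>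
      ce (ennreal (real n * h)) (\<lambda>x. u (b n x) (ennreal (real n * h)) x) x"
  shows "\<bar>uppY u t \<omega> - ce t (\<lambda>x. u (grid_reaction h b t x) t x) \<omega>\<bar> \<le> 2 * \<epsilon>"
proof -
  have near': "ce (ennreal (real n * h)) (\<lambda>x. swap u (ennreal (real n * h)) (b n x) x) x
      \<le> lowX (swap u) (ennreal (real n * h)) x + \<epsilon>" if "x \<in> space M" for n x
    using near[OF that, of n] by (simp add: swap_def ce_uminus uppY_def)
  have "ce t (\<lambda>x. swap u t (grid_reaction h b t x) x) \<omega> = - ce t (\<lambda>x. u (grid_reaction h b t x) t x) \<omega>"
    by (simp add: swap_def ce_uminus)
  then show ?thesis
    using game_payoff.grid_reaction_near_lowX[OF game_payoff_swap h \<omega> b near', of t]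
    unfolding uppY_def by linarith
qed

end

section \<open>The two games of the players\<close>

text \<open>If one of the times is infinite, \<omega>' lies in the atom of \<omega> at every time.
  The payoffs at finite times then agree at both points, and so do their limits.\<close>

lemma (in stopping_game) U_adapted:
  assumes \<omega>: "\<omega> \<in> space M" and \<omega>': "\<omega>' \<in> atom (max s t) \<omega>"
  shows "U i s t \<omega>' = U i s t \<omega>"
proof -
  have fin: "U i s t \<omega>' = U i s t \<omega>" if "s < \<infinity>" "t < \<infinity>" "\<omega>' \<in> atom (max s t) \<omega>" for s t
    using U_measurable[OF that(1,2), of i] \<omega> that(3) by (simp add: measurable_F_iff)
  note \<omega>'M = atom_space[OF \<omega>']
  have at: "\<omega>' \<in> atom q \<omega>" if "max s t = \<infinity>" for q
    using \<omega>' that atom_antimono[of q \<infinity> \<omega>] by auto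
  consider "s < \<infinity>" "t < \<infinity>" | "s < \<infinity>" "t = \<infinity>" | "s = \<infinity>" "t < \<infinity>" | "s = \<infinity>" "t = \<infinity>"
    by (metis infinity_ennreal_def top.not_eq_extremum)
  then show ?thesis
  proof cases
    case 1
    then show ?thesis using fin \<omega>' by blast
  next
    case 2
    then have "(\<lambda>b::real. U i s (ennreal b) \<omega>') = (\<lambda>b. U i s (ennreal b) \<omega>)"
      using at by (intro ext fin) auto
    then show ?thesis
      using U_lim_snd[OF 2(1) \<omega>, of i] U_lim_snd[OF 2(1) \<omega>'M, of i] 2(2)
      by (metis tendsto_unique trivial_limit_at_top_linorder)
  next
    case 3
    then have "(\<lambda>a::real. U i (ennreal a) t \<omega>') = (\<lambda>a. U i (ennreal a) t \<omega>)"
      using at by (intro ext fin) auto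
    then show ?thesis
      using U_lim_fst[OF 3(2) \<omega>, of i] U_lim_fst[OF 3(2) \<omega>'M, of i] 3(1)
      by (metis tendsto_unique trivial_limit_at_top_linorder)
  next
    case 4
    then have "(\<lambda>(a::real, b::real). U i (ennreal a) (ennreal b) \<omega>') = (\<lambda>(a, b). U i (ennreal a) (ennreal b) \<omega>)"
      using at by (intro ext) (auto intro!: fin)
    moreover have "(at_top :: real filter) \<times>\<^sub>F (at_top :: real filter) \<noteq> bot"
      by (simp add: prod_filter_eq_bot)
    ultimately show ?thesis
      using U_lim_both[OF \<omega>, of i] U_lim_both[OF \<omega>'M, of i] 4 by (metis tendsto_unique)
  qed
qed

lemma (in stopping_game) game_payoffs:
  assumes r: "payoff_modulus M U r"
  obtains C where "game_payoff M F (U P1) r C" "game_payoff M F (\<lambda>s t. U P2 t s) r C"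
proof -
  have "bounded (range r)" using r by (simp add: payoff_modulus_def)
  then obtain B where "\<And>y. y \<in> range r \<Longrightarrow> norm y \<le> B" unfolding bounded_iff by blast
  then have B: "\<bar>r x\<bar> \<le> B" for x using rangeI[of r x] by fastforce
  have mod: "\<bar>U i s t \<omega> - U i s' t' \<omega>\<bar> \<le> r (time_dist s s' + time_dist t t')" if "\<omega> \<in> space M" for i s t s' t' \<omega>
    using r that by (auto simp: payoff_modulus_def)
  have "\<exists>c. \<forall>\<omega>\<in>space M. \<bar>U i 0 0 \<omega>\<bar> \<le> c" for i
    using U_bounded[of i] by (metis infinity_ennreal_def ennreal_zero_less_top)
  then obtain c where c: "\<And>i \<omega>. \<omega> \<in> space M \<Longrightarrow> \<bar>U i 0 0 \<omega>\<bar> \<le> c i" by metis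
  \<comment> \<open>The bound assumed for \<open>U\<close> concerns finite times; starting from
    \<open>U i 0 0\<close> and adding the bound of \<open>r\<close> covers infinite times as
    well.\<close>
  define C where "C = max (c P1) (c P2) + B"
  have C: "\<bar>U i s t \<omega>\<bar> \<le> C" if "\<omega> \<in> space M" for i s t \<omega>
  proof -
    have "c i \<le> max (c P1) (c P2)" by (cases i) auto
    then show ?thesis
      using c[OF that, of i] mod[OF that, of i s t 0 0] B[of "time_dist s 0 + time_dist t 0"]
      unfolding C_def by linarith
  qed
  have r': "mono r" "(r \<longlongrightarrow> 0) (at_right 0)" using r by (auto simp: payoff_modulus_def)
  show ?thesis
  proof (rule that)
    show "game_payoff M F (U P1) r C"
      by unfold_locales (use U_adapted C mod r' in blast)+
    show "game_payoff M F (\<lambda>s t. U P2 t s) r C"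
    proof unfold_locales
      fix s t s' t' \<omega> assume "\<omega> \<in> space M"
      then show "\<bar>U P2 t s \<omega> - U P2 t' s' \<omega>\<bar> \<le> r (time_dist s s' + time_dist t t')"
        using mod[of \<omega> P2 t s t' s'] by (simp add: add.commute)
    next
      fix s t \<omega> \<omega>' assume "\<omega> \<in> space M" "\<omega>' \<in> atom (max s t) \<omega>"
      then show "U P2 t s \<omega>' = U P2 t s \<omega>" using U_adapted[of \<omega> \<omega>' t s P2] by (simp add: max.commute)
    qed (use C r' in blast)+
  qed
qed

locale bounded_stopping_game = stopping_game M F U for M :: "'a measure" and F U +
  fixes r :: "ennreal \<Rightarrow> real" and C :: real
  assumes payoff1: "game_payoff M F (U P1) r C"
    and payoff2: "game_payoff M F (\<lambda>s t. U P2 t s) r C"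
begin

abbreviation u1 :: "ennreal \<Rightarrow> ennreal \<Rightarrow> 'a \<Rightarrow> real" where "u1 \<equiv> U P1"

abbreviation u2 :: "ennreal \<Rightarrow> ennreal \<Rightarrow> 'a \<Rightarrow> real" where "u2 \<equiv> \<lambda>s t. U P2 t s"

sublocale G1: game_payoff M F u1 r C by (rule payoff1)

sublocale G2: game_payoff M F u2 r C by (rule payoff2)

section \<open>The Dynkin games of both players in terms of \<open>lowX\<close>, \<open>uppY\<close>
  and \<open>upval\<close>\<close>

lemma X1: "\<omega> \<in> space M \<Longrightarrow> X_proc M F U P1 t \<omega> = lowX u1 t \<omega>"
  using G1.INF_real_cond_exp by simp

lemma Y1: "\<omega> \<in> space M \<Longrightarrow> Y_proc M F U P1 t \<omega> = uppY u1 t \<omega>"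
  using G1.SUP_real_cond_exp by simp

lemma X2: "\<omega> \<in> space M \<Longrightarrow> X_proc M F U P2 t \<omega> = uppY u2 t \<omega>"
  using G2.SUP_real_cond_exp by simp

lemma Y2: "\<omega> \<in> space M \<Longrightarrow> Y_proc M F U P2 t \<omega> = lowX u2 t \<omega>"
  using G2.INF_real_cond_exp by simp

lemma dynkin_payoff1:
  assumes "stopping_time F \<sigma>" "stopping_time F \<rho>" "stopping_time F \<tau>" "\<omega> \<in> space M"
  shows "dynkin_payoff M F U P1 \<sigma> \<rho> \<tau> \<omega> = ce (\<sigma> \<omega>) (stop_payoff u1 \<rho> \<tau>) \<omega>"
  unfolding dynkin_payoff_def
  by (intro cond_at_eq_ce_cong assms G1.nice_stop_payoff)
     (simp only: stop_payoff_def X1 Y1 Z_proc_def)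

lemma dynkin_payoff2:
  assumes "stopping_time F \<sigma>" "stopping_time F \<rho>" "stopping_time F \<tau>" "\<omega> \<in> space M"
  shows "dynkin_payoff M F U P2 \<sigma> \<rho> \<tau> \<omega> = ce (\<sigma> \<omega>) (stop_payoff u2 \<tau> \<rho>) \<omega>"
  unfolding dynkin_payoff_def
proof (intro cond_at_eq_ce_cong assms G2.nice_stop_payoff)
  fix x assume "x \<in> space M"
  then show "(if \<rho> x < \<tau> x then X_proc M F U P2 (\<rho> x) x
      else if \<tau> x < \<rho> x then Y_proc M F U P2 (\<tau> x) x else Z_proc U P2 (\<rho> x) x) =
    stop_payoff u2 \<tau> \<rho> x"
    using X2[of x "\<rho> x"] Y2[of x "\<tau> x"] by (cases "\<rho> x" "\<tau> x" rule: linorder_cases) (auto simp: stop_payoff_def Z_proc_def)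
qed

lemma dynkin_value1:
  assumes "\<omega> \<in> space M"
  shows "dynkin_value M F U P1 (\<lambda>_. t) \<omega> = upval u1 t \<omega>"
  unfolding dynkin_value.simps G1.SUP_INF_eq_upval[OF assms, symmetric]
  by (intro SUP_cong INF_cong refl dynkin_payoff1 stopping_time_const T_stopping assms)

text \<open>In the second game the minimizer is the outer player already, so the definition is an
  upper value as it stands.\<close>

lemma dynkin_value2:
  assumes "\<omega> \<in> space M"
  shows "dynkin_value M F U P2 (\<lambda>_. t) \<omega> = upval u2 t \<omega>"
  unfolding dynkin_value.simps upval_def
  by (intro SUP_cong INF_cong refl dynkin_payoff2 stopping_time_const T_stopping assms)

lemma saddle_point1:
  assumes "stopping_time F \<sigma>"
  shows "saddle_point M F U \<epsilon> P1 \<sigma> p q \<longleftrightarrow> saddle u1 \<epsilon> \<sigma> p q"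
proof -
  have "dynkin_payoff M F U P1 \<sigma> a b \<omega> = ce (\<sigma> \<omega>) (stop_payoff u1 a b) \<omega>"
    if "a \<in> T \<sigma>" "b \<in> T \<sigma>" "\<omega> \<in> space M" for a b \<omega>
    by (rule dynkin_payoff1[OF assms T_stopping[OF that(1)] T_stopping[OF that(2)] that(3)])
  then show ?thesis by (simp add: saddle_def cong: conj_cong ball_cong)
qed

lemma saddle_point2:
  assumes "stopping_time F \<sigma>"
  shows "saddle_point M F U \<epsilon> P2 \<sigma> p q \<longleftrightarrow> saddle u2 \<epsilon> \<sigma> q p"
proof -
  have "dynkin_payoff M F U P2 \<sigma> a b \<omega> = ce (\<sigma> \<omega>) (stop_payoff u2 b a) \<omega>"
    if "a \<in> T \<sigma>" "b \<in> T \<sigma>" "\<omega> \<in> space M" for a b \<omega>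
    by (rule dynkin_payoff2[OF assms T_stopping[OF that(1)] T_stopping[OF that(2)] that(3)])
  then have "saddle_point M F U \<epsilon> P2 \<sigma> p q \<longleftrightarrow> p \<in> T \<sigma> \<and> q \<in> T \<sigma> \<and> (\<forall>b\<in>T \<sigma>. \<forall>a\<in>T \<sigma>. \<forall>\<omega>\<in>space M.
      ce (\<sigma> \<omega>) (stop_payoff u2 a p) \<omega> - \<epsilon> < ce (\<sigma> \<omega>) (stop_payoff u2 q p) \<omega> \<and>
      ce (\<sigma> \<omega>) (stop_payoff u2 q p) \<omega> < ce (\<sigma> \<omega>) (stop_payoff u2 q b) \<omega> + \<epsilon>)"
    by (simp cong: conj_cong ball_cong)
  then show ?thesis unfolding saddle_def by blast
qed

end

section \<open>Instantiating the deviation analysis for both players\<close>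

locale equilibrium_candidate = bounded_stopping_game M F U r C
  for M :: "'a measure" and F U r C +
  fixes \<epsilon> h :: real and rb tb :: "player \<Rightarrow> nat \<Rightarrow> 'a stime"
  assumes \<epsilon>_pos: "0 < \<epsilon>" and h_pos: "0 < h"
    and optimizers: "grid_optimizers M F U \<epsilon> h rb tb"
    and grid: "small_grid M F U r \<epsilon> h rb tb"
begin

abbreviation gr :: "(nat \<Rightarrow> 'a stime) \<Rightarrow> ennreal \<Rightarrow> 'a stime" where "gr \<equiv> grid_reaction h"

abbreviation \<mu>1 :: "'a stime" where "\<mu>1 \<equiv> mu M F U \<epsilon> h rb tb P1"

abbreviation \<mu>2 :: "'a stime" where "\<mu>2 \<equiv> mu M F U \<epsilon> h rb tb P2"

lemma rb_T: "rb i n \<in> T (\<lambda>_. ennreal (real n * h))"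
  and tb_T: "tb i n \<in> T (\<lambda>_. ennreal (real n * h))"
  using optimizers by (auto simp: grid_optimizers_def Let_def)

lemma gr_rb_T: "gr (rb i) t \<in> T (\<lambda>_. t)" and gr_tb_T: "gr (tb i) t \<in> T (\<lambda>_. t)"
  by (intro grid_reaction_T h_pos rb_T tb_T)+

lemma near:
  assumes \<omega>: "\<omega> \<in> space M"
  shows "\<bar>X_proc M F U i t \<omega> - ce t (\<lambda>x. U i t (gr (tb i) t x) x) \<omega>\<bar> \<le> 2 * \<epsilon>"
    and "\<bar>Y_proc M F U i t \<omega> - ce t (\<lambda>x. U i (gr (rb i) t x) t x) \<omega>\<bar> \<le> 2 * \<epsilon>"
proof -
  note st = stopping_time_const[of F t] T_stopping[OF gr_rb_T, of i t] T_stopping[OF gr_tb_T, of i t]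
  have n: "nice (\<lambda>x. U i t (gr (tb i) t x) x)" "nice (\<lambda>x. U i (gr (rb i) t x) t x)"
    using G1.nice_u[OF st(1,3)] G1.nice_u[OF st(2,1)] G2.nice_u[OF st(3,1)] G2.nice_u[OF st(1,2)]
    by (cases i; simp)+
  have c: "(\<lambda>_. t) \<in> stopping_times F" using st(1) by (simp add: stopping_times_def)
  note * = bspec[OF bspec[OF bspec[OF spec[OF conjunct2[OF grid[unfolded small_grid_def]], of i] c] c] \<omega>]
  show "\<bar>X_proc M F U i t \<omega> - ce t (\<lambda>x. U i t (gr (tb i) t x) x) \<omega>\<bar> \<le> 2 * \<epsilon>"
    using conjunct1[OF *] unfolding cond_at_eq_ce[OF st(1) n(1) \<omega>] .
  show "\<bar>Y_proc M F U i t \<omega> - ce t (\<lambda>x. U i (gr (rb i) t x) t x) \<omega>\<bar> \<le> 2 * \<epsilon>"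
    using conjunct2[OF *] unfolding cond_at_eq_ce[OF st(1) n(2) \<omega>] .
qed

lemma \<mu>1_eq: "\<omega> \<in> space M \<Longrightarrow> stop_now u1 \<epsilon> (gr (tb P2)) \<omega> = \<mu>1 \<omega>"
  unfolding stop_now_def mu_def react_value_def
  by (simp only: W_proc.simps dynkin_value1 real_cond_exp_eq_ce G1.nice_u1 T_stopping[OF gr_tb_T])

lemma \<mu>2_eq: "\<omega> \<in> space M \<Longrightarrow> stop_now u2 \<epsilon> (gr (rb P1)) \<omega> = \<mu>2 \<omega>"
  unfolding stop_now_def mu_def react_value_def
  by (simp only: W_proc.simps dynkin_value2 real_cond_exp_eq_ce G2.nice_u1 T_stopping[OF gr_rb_T])

lemma \<mu>1_stopping: "stopping_time F \<mu>1"
  using G1.stop_now_stopping[of \<epsilon> "gr (tb P2)"] stopping_time_cong_space[OF \<mu>1_eq] by simp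

lemma \<mu>2_stopping: "stopping_time F \<mu>2"
  using G2.stop_now_stopping[of \<epsilon> "gr (rb P1)"] stopping_time_cong_space[OF \<mu>2_eq] by simp

text \<open>Player 1 deviates: player 2 reacts selfishly by \<open>tb P2\<close> and punishes by
  \<open>tb P1\<close>, which nearly minimizes the payoff of player 1.\<close>

sublocale S1: stopping_candidate M F u1 r C \<epsilon> "gr (tb P2)" "gr (tb P1)" "gr (rb P1)" \<mu>2 "\<lambda>\<omega>. \<mu>1 \<omega> \<le> \<mu>2 \<omega>"
proof unfold_locales
  fix t \<omega> assume \<omega>: "\<omega> \<in> space M"
  show "ce t (\<lambda>x. u1 t (gr (tb P1) t x) x) \<omega> \<le> lowX u1 t \<omega> + 2 * \<epsilon>"
    "uppY u1 t \<omega> - 2 * \<epsilon> \<le> ce t (\<lambda>x. u1 (gr (rb P1) t x) t x) \<omega>"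
    using near[OF \<omega>, of P1 t] unfolding X1[OF \<omega>] Y1[OF \<omega>] by linarith+
next
  fix \<omega> \<omega>' assume "\<omega> \<in> space M" "\<omega>' \<in> atom (min (stop_now u1 \<epsilon> (gr (tb P2)) \<omega>) (\<mu>2 \<omega>)) \<omega>"
  then show "(\<mu>1 \<omega>' \<le> \<mu>2 \<omega>') = (\<mu>1 \<omega> \<le> \<mu>2 \<omega>)"
    by (intro le_atom[OF \<mu>1_stopping \<mu>2_stopping]) (simp_all add: \<mu>1_eq)
qed (auto simp: \<mu>1_eq \<epsilon>_pos gr_rb_T gr_tb_T \<mu>2_stopping intro: grid_reaction_step h_pos)

text \<open>Player 2 deviates, with exchanged arguments. A tie of \<mu>1 and \<mu>2 belongs to the
  event of player 1, so the inequality is strict and the two events are complementary.\<close>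

sublocale S2: stopping_candidate M F u2 r C \<epsilon> "gr (rb P1)" "gr (rb P2)" "gr (tb P2)" \<mu>1 "\<lambda>\<omega>. \<mu>2 \<omega> < \<mu>1 \<omega>"
proof unfold_locales
  fix t \<omega> assume \<omega>: "\<omega> \<in> space M"
  show "ce t (\<lambda>x. u2 t (gr (rb P2) t x) x) \<omega> \<le> lowX u2 t \<omega> + 2 * \<epsilon>"
    "uppY u2 t \<omega> - 2 * \<epsilon> \<le> ce t (\<lambda>x. u2 (gr (tb P2) t x) t x) \<omega>"
    using near[OF \<omega>, of P2 t] unfolding X2[OF \<omega>] Y2[OF \<omega>] by linarith+
next
  fix \<omega> \<omega>' assume "\<omega> \<in> space M" "\<omega>' \<in> atom (min (stop_now u2 \<epsilon> (gr (rb P1)) \<omega>) (\<mu>1 \<omega>)) \<omega>"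
  then have "(\<mu>1 \<omega>' \<le> \<mu>2 \<omega>') = (\<mu>1 \<omega> \<le> \<mu>2 \<omega>)"
    by (intro le_atom[OF \<mu>1_stopping \<mu>2_stopping]) (simp_all add: \<mu>2_eq min.commute)
  then show "(\<mu>2 \<omega>' < \<mu>1 \<omega>') = (\<mu>2 \<omega> < \<mu>1 \<omega>)" by (simp add: not_le[symmetric])
qed (auto simp: \<mu>2_eq \<epsilon>_pos gr_rb_T gr_tb_T \<mu>1_stopping intro: grid_reaction_step h_pos)

end

lemma le_of_add_le: "t + d \<le> s \<Longrightarrow> t \<le> (s::ennreal)"
  by (rule order_trans[OF add_increasing2]) auto

context countable_filtered_space
begin

text \<open>At a fixed time t the switching condition is decided by t, because \<open>m\<close> has
  passed whenever it holds; both branches react after t, so the switch does not look ahead.\<close>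

lemma switched_reaction:
  assumes h: "0 < h" and m: "stopping_time F m"
    and E: "\<And>\<omega> \<omega>'. \<omega> \<in> space M \<Longrightarrow> \<omega>' \<in> atom (m \<omega>) \<omega> \<Longrightarrow> E \<omega>' = E \<omega>"
    and b: "\<And>n. b n \<in> T (\<lambda>_. ennreal (real n * h))" "\<And>n. b' n \<in> T (\<lambda>_. ennreal (real n * h))"
  shows "(\<lambda>t \<omega>. if t \<ge> m \<omega> + ennreal \<delta> \<and> E \<omega> then grid_reaction h b t \<omega> else grid_reaction h b' t \<omega>)
    \<in> reactions M F"
proof -
  note [measurable] = measurable_grid_reaction[OF h b(1)] measurable_grid_reaction[OF h b(2)]
  have [measurable]: "m \<in> borel_measurable M"
    using measurable_stopping_time[OF m sets_F_subset] space_F by simp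
  have E': "E \<omega>' = E \<omega>" if "\<omega> \<in> space M" "m \<omega> \<le> t" "\<omega>' \<in> atom t \<omega>" for \<omega> \<omega>' t
    using E[OF that(1)] atom_antimono[OF that(2)] that(3) by blast
  have [measurable]: "Measurable.pred M E"
    unfolding pred_def sets_M_iff using E' atom_space by (auto intro: top_greatest)
  have "(\<lambda>p. if fst p \<ge> m (snd p) + ennreal \<delta> \<and> E (snd p)
      then grid_reaction h b (fst p) (snd p) else grid_reaction h b' (fst p) (snd p)) \<in> borel \<Otimes>\<^sub>M M \<rightarrow>\<^sub>M borel"
    by measurable
  moreover have "(\<lambda>\<omega>. if t \<ge> m \<omega> + ennreal \<delta> \<and> E \<omega> then grid_reaction h b t \<omega> else grid_reaction h b' t \<omega>)
      \<in> stopping_times_after M F (\<lambda>_. t)" if t: "t < \<infinity>" for t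
  proof -
    note g = grid_reaction_after[OF h b(1) t] grid_reaction_after[OF h b(2) t]
    have imp: "m \<omega>' + ennreal \<delta> \<le> t \<and> E \<omega>'"
      if "\<omega> \<in> space M" "m \<omega> + ennreal \<delta> \<le> t \<and> E \<omega>" "\<omega>' \<in> atom t \<omega>" for \<omega> \<omega>'
    proof -
      have "m \<omega> \<le> t" using that(2) by (auto elim: order_trans[rotated])
      then show ?thesis using stopping_time_atom_late[OF m that(1) _ that(3)] E'[OF that(1) _ that(3)] that(2) by auto
    qed
    have "stopping_time F (\<lambda>\<omega>. if t \<ge> m \<omega> + ennreal \<delta> \<and> E \<omega> then grid_reaction h b t \<omega> else grid_reaction h b' t \<omega>)"
    proof (rule stopping_time_if[OF stopping_time_const[of F t]])
      fix \<omega> \<omega>' assume \<omega>: "\<omega> \<in> space M" "\<omega>' \<in> atom t \<omega>"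
      show "(m \<omega>' + ennreal \<delta> \<le> t \<and> E \<omega>') = (m \<omega> + ennreal \<delta> \<le> t \<and> E \<omega>)"
        using imp[OF \<omega>(1) _ \<omega>(2)] imp[OF atom_space[OF \<omega>(2)] _ atom_sym[OF \<omega>]] by blast
    qed (use g in \<open>auto simp: stopping_times_after_def less_imp_le\<close>)
    then show ?thesis using g by (auto simp: stopping_times_after_def)
  qed
  ultimately show ?thesis by (simp add: reactions_def case_prod_beta')
qed

end

section \<open>The candidate strategies and their payoffs\<close>

context equilibrium_candidate
begin

abbreviation \<rho>s :: "real \<Rightarrow> 'a stime \<Rightarrow> 'a strategy" where "\<rho>s \<equiv> rho_star h rb \<mu>1 \<mu>2"

abbreviation \<tau>s :: "real \<Rightarrow> 'a stime \<Rightarrow> 'a strategy" where "\<tau>s \<equiv> tau_star h tb \<mu>1 \<mu>2"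

lemma \<mu>1_le_\<mu>2_atom:
  "\<omega> \<in> space M \<Longrightarrow> \<omega>' \<in> atom (min (\<mu>1 \<omega>) (\<mu>2 \<omega>)) \<omega> \<Longrightarrow> (\<mu>1 \<omega>' \<le> \<mu>2 \<omega>') = (\<mu>1 \<omega> \<le> \<mu>2 \<omega>)"
  by (rule le_atom[OF \<mu>1_stopping \<mu>2_stopping])

lemma \<mu>_min_stopping: "stopping_time F (\<lambda>\<omega>. min (\<mu>1 \<omega>) (\<mu>2 \<omega>))"
  by (rule stopping_time_min[OF \<mu>1_stopping \<mu>2_stopping])

lemma rho_star_strategy:
  assumes "sr \<in> T (\<lambda>\<omega>. \<mu>2 \<omega> + ennreal \<delta>)"
  shows "\<rho>s \<delta> sr \<in> strategies M F"
proof -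
  have "\<mu>2 \<omega> \<le> sr \<omega>" if "\<omega> \<in> space M" for \<omega>
    using assms that by (auto simp: T_iff intro: le_of_add_le)
  then have "stopping_time F (\<lambda>\<omega>. if \<mu>1 \<omega> \<le> \<mu>2 \<omega> then \<mu>1 \<omega> else sr \<omega>)"
    by (intro stopping_time_if[OF \<mu>_min_stopping \<mu>1_stopping T_stopping[OF assms] \<mu>1_le_\<mu>2_atom])
       (auto simp: min_le_iff_disj)
  moreover have "(\<mu>1 \<omega>' > \<mu>2 \<omega>') = (\<mu>1 \<omega> > \<mu>2 \<omega>)"
    if "\<omega> \<in> space M" "\<omega>' \<in> atom (min (\<mu>1 \<omega>) (\<mu>2 \<omega>)) \<omega>" for \<omega> \<omega>'
    using \<mu>1_le_\<mu>2_atom[OF that] by (simp add: not_le[symmetric])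
  ultimately show ?thesis
    unfolding rho_star_def strategies_def
    by (intro SigmaI switched_reaction h_pos \<mu>_min_stopping rb_T) (auto simp: stopping_times_def)
qed

lemma tau_star_strategy:
  assumes "st \<in> T (\<lambda>\<omega>. \<mu>1 \<omega> + ennreal \<delta>)"
  shows "\<tau>s \<delta> st \<in> strategies M F"
proof -
  have "\<mu>1 \<omega> \<le> st \<omega>" if "\<omega> \<in> space M" for \<omega>
    using assms that by (auto simp: T_iff intro: le_of_add_le)
  then have "stopping_time F (\<lambda>\<omega>. if \<mu>1 \<omega> \<le> \<mu>2 \<omega> then st \<omega> else \<mu>2 \<omega>)"
    by (intro stopping_time_if[OF \<mu>_min_stopping T_stopping[OF assms] \<mu>2_stopping \<mu>1_le_\<mu>2_atom])
       (auto simp: min_le_iff_disj)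
  then show ?thesis
    unfolding tau_star_def strategies_def
    by (intro SigmaI switched_reaction h_pos \<mu>_min_stopping tb_T \<mu>1_le_\<mu>2_atom) (auto simp: stopping_times_def)
qed

lemma plus_\<delta>:
  assumes "t + ennreal \<delta> \<le> s" "0 < \<delta>"
  shows "t \<le> s" "t < \<infinity> \<Longrightarrow> t < s" "t < \<infinity> \<Longrightarrow> \<not> t + ennreal \<delta> \<le> t"
proof -
  have *: "t < \<infinity> \<Longrightarrow> t < t + ennreal \<delta>" by (rule less_add_ennreal[OF _ assms(2)])
  show "t \<le> s" using assms(1) by (rule le_of_add_le)
  show "t < \<infinity> \<Longrightarrow> t < s" using * assms(1) by (rule order_less_le_trans)
  show "t < \<infinity> \<Longrightarrow> \<not> t + ennreal \<delta> \<le> t" using * by (simp only: not_le)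
qed

text \<open>A positive \<delta> puts the saddle time strictly after a finite first stop and keeps
  the punishment inactive at that stop, so the selfish reaction is the one realized.\<close>

lemma equilibrium_realized:
  assumes \<omega>: "\<omega> \<in> space M" and \<delta>: "0 < \<delta>"
    and sr: "sr \<in> T (\<lambda>\<omega>. \<mu>2 \<omega> + ennreal \<delta>)" and st: "st \<in> T (\<lambda>\<omega>. \<mu>1 \<omega> + ennreal \<delta>)"
  shows "\<mu>1 \<omega> \<le> \<mu>2 \<omega> \<Longrightarrow> realized (\<rho>s \<delta> sr) (\<tau>s \<delta> st) \<omega> = \<mu>1 \<omega> \<and>
      realized (\<tau>s \<delta> st) (\<rho>s \<delta> sr) \<omega> = gr (tb P2) (\<mu>1 \<omega>) \<omega>"
    and "\<mu>2 \<omega> < \<mu>1 \<omega> \<Longrightarrow> realized (\<rho>s \<delta> sr) (\<tau>s \<delta> st) \<omega> = gr (rb P1) (\<mu>2 \<omega>) \<omega> \<and>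
      realized (\<tau>s \<delta> st) (\<rho>s \<delta> sr) \<omega> = \<mu>2 \<omega>"
proof -
  have s: "\<mu>2 \<omega> + ennreal \<delta> \<le> sr \<omega>" "\<mu>1 \<omega> + ennreal \<delta> \<le> st \<omega>" using sr st \<omega> by (auto simp: T_iff)
  note p1 = plus_\<delta>[OF s(2) \<delta>] and p2 = plus_\<delta>[OF s(1) \<delta>]
  show "realized (\<rho>s \<delta> sr) (\<tau>s \<delta> st) \<omega> = \<mu>1 \<omega> \<and>
      realized (\<tau>s \<delta> st) (\<rho>s \<delta> sr) \<omega> = gr (tb P2) (\<mu>1 \<omega>) \<omega>" if le: "\<mu>1 \<omega> \<le> \<mu>2 \<omega>"
  proof (cases "\<mu>1 \<omega> < \<infinity>")
    case True
    then have "\<not> st \<omega> \<le> \<mu>1 \<omega>" using p1(2) by simp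
    then show ?thesis
      using p1(1) p1(3)[OF True] le by (simp add: realized_def rho_star_def tau_star_def min_absorb1)
  next
    case False
    \<comment> \<open>At an infinite first stop the strict order is lost, but the saddle time and
      the reaction are infinite too, so the formula persists.\<close>
    then have "\<mu>1 \<omega> = top" using top.not_eq_extremum unfolding infinity_ennreal_def by blast
    then show ?thesis
      using p1(1) le by (simp add: realized_def rho_star_def tau_star_def top_unique grid_reaction_def)
  qed
  show "realized (\<rho>s \<delta> sr) (\<tau>s \<delta> st) \<omega> = gr (rb P1) (\<mu>2 \<omega>) \<omega> \<and>
      realized (\<tau>s \<delta> st) (\<rho>s \<delta> sr) \<omega> = \<mu>2 \<omega>" if less: "\<mu>2 \<omega> < \<mu>1 \<omega>"
  proof -
    have fin: "\<mu>2 \<omega> < \<infinity>" using less by (auto intro: order_less_le_trans)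
    have "\<not> sr \<omega> \<le> \<mu>2 \<omega>" "\<not> \<mu>1 \<omega> \<le> \<mu>2 \<omega>" using p2(2)[OF fin] less by simp_all
    then show ?thesis
      using p2(1) p2(3)[OF fin] less
      by (simp add: realized_def rho_star_def tau_star_def min_absorb2 less_imp_le)
  qed
qed

lemma equilibrium_payoff1:
  assumes "0 < \<delta>" "sr \<in> T (\<lambda>\<omega>. \<mu>2 \<omega> + ennreal \<delta>)" "st \<in> T (\<lambda>\<omega>. \<mu>1 \<omega> + ennreal \<delta>)"
  shows "expected_payoff M U P1 (\<rho>s \<delta> sr) (\<tau>s \<delta> st) = (\<integral>\<omega>. S1.eq \<omega> \<partial>M)"
  unfolding expected_payoff_def
proof (rule Bochner_Integration.integral_cong[OF refl])
  fix \<omega> assume \<omega>: "\<omega> \<in> space M"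
  note e = equilibrium_realized[OF \<omega> assms]
  show "U P1 (realized (\<rho>s \<delta> sr) (\<tau>s \<delta> st) \<omega>) (realized (\<tau>s \<delta> st) (\<rho>s \<delta> sr) \<omega>) \<omega> = S1.eq \<omega>"
    using e by (cases "\<mu>1 \<omega> \<le> \<mu>2 \<omega>") (simp_all add: S1.eq_def \<mu>1_eq[OF \<omega>])
qed

lemma equilibrium_payoff2:
  assumes "0 < \<delta>" "sr \<in> T (\<lambda>\<omega>. \<mu>2 \<omega> + ennreal \<delta>)" "st \<in> T (\<lambda>\<omega>. \<mu>1 \<omega> + ennreal \<delta>)"
  shows "expected_payoff M U P2 (\<rho>s \<delta> sr) (\<tau>s \<delta> st) = (\<integral>\<omega>. S2.eq \<omega> \<partial>M)"
  unfolding expected_payoff_def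
proof (rule Bochner_Integration.integral_cong[OF refl])
  fix \<omega> assume \<omega>: "\<omega> \<in> space M"
  note e = equilibrium_realized[OF \<omega> assms]
  show "U P2 (realized (\<rho>s \<delta> sr) (\<tau>s \<delta> st) \<omega>) (realized (\<tau>s \<delta> st) (\<rho>s \<delta> sr) \<omega>) \<omega> = S2.eq \<omega>"
  proof (cases "\<mu>2 \<omega> < \<mu>1 \<omega>")
    case True
    then show ?thesis using e(2) by (simp add: S2.eq_def \<mu>2_eq[OF \<omega>])
  next
    case False
    then have "\<mu>1 \<omega> \<le> \<mu>2 \<omega>" by simp
    then show ?thesis using e(1) False by (simp add: S2.eq_def)
  qed
qed

lemma deviation_payoff1:
  "expected_payoff M U P1 \<rho> (\<tau>s \<delta> st) = (\<integral>\<omega>. S1.dev \<delta> st (fst \<rho>) (snd \<rho>) \<omega> \<partial>M)"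
  unfolding expected_payoff_def
proof (rule Bochner_Integration.integral_cong[OF refl])
  fix \<omega> assume \<omega>: "\<omega> \<in> space M"
  show "U P1 (realized \<rho> (\<tau>s \<delta> st) \<omega>) (realized (\<tau>s \<delta> st) \<rho> \<omega>) \<omega> = S1.dev \<delta> st (fst \<rho>) (snd \<rho>) \<omega>"
  proof -
    define t0 where "t0 = (if \<mu>1 \<omega> \<le> \<mu>2 \<omega> then st \<omega> else \<mu>2 \<omega>)"
    have t0: "fst (\<tau>s \<delta> st) \<omega> = t0" "(if \<mu>1 \<omega> \<le> \<mu>2 \<omega> then st \<omega> else \<mu>2 \<omega>) = t0"
      by (auto simp: t0_def tau_star_def)
    have m: "S1.m \<omega> = min (\<mu>1 \<omega>) (\<mu>2 \<omega>)" by (simp add: S1.m_def \<mu>1_eq[OF \<omega>] min.commute)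
    consider "fst \<rho> \<omega> < t0" | "fst \<rho> \<omega> = t0" | "t0 < fst \<rho> \<omega>" by (rule linorder_cases)
    then show ?thesis
    proof cases
      case 1
      then have "\<not> t0 \<le> fst \<rho> \<omega>" "fst \<rho> \<omega> \<le> t0" by simp_all
      with 1 show ?thesis
        by (simp only: realized_def S1.dev_def Let_def t0 m if_True if_False) (simp only: tau_star_def snd_conv)
    next
      case 2
      then show ?thesis by (simp only: realized_def S1.dev_def Let_def t0 m order_refl less_irrefl if_True if_False)
    next
      case 3
      then have "\<not> fst \<rho> \<omega> \<le> t0" "t0 \<le> fst \<rho> \<omega>" "\<not> fst \<rho> \<omega> < t0" by simp_all
      with 3 show ?thesis by (simp only: realized_def S1.dev_def Let_def t0 m if_True if_False)
    qed
  qed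
qed

lemma deviation_payoff2:
  "expected_payoff M U P2 (\<rho>s \<delta> sr) \<tau> = (\<integral>\<omega>. S2.dev \<delta> sr (fst \<tau>) (snd \<tau>) \<omega> \<partial>M)"
  unfolding expected_payoff_def
proof (rule Bochner_Integration.integral_cong[OF refl])
  fix \<omega> assume \<omega>: "\<omega> \<in> space M"
  show "U P2 (realized (\<rho>s \<delta> sr) \<tau> \<omega>) (realized \<tau> (\<rho>s \<delta> sr) \<omega>) \<omega> = S2.dev \<delta> sr (fst \<tau>) (snd \<tau>) \<omega>"
  proof -
    define t0 where "t0 = (if \<mu>1 \<omega> \<le> \<mu>2 \<omega> then \<mu>1 \<omega> else sr \<omega>)"
    have t0: "fst (\<rho>s \<delta> sr) \<omega> = t0" "(if \<mu>2 \<omega> < \<mu>1 \<omega> then sr \<omega> else \<mu>1 \<omega>) = t0"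
      by (auto simp: t0_def rho_star_def)
    have m: "S2.m \<omega> = min (\<mu>1 \<omega>) (\<mu>2 \<omega>)" by (simp add: S2.m_def \<mu>2_eq[OF \<omega>] min.commute)
    consider "fst \<tau> \<omega> < t0" | "fst \<tau> \<omega> = t0" | "t0 < fst \<tau> \<omega>" by (rule linorder_cases)
    then show ?thesis
    proof cases
      case 1
      then have "\<not> t0 \<le> fst \<tau> \<omega>" "fst \<tau> \<omega> \<le> t0" by simp_all
      with 1 show ?thesis
        by (simp only: realized_def S2.dev_def Let_def t0 m if_True if_False) (simp only: rho_star_def snd_conv)
    next
      case 2
      then show ?thesis by (simp only: realized_def S2.dev_def Let_def t0 m order_refl less_irrefl if_True if_False)
    next
      case 3
      then have "\<not> fst \<tau> \<omega> \<le> t0" "t0 \<le> fst \<tau> \<omega>" "\<not> fst \<tau> \<omega> < t0" by simp_all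
      with 3 show ?thesis by (simp only: realized_def S2.dev_def Let_def t0 m if_True if_False)
    qed
  qed
qed

lemma \<mu>1_plus_stopping: "stopping_time F (\<lambda>\<omega>. \<mu>1 \<omega> + ennreal \<delta>)"
  by (rule iffD1[OF stopping_time_cong_space S1.m1_plus_stopping[of \<delta>]]) (simp add: \<mu>1_eq)

lemma \<mu>2_plus_stopping: "stopping_time F (\<lambda>\<omega>. \<mu>2 \<omega> + ennreal \<delta>)"
  by (rule iffD1[OF stopping_time_cong_space S2.m1_plus_stopping[of \<delta>]]) (simp add: \<mu>2_eq)

lemma saddle_point_S1: "saddle_point M F U \<epsilon> P1 (\<lambda>\<omega>. \<mu>1 \<omega> + ennreal \<delta>) sr st \<longleftrightarrow>
    saddle u1 \<epsilon> (\<lambda>\<omega>. S1.m1 \<omega> + ennreal \<delta>) sr st"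
  unfolding saddle_point1[OF \<mu>1_plus_stopping] by (rule saddle_cong) (simp add: \<mu>1_eq)

lemma saddle_point_S2: "saddle_point M F U \<epsilon> P2 (\<lambda>\<omega>. \<mu>2 \<omega> + ennreal \<delta>) sr st \<longleftrightarrow>
    saddle u2 \<epsilon> (\<lambda>\<omega>. S2.m1 \<omega> + ennreal \<delta>) st sr"
  unfolding saddle_point2[OF \<mu>2_plus_stopping] by (rule saddle_cong) (simp add: \<mu>2_eq)

lemma saddle_points_exist:
  "\<exists>sr st. saddle_point M F U \<epsilon> i (\<lambda>\<omega>. mu M F U \<epsilon> h rb tb i \<omega> + ennreal \<delta>) sr st"
proof (cases i)
  case P1
  then show ?thesis
    using G1.saddle_exists[OF \<mu>1_plus_stopping \<epsilon>_pos] saddle_point1[OF \<mu>1_plus_stopping] by blast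
next
  case P2
  then show ?thesis
    using G2.saddle_exists[OF \<mu>2_plus_stopping \<epsilon>_pos] saddle_point2[OF \<mu>2_plus_stopping] by blast
qed

text \<open>The bounds for the two players hold for all small \<delta> uniformly in saddle points
  and deviations, hence together on a common interval.\<close>

lemma candidate_is_nash_equilibrium:
  assumes saddle: "\<And>i \<delta>. 0 < \<delta> \<Longrightarrow>
    saddle_point M F U \<epsilon> i (\<lambda>\<omega>. mu M F U \<epsilon> h rb tb i \<omega> + ennreal \<delta>) (sr i \<delta>) (st i \<delta>)"
  shows "\<exists>\<delta>0>0. \<forall>\<delta>. 0 < \<delta> \<and> \<delta> < \<delta>0 \<longrightarrow>
    nash_equilibrium M F U (18 * \<epsilon>) (\<rho>s \<delta> (sr P2 \<delta>)) (\<tau>s \<delta> (st P1 \<delta>))"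
proof -
  have strat: "stopping_time F (fst \<rho>)" "\<forall>t<\<infinity>. snd \<rho> t \<in> T (\<lambda>_. t)" if "\<rho> \<in> strategies M F" for \<rho>
    using that after_in_T by (auto simp: strategies_def stopping_times_def reactions_def)
  have "\<forall>\<^sub>F \<delta> in at_right 0. nash_equilibrium M F U (18 * \<epsilon>) (\<rho>s \<delta> (sr P2 \<delta>)) (\<tau>s \<delta> (st P1 \<delta>))"
    using S1.deviation_bound S2.deviation_bound eventually_at_right_less[of "0::real"]
  proof eventually_elim
    case (elim \<delta>)
    note s = saddle[OF elim(3), of P1] saddle[OF elim(3), of P2]
    then have sT: "sr P2 \<delta> \<in> T (\<lambda>\<omega>. \<mu>2 \<omega> + ennreal \<delta>)" "st P1 \<delta> \<in> T (\<lambda>\<omega>. \<mu>1 \<omega> + ennreal \<delta>)"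
      by simp_all
    note s' = s[unfolded saddle_point_S1 saddle_point_S2]
    show ?case
      unfolding nash_equilibrium_def
    proof (intro conjI ballI rho_star_strategy tau_star_strategy sT)
      fix \<rho> assume *: "\<rho> \<in> strategies M F"
      show "expected_payoff M U P1 \<rho> (\<tau>s \<delta> (st P1 \<delta>)) \<le>
          expected_payoff M U P1 (\<rho>s \<delta> (sr P2 \<delta>)) (\<tau>s \<delta> (st P1 \<delta>)) + 18 * \<epsilon>"
        unfolding equilibrium_payoff1[OF elim(3) sT] deviation_payoff1[of \<rho>]
        using elim(1) s'(1) strat[OF *] by blast
    next
      fix \<tau> assume *: "\<tau> \<in> strategies M F"
      show "expected_payoff M U P2 (\<rho>s \<delta> (sr P2 \<delta>)) \<tau> \<le>
          expected_payoff M U P2 (\<rho>s \<delta> (sr P2 \<delta>)) (\<tau>s \<delta> (st P1 \<delta>)) + 18 * \<epsilon>"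
        unfolding equilibrium_payoff2[OF elim(3) sT] deviation_payoff2[of _ _ \<tau>]
        using elim(2) s'(2) strat[OF *] by blast
    qed
  qed
  then show ?thesis unfolding eventually_at_right_field by blast
qed

end

section \<open>Existence of a grid with near-optimizers, and the conclusion\<close>

lemma (in bounded_stopping_game) candidate_exists:
  assumes "0 < \<epsilon>"
  obtains h rb tb where "equilibrium_candidate M F U r C \<epsilon> h rb tb"
proof -
  have "0 < \<epsilon> / 3" using assms by simp
  then obtain d :: real where d: "0 < d" "\<And>x. x \<le> ennreal d \<Longrightarrow> r x < \<epsilon> / 3"
    using G1.r_small by blast
  \<comment> \<open>The error estimate for grid reactions evaluates the modulus at
    \<open>2 * h\<close>.\<close>
  define h where "h = d / 2"
  have h: "0 < h" using d by (simp add: h_def)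
  have "2 * ennreal h = ennreal d" using d(1) by (simp add: h_def ennreal_mult'[symmetric] flip: ennreal_numeral)
  then have rh: "r (2 * ennreal h) < \<epsilon> / 3" using d(2) by simp
  have rh1: "r (ennreal h) < \<epsilon> / 3" using d by (intro d(2) ennreal_leI) (simp add: h_def)
  let ?t = "\<lambda>n. ennreal (real n * h)"
  obtain tb1 where tb1: "\<And>n. tb1 n \<in> T (\<lambda>_. ?t n)"
    "\<And>n \<omega>. \<omega> \<in> space M \<Longrightarrow> ce (?t n) (\<lambda>x. u1 (?t n) (tb1 n x) x) \<omega> \<le> lowX u1 (?t n) \<omega> + \<epsilon>"
    using G1.lowX_near_family[OF assms, of ?t] by blast
  obtain rb2 where rb2: "\<And>n. rb2 n \<in> T (\<lambda>_. ?t n)"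
    "\<And>n \<omega>. \<omega> \<in> space M \<Longrightarrow> ce (?t n) (\<lambda>x. u2 (?t n) (rb2 n x) x) \<omega> \<le> lowX u2 (?t n) \<omega> + \<epsilon>"
    using G2.lowX_near_family[OF assms, of ?t] by blast
  obtain rb1 where rb1: "\<And>n. rb1 n \<in> T (\<lambda>_. ?t n)"
    "\<And>n \<omega>. \<omega> \<in> space M \<Longrightarrow> uppY u1 (?t n) \<omega> - \<epsilon> \<le> ce (?t n) (\<lambda>x. u1 (rb1 n x) (?t n) x) \<omega>"
    using G1.uppY_near_family[OF assms, of ?t] by blast
  obtain tb2 where tb2: "\<And>n. tb2 n \<in> T (\<lambda>_. ?t n)"
    "\<And>n \<omega>. \<omega> \<in> space M \<Longrightarrow> uppY u2 (?t n) \<omega> - \<epsilon> \<le> ce (?t n) (\<lambda>x. u2 (tb2 n x) (?t n) x) \<omega>"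
    using G2.uppY_near_family[OF assms, of ?t] by blast
  define rb where "rb i = (case i of P1 \<Rightarrow> rb1 | P2 \<Rightarrow> rb2)" for i
  define tb where "tb i = (case i of P1 \<Rightarrow> tb1 | P2 \<Rightarrow> tb2)" for i
  have T: "rb i n \<in> T (\<lambda>_. ?t n)" "tb i n \<in> T (\<lambda>_. ?t n)" for i n
    by (cases i; simp add: rb_def tb_def rb1 rb2 tb1 tb2)+
  have nice: "stopping_time F \<sigma> \<Longrightarrow> stopping_time F \<tau> \<Longrightarrow> nice (\<lambda>\<omega>. U i (\<sigma> \<omega>) (\<tau> \<omega>) \<omega>)" for i \<sigma> \<tau>
    using G1.nice_u[of \<sigma> \<tau>] G2.nice_u[of \<tau> \<sigma>] by (cases i) simp_all
  have "grid_optimizers M F U \<epsilon> h rb tb"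
    unfolding grid_optimizers_def Let_def
  proof (intro allI conjI T ballI)
    fix i n \<omega> assume \<omega>: "\<omega> \<in> space M"
    have "real_cond_exp M (F (?t n)) (\<lambda>\<omega>. U i (rb i n \<omega>) (?t n) \<omega>) \<omega> = ce (?t n) (\<lambda>\<omega>. U i (rb i n \<omega>) (?t n) \<omega>) \<omega>"
      by (intro real_cond_exp_eq_ce nice T_stopping[OF T(1)] stopping_time_const \<omega>)
    then show "\<bar>real_cond_exp M (F (?t n)) (\<lambda>\<omega>. U i (rb i n \<omega>) (?t n) \<omega>) \<omega> - Y_proc M F U i (?t n) \<omega>\<bar> \<le> \<epsilon>"
      using rb1(2)[OF \<omega>, of n] G1.uppY_ge[OF \<omega> rb1(1)] rb2(2)[OF \<omega>, of n] G2.lowX_le[OF \<omega> rb2(1)] assms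
        Y1[OF \<omega>, of "?t n"] Y2[OF \<omega>, of "?t n"] by (cases i) (simp_all add: rb_def abs_le_iff)
    have "real_cond_exp M (F (?t n)) (\<lambda>\<omega>. U i (?t n) (tb i n \<omega>) \<omega>) \<omega> = ce (?t n) (\<lambda>\<omega>. U i (?t n) (tb i n \<omega>) \<omega>) \<omega>"
      by (intro real_cond_exp_eq_ce nice T_stopping[OF T(2)] stopping_time_const \<omega>)
    then show "\<bar>real_cond_exp M (F (?t n)) (\<lambda>\<omega>. U i (?t n) (tb i n \<omega>) \<omega>) \<omega> - X_proc M F U i (?t n) \<omega>\<bar> \<le> \<epsilon>"
      using tb2(2)[OF \<omega>, of n] G2.uppY_ge[OF \<omega> tb2(1)] tb1(2)[OF \<omega>, of n] G1.lowX_le[OF \<omega> tb1(1)] assms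
        X1[OF \<omega>, of "?t n"] X2[OF \<omega>, of "?t n"] by (cases i) (simp_all add: tb_def abs_le_iff)
  qed
  moreover have "small_grid M F U r \<epsilon> h rb tb"
    unfolding small_grid_def
  proof (intro conjI rh1 allI ballI)
    fix i \<rho>0 \<tau>0 \<omega> assume "\<rho>0 \<in> stopping_times F" "\<tau>0 \<in> stopping_times F" and \<omega>: "\<omega> \<in> space M"
    then have st: "stopping_time F \<rho>0" "stopping_time F \<tau>0" by (simp_all add: stopping_times_def)
    have near: "\<bar>X_proc M F U i t \<omega> - ce t (\<lambda>x. U i t (grid_reaction h (tb i) t x) x) \<omega>\<bar> \<le> 2 * \<epsilon>"
      "\<bar>Y_proc M F U i t \<omega> - ce t (\<lambda>x. U i (grid_reaction h (rb i) t x) t x) \<omega>\<bar> \<le> 2 * \<epsilon>" for t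
      using G1.grid_reaction_near_lowX[OF h rh \<omega> tb1] G2.grid_reaction_near_lowX[OF h rh \<omega> rb2]
        G1.grid_reaction_near_uppY[OF h rh \<omega> rb1] G2.grid_reaction_near_uppY[OF h rh \<omega> tb2]
        X1[OF \<omega>] X2[OF \<omega>] Y1[OF \<omega>] Y2[OF \<omega>] by (cases i; simp add: rb_def tb_def)+
    \<comment> \<open>On the atom at \<sigma> the random time may be frozen at its value; this
      carries the estimate at fixed times over to stopping times.\<close>
    have cond: "cond_at M F \<sigma> (\<lambda>x. f (\<sigma> x) x) \<omega> = ce (\<sigma> \<omega>) (f (\<sigma> \<omega>)) \<omega>"
      if \<sigma>: "stopping_time F \<sigma>" and f: "\<And>t. nice (f t)" "\<And>t x. x \<in> space M \<Longrightarrow> \<bar>f t x\<bar> \<le> C" for \<sigma> f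
    proof -
      have "nice (\<lambda>x. f (\<sigma> x) x)"
      proof (rule niceI[OF _ f(2)])
        fix x y assume *: "x \<in> space M" "y \<in> atom \<infinity> x"
        show "f (\<sigma> y) y = f (\<sigma> x) x"
          using nice_atom[OF f(1) *] stopping_time_atom_late[OF \<sigma> *(1) _ *(2)] by simp
      qed
      then have "cond_at M F \<sigma> (\<lambda>x. f (\<sigma> x) x) \<omega> = ce (\<sigma> \<omega>) (\<lambda>x. f (\<sigma> x) x) \<omega>"
        by (intro cond_at_eq_ce \<sigma> \<omega>)
      also have "\<dots> = ce (\<sigma> \<omega>) (f (\<sigma> \<omega>)) \<omega>"
        using stopping_time_atom[OF \<sigma> \<omega>] by (intro ce_cong) simp
      finally show ?thesis .
    qed
    have bounded: "\<bar>U i s t x\<bar> \<le> C" if "x \<in> space M" for s t x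
      using G1.u_bounded[OF that] G2.u_bounded[OF that] by (cases i) auto
    note g = T_stopping[OF grid_reaction_T[OF h T(1)]] T_stopping[OF grid_reaction_T[OF h T(2)]]
    show "\<bar>X_proc M F U i (\<rho>0 \<omega>) \<omega> -
        cond_at M F \<rho>0 (\<lambda>\<omega>. U i (\<rho>0 \<omega>) (grid_reaction h (tb i) (\<rho>0 \<omega>) \<omega>) \<omega>) \<omega>\<bar> \<le> 2 * \<epsilon>"
      using near(1)[of "\<rho>0 \<omega>"] cond[OF st(1), of "\<lambda>t x. U i t (grid_reaction h (tb i) t x) x"]
        nice[OF stopping_time_const g(2)] bounded by simp
    show "\<bar>Y_proc M F U i (\<tau>0 \<omega>) \<omega> -
        cond_at M F \<tau>0 (\<lambda>\<omega>. U i (grid_reaction h (rb i) (\<tau>0 \<omega>) \<omega>) (\<tau>0 \<omega>) \<omega>) \<omega>\<bar> \<le> 2 * \<epsilon>"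
      using near(2)[of "\<tau>0 \<omega>"] cond[OF st(2), of "\<lambda>t x. U i (grid_reaction h (rb i) t x) t x"]
        nice[OF g(1) stopping_time_const] bounded by simp
  qed
  ultimately show ?thesis
    using assms h by (intro that) (unfold_locales, auto)
qed

theorem proposition4p2:
  fixes M :: "'a measure" and F :: "ennreal \<Rightarrow> 'a measure" and U :: "'a payoff"
    and r :: "ennreal \<Rightarrow> real"
  assumes "stopping_game M F U"
    and "payoff_modulus M U r"
  shows "(\<forall>\<epsilon>>0. \<forall>h>0. \<forall>rb tb sr st.
      grid_optimizers M F U \<epsilon> h rb tb \<and>
      small_grid M F U r \<epsilon> h rb tb \<and>
      (\<forall>i. \<forall>\<delta>>0. saddle_point M F U \<epsilon> i (\<lambda>\<omega>. mu M F U \<epsilon> h rb tb i \<omega> + ennreal \<delta>) (sr i \<delta>) (st i \<delta>))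
      \<longrightarrow> (\<exists>\<delta>0>0. \<forall>\<delta>. 0 < \<delta> \<and> \<delta> < \<delta>0 \<longrightarrow>
            nash_equilibrium M F U (18 * \<epsilon>)
              (rho_star h rb (mu M F U \<epsilon> h rb tb P1) (mu M F U \<epsilon> h rb tb P2) \<delta> (sr P2 \<delta>))
              (tau_star h tb (mu M F U \<epsilon> h rb tb P1) (mu M F U \<epsilon> h rb tb P2) \<delta> (st P1 \<delta>))))
    \<and> (\<forall>\<epsilon>>0. \<exists>\<rho> \<tau>. nash_equilibrium M F U \<epsilon> \<rho> \<tau>)"
proof -
  interpret stopping_game M F U by (rule assms(1))
  obtain C where C: "game_payoff M F (U P1) r C" "game_payoff M F (\<lambda>s t. U P2 t s) r C"
    using game_payoffs[OF assms(2)] .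
  interpret bounded_stopping_game M F U r C
    by (intro bounded_stopping_game.intro bounded_stopping_game_axioms.intro assms(1) C)
  have candidate: "equilibrium_candidate M F U r C \<epsilon> h rb tb"
    if "0 < \<epsilon>" "0 < h" "grid_optimizers M F U \<epsilon> h rb tb" "small_grid M F U r \<epsilon> h rb tb" for \<epsilon> h rb tb
    using that by unfold_locales
  have "\<exists>\<rho> \<tau>. nash_equilibrium M F U \<eta> \<rho> \<tau>" if "0 < \<eta>" for \<eta> :: real
  proof -
    define \<epsilon> where "\<epsilon> = \<eta> / 18"
    have "0 < \<epsilon>" using that by (simp add: \<epsilon>_def)
    then obtain h rb tb where c: "equilibrium_candidate M F U r C \<epsilon> h rb tb" by (rule candidate_exists)
    \<comment> \<open>The result on candidates takes a family of saddle points indexed by player and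
      \<delta>; choice produces one from mere existence.\<close>
    define p where "p i \<delta> = (SOME p. saddle_point M F U \<epsilon> i (\<lambda>\<omega>. mu M F U \<epsilon> h rb tb i \<omega> + ennreal \<delta>) (fst p) (snd p))" for i \<delta>
    have p: "saddle_point M F U \<epsilon> i (\<lambda>\<omega>. mu M F U \<epsilon> h rb tb i \<omega> + ennreal \<delta>) (fst (p i \<delta>)) (snd (p i \<delta>))"
      if "0 < \<delta>" for i \<delta>
    proof -
      have "\<exists>p. saddle_point M F U \<epsilon> i (\<lambda>\<omega>. mu M F U \<epsilon> h rb tb i \<omega> + ennreal \<delta>) (fst p) (snd p)"
        using equilibrium_candidate.saddle_points_exist[OF c, of i \<delta>] by simp
      then show ?thesis unfolding p_def by (rule someI_ex)
    qed
    obtain \<delta>0 :: real where "0 < \<delta>0"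
      "\<And>\<delta>. 0 < \<delta> \<Longrightarrow> \<delta> < \<delta>0 \<Longrightarrow> \<exists>\<rho> \<tau>. nash_equilibrium M F U (18 * \<epsilon>) \<rho> \<tau>"
      using equilibrium_candidate.candidate_is_nash_equilibrium[OF c p] by blast
    then have "\<exists>\<rho> \<tau>. nash_equilibrium M F U (18 * \<epsilon>) \<rho> \<tau>" using dense by blast
    then show ?thesis by (simp add: \<epsilon>_def)
  qed
  note exists = this
  show ?thesis
  proof (intro conjI allI impI)
    fix \<epsilon> h :: real and rb tb sr st
    assume "0 < \<epsilon>" "0 < h" and *: "grid_optimizers M F U \<epsilon> h rb tb \<and> small_grid M F U r \<epsilon> h rb tb \<and>
      (\<forall>i. \<forall>\<delta>>0. saddle_point M F U \<epsilon> i (\<lambda>\<omega>. mu M F U \<epsilon> h rb tb i \<omega> + ennreal \<delta>) (sr i \<delta>) (st i \<delta>))"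
    then have c: "equilibrium_candidate M F U r C \<epsilon> h rb tb" by (intro candidate) auto
    show "\<exists>\<delta>0>0. \<forall>\<delta>. 0 < \<delta> \<and> \<delta> < \<delta>0 \<longrightarrow>
      nash_equilibrium M F U (18 * \<epsilon>)
        (rho_star h rb (mu M F U \<epsilon> h rb tb P1) (mu M F U \<epsilon> h rb tb P2) \<delta> (sr P2 \<delta>))
        (tau_star h tb (mu M F U \<epsilon> h rb tb P1) (mu M F U \<epsilon> h rb tb P2) \<delta> (st P1 \<delta>))"
      by (rule equilibrium_candidate.candidate_is_nash_equilibrium[OF c]) (use * in blast)
  qed (rule exists)
qed

end
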